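(* Let $\beta\ge 0$, $\mathbf n\in S^{d-1}$ and $\mathcal S\in\mathbb S_{\mathbf n}$. For any $\varepsilon>0$ and $\delta>0$, $$\limsup_{N\to\infty}\frac1{N^d}\log\mathbb P\Big(\tau^J_{\mathcal R_{0,N,\delta N}(\mathcal S,\mathbf n)}\ge\tau^q(\mathbf n)+\varepsilon\Big)<0.$$
   Context: Fix $d\ge 2$, $q\ge 1$, $\beta\ge 0$. For $x,y\in\mathbb Z^d$ write $x\sim y$ if $\|x-y\|_2=1$; for $\Lambda\subset\mathbb Z^d$ let $E(\Lambda)=\{\{x,y\}:x,y\in\Lambda,\ x\sim y\}$. The couplings $J=(J_e)_{e\in E(\mathbb Z^d)}$ are i.i.d. with values in $[0,1]$ under the product measure $\mathbb P$. Random cluster model: for finite $E\subset E(\mathbb Z^d)$, boundary condition $\pi\in\{0,1\}^{E^c}$ and $\omega\in\{0,1\}^E$, $\Phi^{J,\pi,q}_{E,\beta}(\{\omega\})=\frac1Z\prod_{e\in E}p_e^{\omega_e}(1-p_e)^{1-\omega_e}\,q^{C^\pi_E(\omega)}$ with $p_e=1-e^{-\beta J_e}$, where $C^\pi_E(\omega)$ is the number of clusters of the set of vertices touched by $E$ when connections use the open edges of $\omega$ in $E$ and of $\pi$ outside $E$, and $Z$ is the normalizing constant. The boundary condition $w$ (wired) is $\pi\equiv1$. Geometry: $S^{d-1}$ is the Euclidean unit sphere. For $\mathbf n\in S^{d-1}$, $\mathbb S_{\mathbf n}$ is the set of the $(d-1)$-dimensional unit cubes $\{\sum_{k=1}^{d-1}t_k\mathbf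 u_k: t_k\in[-\frac12,\frac12]\}$ with $(\mathbf u_1,\dots,\mathbf u_{d-1},\mathbf n)$ an orthonormal basis of $\mathbb R^d$. $\mathcal R_{x,L,H}(\mathcal S,\mathbf n)=x+L\mathcal S+[-H,H]\mathbf n$. For such $\mathcal R$, $\hat{\mathcal R}$ is the set of points of $\mathbb Z^d$ in the interior of $\mathcal R$; $\partial\hat{\mathcal R}=\{y\in\hat{\mathcal R}:\exists z\in\mathbb Z^d\setminus\hat{\mathcal R},\ z\sim y\}$; $\partial^+\hat{\mathcal R}=\{y\in\partial\hat{\mathcal R}:(y-x)\cdot\mathbf n\ge0\}$, $\partial^-\hat{\mathcal R}=\{y\in\partial\hat{\mathcal R}:(y-x)\cdot\mathbf n<0\}$. $\Phi^{J,w}_{\mathcal R}$ is $\Phi^{J,w,q}_{E(\hat{\mathcal R}),\beta}$. Surface tension: $\mathcal D_{\mathcal R}$ is the event that no $\omega$-open path in $E(\hat{\mathcal R})$ joins $\partial^+\hat{\mathcal R}$ to $\partial^-\hat{\mathcal R}$, and $\tau^J_{\mathcal R}=-\frac1{L^{d-1}}\log\Phi^{J,w}_{\mathcal R}(\mathcal D_{\mathcal R})$. The quenched surface tension $\tau^q(\mathbf n)=\tau^q_\beta(\mathbf n)$ is the limit in $\mathbb P$-probability of $\tau^J_{\mathcal R_{0,N,\delta N}(\mathcal S,\mathbf n)}$ as $N\to\infty$, which exists and does not depend on $\delta>0$ nor on $\mathcal S\in\mathbb S_{\mathbf n}$. *)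

theory Defs
  imports "HOL-Probability.Probability"
begin

text \<open>The dimension \<open>d\<close> is \<open>CARD('d)\<close>: sites of the lattice are vectors of type
  \<open>int ^ 'd\<close>, and \<^typ>\<open>real ^ 'd\<close> is the ambient Euclidean space.\<close>

type_synonym 'd site = "(int, 'd) vec"
type_synonym 'd edge = "(int, 'd) vec set"

definition emb :: "int ^ 'd \<Rightarrow> real ^ 'd" where
  "emb x = (\<chi> i. real_of_int (x $ i))"

definition adj :: "int ^ 'd \<Rightarrow> int ^ 'd \<Rightarrow> bool"  (infix \<open>\<sim>\<close> 50) where
  "x \<sim> y \<longleftrightarrow> norm (emb x - emb y) = 1"

definition edges :: "('d::finite) site set \<Rightarrow> 'd edge set" where
  "edges \<Lambda> = {{x, y} | x y. x \<in> \<Lambda> \<and> y \<in> \<Lambda> \<and> x \<sim> y}"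


section \<open>The random cluster model\<close>

text \<open>A configuration on \<open>E\<close> is an element of \<open>{0,1}\<^sup>E\<close>; open edges carry the value 1.
  \<open>open_links F \<eta>\<close> only looks at the values of \<open>\<eta>\<close> on the edges in \<open>F\<close>.\<close>

definition configs :: "'d edge set \<Rightarrow> ('d edge \<Rightarrow> nat) set" where
  "configs E = (E \<rightarrow>\<^sub>E {0, 1})"

definition open_links ::
    "'d edge set \<Rightarrow> ('d edge \<Rightarrow> nat) \<Rightarrow> ('d site \<times> 'd site) set" where
  "open_links F \<eta> = {(x, y). {x, y} \<in> F \<and> \<eta> {x, y} = 1}"

text \<open>The vertices touched by \<open>E\<close> are \<open>\<Union>E\<close>. They are partitioned by
  connectivity in the whole lattice.\<close>

definition num_clusters ::
    "('d::finite) edge set \<Rightarrow> ('d edge \<Rightarrow> nat) \<Rightarrow> ('d edge \<Rightarrow> nat) \<Rightarrow> nat" where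
  "num_clusters E \<pi> \<omega> =
     card (\<Union>E // {(x, y). x \<in> \<Union>E \<and> y \<in> \<Union>E \<and>
       (x, y) \<in> (open_links E \<omega> \<union> open_links (edges UNIV - E) \<pi>)\<^sup>*})"

definition edge_prob :: "real \<Rightarrow> ('d edge \<Rightarrow> real) \<Rightarrow> 'd edge \<Rightarrow> real" where
  "edge_prob \<beta> J e = 1 - exp (- \<beta> * J e)"

definition rc_weight ::
    "real \<Rightarrow> real \<Rightarrow> ('d::finite edge \<Rightarrow> real) \<Rightarrow> 'd edge set \<Rightarrow> ('d edge \<Rightarrow> nat)
      \<Rightarrow> ('d edge \<Rightarrow> nat) \<Rightarrow> real" where
  "rc_weight q \<beta> J E \<pi> \<omega> =
     (\<Prod>e\<in>E. edge_prob \<beta> J e ^ \<omega> e * (1 - edge_prob \<beta> J e) ^ (1 - \<omega> e))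
       * q ^ num_clusters E \<pi> \<omega>"

definition rc_measure ::
    "real \<Rightarrow> real \<Rightarrow> ('d::finite edge \<Rightarrow> real) \<Rightarrow> 'd edge set \<Rightarrow> ('d edge \<Rightarrow> nat)
      \<Rightarrow> ('d edge \<Rightarrow> nat) measure" where
  "rc_measure q \<beta> J E \<pi> = point_measure (configs E)
     (\<lambda>\<omega>. ennreal (rc_weight q \<beta> J E \<pi> \<omega> / (\<Sum>\<omega>'\<in>configs E. rc_weight q \<beta> J E \<pi> \<omega>')))"

definition wired :: "'d edge \<Rightarrow> nat" where
  "wired = (\<lambda>e. 1)"


section \<open>Geometry\<close>

text \<open>The vectors \<open>u\<^sub>1, \<dots>, u\<^sub>d\<^sub>-\<^sub>1, n\<close> are \<open>d\<close> orthonormal vectors of \<open>\<real>\<^sup>d\<close>, hence a basis.\<close>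

definition unit_cubes :: "real ^ 'd \<Rightarrow> (real ^ 'd) set set" where
  "unit_cubes n =
     {{\<Sum>k=1..CARD('d)-1. t k *\<^sub>R u k | t :: nat \<Rightarrow> real. \<forall>k\<in>{1..CARD('d)-1}. t k \<in> {-1/2..1/2}}
      | u :: nat \<Rightarrow> real ^ 'd.
        norm n = 1 \<and>
        (\<forall>k\<in>{1..CARD('d)-1}. norm (u k) = 1 \<and> u k \<bullet> n = 0) \<and>
        (\<forall>j\<in>{1..CARD('d)-1}. \<forall>k\<in>{1..CARD('d)-1}. j \<noteq> k \<longrightarrow> u j \<bullet> u k = 0)}"

definition rect ::
    "real ^ 'd \<Rightarrow> real \<Rightarrow> real \<Rightarrow> (real ^ 'd) set \<Rightarrow> real ^ 'd \<Rightarrow> (real ^ 'd) set" where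
  "rect x L H S n = {x + L *\<^sub>R s + h *\<^sub>R n | s h. s \<in> S \<and> h \<in> {-H..H}}"

definition sites :: "(real ^ 'd) set \<Rightarrow> (int ^ 'd) set" where
  "sites R = {y. emb y \<in> interior R}"

definition bdry :: "(int ^ 'd) set \<Rightarrow> (int ^ 'd) set" where
  "bdry \<Lambda> = {y \<in> \<Lambda>. \<exists>z. z \<notin> \<Lambda> \<and> z \<sim> y}"

definition bdry_plus :: "real ^ 'd \<Rightarrow> real ^ 'd \<Rightarrow> (int ^ 'd) set \<Rightarrow> (int ^ 'd) set" where
  "bdry_plus x n \<Lambda> = {y \<in> bdry \<Lambda>. (emb y - x) \<bullet> n \<ge> 0}"

definition bdry_minus :: "real ^ 'd \<Rightarrow> real ^ 'd \<Rightarrow> (int ^ 'd) set \<Rightarrow> (int ^ 'd) set" where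
  "bdry_minus x n \<Lambda> = {y \<in> bdry \<Lambda>. (emb y - x) \<bullet> n < 0}"


section \<open>Surface tension\<close>

definition disconnection ::
    "real ^ 'd \<Rightarrow> real \<Rightarrow> real \<Rightarrow> (real ^ 'd) set \<Rightarrow> real ^ 'd \<Rightarrow> (('d::finite) edge \<Rightarrow> nat) set" where
  "disconnection x L H S n = (let \<Lambda> = sites (rect x L H S n) in
     {\<omega> \<in> configs (edges \<Lambda>).
        \<not> (\<exists>y\<in>bdry_plus x n \<Lambda>. \<exists>z\<in>bdry_minus x n \<Lambda>. (y, z) \<in> (open_links (edges \<Lambda>) \<omega>)\<^sup>*)})"

text \<open>For couplings in \<open>[0,1]\<close> the probability below is positive, as the configuration with all
  edges closed is in the event, so the value of \<^const>\<open>ln\<close> at 0 plays no role.\<close>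

definition tau_J ::
    "real \<Rightarrow> real \<Rightarrow> (('d::finite) edge \<Rightarrow> real) \<Rightarrow> real ^ 'd \<Rightarrow> real \<Rightarrow> real \<Rightarrow> (real ^ 'd) set
      \<Rightarrow> real ^ 'd \<Rightarrow> real" where
  "tau_J q \<beta> J x L H S n = - (1 / L ^ (CARD('d) - 1)) *
     ln (measure (rc_measure q \<beta> J (edges (sites (rect x L H S n))) wired) (disconnection x L H S n))"

definition coupling_measure :: "real measure \<Rightarrow> ('d::finite edge \<Rightarrow> real) measure" where
  "coupling_measure \<rho> = PiM (edges UNIV) (\<lambda>_. \<rho>)"

definition tendsto_in_probability ::
    "'a measure \<Rightarrow> (nat \<Rightarrow> 'a \<Rightarrow> real) \<Rightarrow> real \<Rightarrow> bool" where
  "tendsto_in_probability M X t \<longleftrightarrow>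
     (\<forall>\<eta>>0. (\<lambda>N. measure M {\<omega> \<in> space M. \<bar>X N \<omega> - t\<bar> > \<eta>}) \<longlonglongrightarrow> 0)"

text \<open>The limit exists and depends neither on \<open>\<delta>\<close> nor on \<open>S\<close>, so that the description is proper.\<close>

definition tau_q :: "real measure \<Rightarrow> real \<Rightarrow> real \<Rightarrow> real ^ 'd \<Rightarrow> real" where
  "tau_q \<rho> q \<beta> n = (THE t. \<forall>\<delta>>0. \<forall>S\<in>unit_cubes n.
     tendsto_in_probability (coupling_measure \<rho> :: ('d edge \<Rightarrow> real) measure)
       (\<lambda>N J. tau_J q \<beta> J 0 (real N) (\<delta> * real N) S n) t)"

text \<open>The logarithm of a probability, with \<open>log 0 = -\<infinity>\<close> (whereas \<^const>\<open>ln\<close> is real-valued).\<close>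

definition log_prob :: "real \<Rightarrow> ereal" where
  "log_prob p = (if p = 0 then -\<infinity> else ereal (ln p))"

end

theory Submission
  imports Defs
begin

text \<open>
  An upper deviation of the surface tension is a deviation of many independent quantities at once,
  and their number is of the order of the volume.

  The event \<open>\<D>\<close> that an interface separates the two halves of the boundary is decreasing, and for
  \<open>q \<ge> 1\<close> decreasing events are least likely under wired boundary conditions. Consequently, a big
  box is separated at least as cheaply as by gluing interfaces of disjoint small boxes and closing the
  remaining edges in their common height, at a price of at most \<open>\<beta>\<close> per closed edge
  (\<open>cut_cost_subadditive\<close>). For boxes of width \<open>L\<close> arranged in a layer at height \<open>y\<close> inside a box of
  width \<open>N\<close>, the edges to be closed lie between the small boxes, near the lateral boundary, or on the
  lateral boundary between heights \<open>0\<close> and \<open>y\<close>; their proportion is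
  \<open>O(1/L + L/N + y/N)\<close> (\<open>slab_subadditive\<close>). A layer is built from boxes centred at lattice points,
  so that the costs of the small boxes are independent copies of one random variable.

  Using the layer at height \<open>0\<close> and taking expectations shows that
  \<open>N \<mapsto> E \<tau>\<^sub>N\<close> is almost decreasing, also when \<open>\<tau>\<^sub>N\<close> and \<open>\<tau>\<^sub>L\<close> belong to different cubes \<open>\<S>\<close> and
  different ratios \<open>\<delta>\<close> (\<open>mean_tau_le\<close>). Hence all these expectations converge to one number \<open>t\<close>.

  On the other hand, the interface may be placed in any layer at a height \<open>y \<le> \<kappa>N\<close> with a small
  constant \<open>\<kappa>\<close>. If \<open>\<tau>\<^sub>N \<ge> t + \<epsilon>\<close>, then in each of these order \<open>N\<close> disjoint layers the average of order
  \<open>N\<^sup>d\<^sup>-\<^sup>1\<close> independent copies of \<open>\<tau>\<^sub>L\<close> is too big, where \<open>L\<close> is fixed with \<open>E \<tau>\<^sub>L\<close> close to \<open>t\<close>. So the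
  average over all layers is too big, and by Hoeffding's inequality for order \<open>N\<^sup>d\<close> variables this
  has probability at most \<open>exp(-cN\<^sup>d)\<close> (\<open>upper_deviation\<close>).

  It remains to identify \<open>t\<close> with the quenched surface tension. The exponential bound shows that
  \<open>\<tau>\<^sub>N\<close> is rarely above \<open>t + \<eta>\<close>; as \<open>\<tau>\<^sub>N\<close> is bounded with expectations converging to \<open>t\<close>, it is then
  also rarely below \<open>t - \<eta>\<close>. Thus \<open>\<tau>\<^sub>N \<rightarrow> t\<close> in probability (\<open>tau_tendsto_in_probability\<close>, \<open>tau_q_eq\<close>).
\<close>

section \<open>The four functions theorem\<close>

text \<open>The one-point case of the four functions theorem. The two mixed products \<open>u\<close> and \<open>v\<close> are
  both at most \<open>x = c\<^sub>1 d\<^sub>0\<close>, and their product is at most \<open>x (c\<^sub>0 d\<^sub>1)\<close>; expanding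
  \<open>0 \<le> (x - u) (x - v)\<close> gives \<open>u + v \<le> x + c\<^sub>0 d\<^sub>1\<close>.\<close>
lemma four_numbers:
  fixes a0 a1 b0 b1 c0 c1 d0 d1 :: real
  assumes nn: "0 \<le> a0" "0 \<le> a1" "0 \<le> b0" "0 \<le> b1" "0 \<le> c0" "0 \<le> c1" "0 \<le> d0" "0 \<le> d1"
    and 00: "a0 * b0 \<le> c0 * d0" and 01: "a0 * b1 \<le> c1 * d0"
    and 10: "a1 * b0 \<le> c1 * d0" and 11: "a1 * b1 \<le> c1 * d1"
  shows "(a0 + a1) * (b0 + b1) \<le> (c0 + c1) * (d0 + d1)"
proof -
  define x u v where "x = c1 * d0" and "u = a0 * b1" and "v = a1 * b0"
  have uv: "0 \<le> u" "u \<le> x" "0 \<le> v" "v \<le> x"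
    using nn 01 10 by (auto simp: x_def u_def v_def)
  have "u + v \<le> x + c0 * d1"
  proof (cases "x = 0")
    case True
    then show ?thesis using uv nn by simp
  next
    case False
    then have "x > 0" using uv by simp
    have "u * v = (a0 * b0) * (a1 * b1)" by (simp add: u_def v_def)
    also have "\<dots> \<le> (c0 * d0) * (c1 * d1)"
      by (rule mult_mono[OF 00 11]) (use nn in auto)
    also have "\<dots> = x * (c0 * d1)" by (simp add: x_def)
    finally have "u * v \<le> x * (c0 * d1)" .
    moreover have "0 \<le> (x - u) * (x - v)" using uv by simp
    ultimately have "x * (u + v) \<le> x * (x + c0 * d1)" by (simp add: algebra_simps)
    then show ?thesis using \<open>x > 0\<close> by simp
  qed
  then show ?thesis using 00 11 by (simp add: x_def u_def v_def algebra_simps)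
qed

lemma sum_Pow_insert:
  assumes "finite F" "e \<notin> F"
  shows "(\<Sum>A\<in>Pow (insert e F). h A) = (\<Sum>A\<in>Pow F. h A + h (insert e A) :: real)"
proof -
  have "(\<Sum>A\<in>Pow (insert e F). h A) = (\<Sum>A\<in>Pow F. h A) + (\<Sum>A\<in>insert e ` Pow F. h A)"
    unfolding Pow_insert using assms by (intro sum.union_disjoint) auto
  also have "(\<Sum>A\<in>insert e ` Pow F. h A) = (\<Sum>A\<in>Pow F. h (insert e A))"
    using assms(2) by (intro sum.reindex[unfolded comp_def]) (auto simp: inj_on_def)
  finally show ?thesis by (simp add: sum.distrib)
qed

text \<open>The theorem of Ahlswede and Daykin. Summing the four functions over the presence of one
  element preserves the hypothesis by \<open>four_numbers\<close>, so the elements can be summed out one by one.\<close>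
theorem four_functions:
  fixes \<alpha> \<beta> \<gamma> \<delta> :: "'a set \<Rightarrow> real"
  assumes "finite F"
    and "\<And>A. A \<subseteq> F \<Longrightarrow> 0 \<le> \<alpha> A \<and> 0 \<le> \<beta> A \<and> 0 \<le> \<gamma> A \<and> 0 \<le> \<delta> A"
    and "\<And>A B. A \<subseteq> F \<Longrightarrow> B \<subseteq> F \<Longrightarrow> \<alpha> A * \<beta> B \<le> \<gamma> (A \<union> B) * \<delta> (A \<inter> B)"
  shows "(\<Sum>A\<in>Pow F. \<alpha> A) * (\<Sum>A\<in>Pow F. \<beta> A) \<le> (\<Sum>A\<in>Pow F. \<gamma> A) * (\<Sum>A\<in>Pow F. \<delta> A)"
  using assms
proof (induction F arbitrary: \<alpha> \<beta> \<gamma> \<delta> rule: finite_induct)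
  case empty
  then show ?case by force
next
  case (insert e F)
  show ?case
    unfolding sum_Pow_insert[OF insert.hyps]
  proof (rule insert.IH)
    fix A assume "A \<subseteq> F"
    then have "A \<subseteq> insert e F" "insert e A \<subseteq> insert e F" by auto
    from this[THEN insert.prems(1)]
    show "0 \<le> \<alpha> A + \<alpha> (insert e A) \<and> 0 \<le> \<beta> A + \<beta> (insert e A)
        \<and> 0 \<le> \<gamma> A + \<gamma> (insert e A) \<and> 0 \<le> \<delta> A + \<delta> (insert e A)"
      by simp
  next
    fix A B assume AB: "A \<subseteq> F" "B \<subseteq> F"
    then have e: "e \<notin> A" "e \<notin> B" using insert.hyps by auto
    have nn: "X \<subseteq> F \<Longrightarrow> 0 \<le> \<alpha> X" "X \<subseteq> F \<Longrightarrow> 0 \<le> \<beta> X" "X \<subseteq> F \<Longrightarrow> 0 \<le> \<gamma> X" "X \<subseteq> F \<Longrightarrow> 0 \<le> \<delta> X"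
      "X \<subseteq> F \<Longrightarrow> 0 \<le> \<alpha> (insert e X)" "X \<subseteq> F \<Longrightarrow> 0 \<le> \<beta> (insert e X)"
      "X \<subseteq> F \<Longrightarrow> 0 \<le> \<gamma> (insert e X)" "X \<subseteq> F \<Longrightarrow> 0 \<le> \<delta> (insert e X)" for X
      using insert.prems(1)[of X] insert.prems(1)[of "insert e X"] by auto
    have i: "A \<inter> insert e B = A \<inter> B" "insert e A \<inter> B = A \<inter> B"
      using e by auto
    show "(\<alpha> A + \<alpha> (insert e A)) * (\<beta> B + \<beta> (insert e B))
      \<le> (\<gamma> (A \<union> B) + \<gamma> (insert e (A \<union> B))) * (\<delta> (A \<inter> B) + \<delta> (insert e (A \<inter> B)))"
    proof (rule four_numbers)
      show "\<alpha> A * \<beta> B \<le> \<gamma> (A \<union> B) * \<delta> (A \<inter> B)" using AB by (intro insert.prems(2)) auto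
      show "\<alpha> A * \<beta> (insert e B) \<le> \<gamma> (insert e (A \<union> B)) * \<delta> (A \<inter> B)"
        using AB insert.prems(2)[of A "insert e B"] i by auto
      show "\<alpha> (insert e A) * \<beta> B \<le> \<gamma> (insert e (A \<union> B)) * \<delta> (A \<inter> B)"
        using AB insert.prems(2)[of "insert e A" B] i by auto
      show "\<alpha> (insert e A) * \<beta> (insert e B) \<le> \<gamma> (insert e (A \<union> B)) * \<delta> (insert e (A \<inter> B))"
        using AB insert.prems(2)[of "insert e A" "insert e B"] i by auto
    qed (use AB nn in \<open>auto simp: le_infI1\<close>)
  qed
qed

section \<open>Cluster counts\<close>

text \<open>A configuration is represented by its set of open edges, which makes the lattice operations
  on configurations plain union and intersection. \<open>cluster_count V G\<close> counts the clusters of the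
  configuration \<open>G\<close> that meet \<open>V\<close>.\<close>
definition links :: "'a set set \<Rightarrow> ('a \<times> 'a) set" where
  "links G = {(x, y). {x, y} \<in> G}"

definition cluster_count :: "'a set \<Rightarrow> 'a set set \<Rightarrow> nat" where
  "cluster_count V G = card (V // {(x, y). x \<in> V \<and> y \<in> V \<and> (x, y) \<in> (links G)\<^sup>*})"

lemma sym_links: "sym (links G)"
  by (auto simp: links_def sym_def insert_commute)

lemma links_mono: "G \<subseteq> H \<Longrightarrow> links G \<subseteq> links H"
  by (auto simp: links_def)

lemma cluster_count_alt: "cluster_count V G = card ((\<lambda>a. {b \<in> V. (a, b) \<in> (links G)\<^sup>*}) ` V)"
  unfolding cluster_count_def quotient_def
  by (rule arg_cong[of _ _ card]) (auto simp: Image_def)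

lemma rtrancl_links_insert:
  "(a, b) \<in> (links (insert {x, y} G))\<^sup>* \<longleftrightarrow>
     (a, b) \<in> (links G)\<^sup>* \<or> (a, x) \<in> (links G)\<^sup>* \<and> (y, b) \<in> (links G)\<^sup>*
       \<or> (a, y) \<in> (links G)\<^sup>* \<and> (x, b) \<in> (links G)\<^sup>*"
proof -
  have s: "(u, v) \<in> (links G)\<^sup>* \<longleftrightarrow> (v, u) \<in> (links G)\<^sup>*" for u v
    using sym_rtrancl[OF sym_links] by (meson symD)
  have "links (insert {x, y} G) = insert (x, y) (insert (y, x) (links G))"
    by (auto simp: links_def doubleton_eq_iff)
  then show ?thesis
    by (auto simp: rtrancl_insert intro: rtrancl_trans)
qed

text \<open>Opening an edge merges the clusters of its endpoints, if these are different.\<close>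
lemma cluster_count_insert:
  assumes fin: "finite V" and x: "x \<in> V" and y: "y \<in> V"
  shows "cluster_count V G = cluster_count V (insert {x, y} G) + (if (x, y) \<in> (links G)\<^sup>* then 0 else 1)"
proof -
  define c where "c a b \<longleftrightarrow> (a, b) \<in> (links G)\<^sup>*" for a b
  have s: "c u v \<longleftrightarrow> c v u" for u v
    using sym_rtrancl[OF sym_links] unfolding c_def by (meson symD)
  have t: "c u v \<Longrightarrow> c v w \<Longrightarrow> c u w" for u v w by (auto simp: c_def)
  have r: "c u u" for u by (auto simp: c_def)
  have ins: "(a, b) \<in> (links (insert {x, y} G))\<^sup>* \<longleftrightarrow> c a b \<or> c a x \<and> c y b \<or> c a y \<and> c x b" for a b
    unfolding rtrancl_links_insert c_def ..
  define f where "f a = {b \<in> V. c a b}" for a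
  define g where "g a = {b \<in> V. c a b \<or> c a x \<and> c y b \<or> c a y \<and> c x b}" for a
  have nf: "cluster_count V G = card (f ` V)" and ng: "cluster_count V (insert {x, y} G) = card (g ` V)"
    unfolding cluster_count_alt ins f_def g_def c_def by simp_all
  show ?thesis
  proof (cases "c x y")
    case True
    have "g = f" using True s t by (auto simp: f_def g_def fun_eq_iff)
    then show ?thesis using True by (simp add: nf ng c_def)
  next
    case False
    have feq: "f a = f b \<longleftrightarrow> c a b" if "b \<in> V" for a b
      using that s t r by (auto simp: f_def set_eq_iff)
    have g1: "g a = f x \<union> f y" if "c a x \<or> c a y" for a
      using that s t by (auto simp: f_def g_def)
    have g2: "g a = f a" if "\<not> (c a x \<or> c a y)" for a
      using that by (auto simp: f_def g_def)
    \<comment> \<open>The two clusters of the endpoints are replaced by their union, and the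
      others are kept.\<close>
    have img: "g ` V = insert (f x \<union> f y) (f ` V - {f x, f y})"
    proof (intro equalityI subsetI)
      fix s assume "s \<in> g ` V"
      then obtain a where a: "a \<in> V" "s = g a" by auto
      show "s \<in> insert (f x \<union> f y) (f ` V - {f x, f y})"
        using a g1[of a] g2[of a] feq[of x a] feq[of y a] x y by (cases "c a x \<or> c a y") auto
    next
      fix s assume "s \<in> insert (f x \<union> f y) (f ` V - {f x, f y})"
      then consider "s = f x \<union> f y" | a where "a \<in> V" "s = f a" "f a \<noteq> f x" "f a \<noteq> f y" by auto
      then show "s \<in> g ` V"
      proof cases
        case 1
        then have "s = g x" using g1[of x] r by simp
        then show ?thesis using x by blast
      next
        case 2
        then have "s = g a" using g2[of a] feq[of x a] feq[of y a] x y by auto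
        then show ?thesis using 2 by blast
      qed
    qed
    have new: "f x \<union> f y \<notin> f ` V - {f x, f y}"
    proof
      assume "f x \<union> f y \<in> f ` V - {f x, f y}"
      then obtain a where a: "a \<in> V" "f x \<union> f y = f a" "f a \<noteq> f x" by auto
      moreover have "x \<in> f x" using x r by (simp add: f_def)
      ultimately have "c a x" by (auto simp: f_def)
      then show False using a feq[of x a] x by simp
    qed
    have ne: "f x \<noteq> f y" using feq[of y x] y False by simp
    have "card (g ` V) = Suc (card (f ` V - {f x, f y}))"
      unfolding img using fin new by (subst card_insert_disjoint) auto
    also have "card (f ` V - {f x, f y}) = card (f ` V) - 2"
      using x y ne fin by (subst card_Diff_subset) auto
    finally have "card (g ` V) = Suc (card (f ` V) - 2)" .
    moreover have "card {f x, f y} \<le> card (f ` V)"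
      using fin x y by (intro card_mono) auto
    ultimately show ?thesis using False ne by (simp add: nf ng c_def)
  qed
qed

text \<open>An edge that merges two clusters of the larger configuration \<open>S\<close> also does so in the smaller
  configuration \<open>R\<close>. Therefore opening \<open>G\<close> destroys at least as many clusters in \<open>R\<close> as in \<open>S\<close>.
  The vertex sets \<open>V\<close> and \<open>W\<close> may differ, since only clusters that contain endpoints of \<open>G\<close> change;
  this allows a comparison of models on different edge sets.\<close>
lemma cluster_count_supermodular:
  assumes "finite G" "finite V" "finite W" "R \<subseteq> S"
    and "\<And>e. e \<in> G \<Longrightarrow> \<exists>x y. e = {x, y} \<and> x \<in> V \<inter> W \<and> y \<in> V \<inter> W"
  shows "cluster_count V (R \<union> G) + cluster_count W S \<le> cluster_count W (S \<union> G) + cluster_count V R"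
  using assms(1,5)
proof (induction G rule: finite_induct)
  case (insert e G)
  obtain x y where e: "e = {x, y}" "x \<in> V" "x \<in> W" "y \<in> V" "y \<in> W"
    using insert.prems[of e] by auto
  have *: "(links (R \<union> G))\<^sup>* \<subseteq> (links (S \<union> G))\<^sup>*"
    using assms(4) by (intro rtrancl_mono links_mono) auto
  have "cluster_count V (R \<union> G) + cluster_count W S \<le> cluster_count W (S \<union> G) + cluster_count V R"
    using insert by auto
  then show ?case
    using * cluster_count_insert[OF assms(2) e(2,4), of "R \<union> G"] cluster_count_insert[OF assms(3) e(3,5), of "S \<union> G"]
    by (auto simp: e(1) split: if_splits)
qed simp

section \<open>Decreasing events under wired boundary conditions\<close>

lemma edges_UNIV_D: "e \<in> edges UNIV \<Longrightarrow> \<exists>x y. e = {x, y}"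
  by (auto simp: edges_def)

lemma finite_Union_edges: "finite E \<Longrightarrow> E \<subseteq> edges UNIV \<Longrightarrow> finite (\<Union>E)"
  using edges_UNIV_D by fastforce

definition wired_weight :: "real \<Rightarrow> real \<Rightarrow> ('d::finite edge \<Rightarrow> real) \<Rightarrow> 'd edge set \<Rightarrow> 'd edge set \<Rightarrow> real" where
  "wired_weight q \<beta> J E X = (\<Prod>e\<in>E. if e \<in> X then edge_prob \<beta> J e else 1 - edge_prob \<beta> J e)
     * q ^ cluster_count (\<Union>E) (X \<union> (edges UNIV - E))"

text \<open>The probability of \<open>P\<close> under \<open>\<Phi>\<^sup>J\<^sup>,\<^sup>w\<^sub>E\<close>.\<close>
definition wired_prob ::
    "real \<Rightarrow> real \<Rightarrow> ('d::finite edge \<Rightarrow> real) \<Rightarrow> 'd edge set \<Rightarrow> ('d edge set \<Rightarrow> bool) \<Rightarrow> real" where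
  "wired_prob q \<beta> J E P = (\<Sum>X\<in>Pow E. if P X then wired_weight q \<beta> J E X else 0) / (\<Sum>X\<in>Pow E. wired_weight q \<beta> J E X)"

definition decreasing_event :: "('a set \<Rightarrow> bool) \<Rightarrow> bool" where
  "decreasing_event P \<longleftrightarrow> (\<forall>X Y. X \<subseteq> Y \<longrightarrow> P Y \<longrightarrow> P X)"

locale rc_params =
  fixes q \<beta> :: real
  assumes q: "q \<ge> 1" and \<beta>: "\<beta> \<ge> 0"
begin

lemma edge_prob_bounds:
  assumes "J e \<in> {0..1}"
  shows "0 \<le> edge_prob \<beta> J e" "edge_prob \<beta> J e < 1" "exp (-\<beta>) \<le> 1 - edge_prob \<beta> J e"
proof -
  have "0 \<le> \<beta> * J e" "\<beta> * J e \<le> \<beta> * 1"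
    using assms \<beta> by (auto simp del: mult_1_right intro!: mult_left_mono)
  then show "0 \<le> edge_prob \<beta> J e" "edge_prob \<beta> J e < 1" "exp (-\<beta>) \<le> 1 - edge_prob \<beta> J e"
    by (auto simp: edge_prob_def)
qed

lemma wired_weight_nonneg:
  assumes "J \<in> E \<rightarrow> {0..1}"
  shows "0 \<le> wired_weight q \<beta> J E X"
  unfolding wired_weight_def using assms edge_prob_bounds[of J] q
  by (intro mult_nonneg_nonneg prod_nonneg) (auto simp: less_imp_le Pi_iff)

lemma wired_weight_empty_pos:
  assumes "J \<in> E \<rightarrow> {0..1}"
  shows "0 < wired_weight q \<beta> J E {}"
  unfolding wired_weight_def using assms edge_prob_bounds[of J] q
  by (intro mult_pos_pos prod_pos) (auto simp: Pi_iff)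

lemma partition_function_pos:
  assumes "finite E" "J \<in> E \<rightarrow> {0..1}"
  shows "0 < (\<Sum>X\<in>Pow E. wired_weight q \<beta> J E X)"
  using assms by (intro sum_pos2[of _ "{}"] wired_weight_nonneg wired_weight_empty_pos) auto

lemma wired_prob_pos:
  assumes "finite E" "J \<in> E \<rightarrow> {0..1}" "P {}"
  shows "0 < wired_prob q \<beta> J E P"
proof -
  have "0 < (\<Sum>X\<in>Pow E. if P X then wired_weight q \<beta> J E X else 0)"
    using assms by (intro sum_pos2[of _ "{}"]) (auto intro: wired_weight_nonneg wired_weight_empty_pos)
  then show ?thesis using partition_function_pos[OF assms(1,2)] by (simp add: wired_prob_def)
qed

lemma wired_prob_nonneg:
  assumes "J \<in> E \<rightarrow> {0..1}"
  shows "0 \<le> wired_prob q \<beta> J E P"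
  unfolding wired_prob_def using wired_weight_nonneg[OF assms]
  by (intro divide_nonneg_nonneg sum_nonneg) auto

lemma wired_prob_mono:
  assumes "finite E" "J \<in> E \<rightarrow> {0..1}" "\<And>X. X \<subseteq> E \<Longrightarrow> P X \<Longrightarrow> Q X"
  shows "wired_prob q \<beta> J E P \<le> wired_prob q \<beta> J E Q"
  unfolding wired_prob_def using partition_function_pos[OF assms(1,2)] assms
  by (intro divide_right_mono sum_mono) (auto intro: wired_weight_nonneg less_imp_le)

lemma wired_prob_True:
  assumes "finite E" "J \<in> E \<rightarrow> {0..1}"
  shows "wired_prob q \<beta> J E (\<lambda>_. True) = 1"
  using partition_function_pos[OF assms] by (simp add: wired_prob_def)

lemma wired_prob_le_1:
  assumes "finite E" "J \<in> E \<rightarrow> {0..1}"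
  shows "wired_prob q \<beta> J E P \<le> 1"
  using wired_prob_mono[OF assms, of P "\<lambda>_. True"] wired_prob_True[OF assms] by simp

text \<open>The lattice condition behind all correlation inequalities used below. The Bernoulli factors
  on the two sides agree; the inequality comes from \<open>cluster_count_supermodular\<close> and \<open>q \<ge> 1\<close>. The
  configuration \<open>X\<close> is fully open outside \<open>E'\<close> and thus stands for a configuration on \<open>E'\<close> with
  wired boundary condition.\<close>
lemma wired_weight_lattice:
  assumes fin: "finite E" and E: "E \<subseteq> edges UNIV" and E': "E' \<subseteq> E"
    and J: "J \<in> E \<rightarrow> {0..1}"
    and X: "X \<subseteq> E" "E - E' \<subseteq> X" and Y: "Y \<subseteq> E"
  shows "wired_weight q \<beta> J E' (X \<inter> E') * wired_weight q \<beta> J E Y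
    \<le> wired_weight q \<beta> J E' ((X \<union> Y) \<inter> E') * wired_weight q \<beta> J E (X \<inter> Y)"
proof -
  define w where "w Z e = (if e \<in> Z then edge_prob \<beta> J e else 1 - edge_prob \<beta> J e)" for Z e
  define U :: "'a edge set" where "U = edges UNIV"
  have split: "prod f E = prod f (E - E') * prod f E'" for f :: "'a edge \<Rightarrow> real"
    using prod.subset_diff[OF E' fin] .
  have out: "prod (w Y) (E - E') = prod (w (X \<inter> Y)) (E - E')"
    using X by (intro prod.cong) (auto simp: w_def)
  have inn: "prod (w (X \<inter> E')) E' * prod (w Y) E' = prod (w ((X \<union> Y) \<inter> E')) E' * prod (w (X \<inter> Y)) E'"
    unfolding prod.distrib[symmetric] by (intro prod.cong) (auto simp: w_def)
  have prods: "prod (w (X \<inter> E')) E' * prod (w Y) E = prod (w ((X \<union> Y) \<inter> E')) E' * prod (w (X \<inter> Y)) E"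
    unfolding split out using inn by (simp add: algebra_simps)
  have "cluster_count (\<Union>E) ((X \<inter> Y \<union> (U - E)) \<union> (Y - X)) + cluster_count (\<Union>E') (X \<inter> E' \<union> (U - E'))
    \<le> cluster_count (\<Union>E') ((X \<inter> E' \<union> (U - E')) \<union> (Y - X)) + cluster_count (\<Union>E) (X \<inter> Y \<union> (U - E))"
  proof (rule cluster_count_supermodular)
    show "finite (Y - X)" using Y fin finite_subset by blast
    show "finite (\<Union>E)" using finite_Union_edges fin E by blast
    show "finite (\<Union>E')" using finite_Union_edges fin E E' by (meson finite_subset order_trans)
    show "X \<inter> Y \<union> (U - E) \<subseteq> X \<inter> E' \<union> (U - E')"
      using X E E' by (auto simp: U_def)
    fix e assume e: "e \<in> Y - X"
    then have "e \<in> E'" "e \<in> E" using X Y by auto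
    then show "\<exists>x y. e = {x, y} \<and> x \<in> \<Union> E \<inter> \<Union> E' \<and> y \<in> \<Union> E \<inter> \<Union> E'"
      using edges_UNIV_D[of e] E by blast
  qed
  moreover have "(X \<inter> Y \<union> (U - E)) \<union> (Y - X) = Y \<union> (U - E)" by auto
  moreover have "(X \<inter> E' \<union> (U - E')) \<union> (Y - X) = (X \<union> Y) \<inter> E' \<union> (U - E')"
    using X Y by auto
  ultimately have "q ^ (cluster_count (\<Union>E') (X \<inter> E' \<union> (U - E')) + cluster_count (\<Union>E) (Y \<union> (U - E)))
    \<le> q ^ (cluster_count (\<Union>E') ((X \<union> Y) \<inter> E' \<union> (U - E')) + cluster_count (\<Union>E) (X \<inter> Y \<union> (U - E)))"
    using q by (intro power_increasing) auto
  moreover have "0 \<le> prod (w ((X \<union> Y) \<inter> E')) E' * prod (w (X \<inter> Y)) E"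
    using J edge_prob_bounds[of J] E'
    by (intro mult_nonneg_nonneg prod_nonneg) (auto simp: w_def less_imp_le subset_iff Pi_iff)
  ultimately have "prod (w (X \<inter> E')) E' * prod (w Y) E
        * q ^ (cluster_count (\<Union>E') (X \<inter> E' \<union> (U - E')) + cluster_count (\<Union>E) (Y \<union> (U - E)))
    \<le> prod (w ((X \<union> Y) \<inter> E')) E' * prod (w (X \<inter> Y)) E
        * q ^ (cluster_count (\<Union>E') ((X \<union> Y) \<inter> E' \<union> (U - E')) + cluster_count (\<Union>E) (X \<inter> Y \<union> (U - E)))"
    unfolding prods by (rule mult_left_mono)
  then show ?thesis
    by (simp add: wired_weight_def w_def U_def power_add algebra_simps)
qed

text \<open>Restricting to a smaller edge set with wired boundary condition makes a decreasing event less
  likely, even conditionally on a further decreasing event. The usual proof combines the spatial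
  Markov property, monotonicity in the boundary condition and the FKG inequality; a single application of
  the four functions theorem gives all of it.\<close>
theorem wired_prob_decreasing_product:
  assumes fin: "finite E" and E: "E \<subseteq> edges UNIV" and E': "E' \<subseteq> E"
    and J: "J \<in> E \<rightarrow> {0..1}"
    and A: "decreasing_event A" and B: "decreasing_event B"
  shows "wired_prob q \<beta> J E' A * wired_prob q \<beta> J E B \<le> wired_prob q \<beta> J E (\<lambda>X. A (X \<inter> E') \<and> B X)"
proof -
  \<comment> \<open>A function of configurations on \<open>E'\<close> is transported to
    configurations on \<open>E\<close> that are fully open outside \<open>E'\<close>.\<close>
  define ext where "ext h X = (if E - E' \<subseteq> X then h (X \<inter> E') else 0)"
    for h :: "'a edge set \<Rightarrow> real" and X
  have fin': "finite E'" using fin E' finite_subset by blast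
  have J': "J \<in> E' \<rightarrow> {0..1}" using J E' by auto
  have ext: "(\<Sum>X\<in>Pow E. ext h X) = (\<Sum>X\<in>Pow E'. h X)" for h
  proof -
    have "(\<Sum>X\<in>Pow E'. h X) = (\<Sum>X\<in>{X\<in>Pow E. E - E' \<subseteq> X}. h (X \<inter> E'))"
      by (rule sum.reindex_bij_witness[where j = "\<lambda>X. X \<union> (E - E')" and i = "\<lambda>X. X \<inter> E'"])
        (use E' in \<open>auto intro!: arg_cong[where f = h]\<close>)
    also have "\<dots> = (\<Sum>X\<in>Pow E. ext h X)"
      unfolding ext_def by (rule sum.inter_filter) (use fin in simp)
    finally show ?thesis ..
  qed
  define a where "a X = (if A X then wired_weight q \<beta> J E' X else 0)" for X
  define b where "b X = (if B X then wired_weight q \<beta> J E X else 0)" for X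
  define ab where "ab X = (if A (X \<inter> E') \<and> B X then wired_weight q \<beta> J E X else 0)" for X
  have "(\<Sum>X\<in>Pow E. ext a X) * (\<Sum>X\<in>Pow E. b X)
    \<le> (\<Sum>X\<in>Pow E. ext (wired_weight q \<beta> J E') X) * (\<Sum>X\<in>Pow E. ab X)"
  proof (rule four_functions)
    fix X Y assume X: "X \<subseteq> E" and Y: "Y \<subseteq> E"
    have nn: "0 \<le> ext (wired_weight q \<beta> J E') (X \<union> Y) * ab (X \<inter> Y)"
      using J J' by (auto simp: ext_def ab_def intro!: mult_nonneg_nonneg wired_weight_nonneg)
    show "ext a X * b Y \<le> ext (wired_weight q \<beta> J E') (X \<union> Y) * ab (X \<inter> Y)"
    proof (cases "E - E' \<subseteq> X \<and> A (X \<inter> E') \<and> B Y")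
      case True
      then have "A (X \<inter> Y \<inter> E')" "B (X \<inter> Y)"
        using A B unfolding decreasing_event_def by (meson Int_lower1 Int_lower2 Int_mono subset_refl)+
      then show ?thesis
        using True wired_weight_lattice[OF fin E E' J X _ Y] by (auto simp: ext_def a_def b_def ab_def)
    next
      case False
      then have "ext a X * b Y = 0" by (auto simp: ext_def a_def b_def)
      then show ?thesis using nn by (rule ord_eq_le_trans)
    qed
  next
    fix X
    show "0 \<le> ext a X \<and> 0 \<le> b X \<and> 0 \<le> ext (wired_weight q \<beta> J E') X \<and> 0 \<le> ab X"
      using J J' by (auto simp: ext_def a_def b_def ab_def intro!: wired_weight_nonneg)
  qed (fact fin)
  then have "(\<Sum>X\<in>Pow E'. a X) * (\<Sum>X\<in>Pow E. b X) \<le> (\<Sum>X\<in>Pow E'. wired_weight q \<beta> J E' X) * (\<Sum>X\<in>Pow E. ab X)"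
    unfolding ext .
  then show ?thesis
    using partition_function_pos[OF fin J] partition_function_pos[OF fin' J']
    unfolding wired_prob_def a_def b_def ab_def by (simp add: field_simps)
qed

text \<open>Opening the edge cannot increase the number of clusters, so with \<open>q \<ge> 1\<close> it is closed at least
  as often as under independent percolation.\<close>
lemma wired_prob_closed_edge:
  assumes "e \<in> edges UNIV" "J e \<in> {0..1}"
  shows "exp (-\<beta>) \<le> wired_prob q \<beta> J {e} (\<lambda>X. e \<notin> X)"
proof -
  obtain x y where e: "e = {x, y}" using edges_UNIV_D[OF assms(1)] by auto
  define p where "p = edge_prob \<beta> J e"
  define c0 c1 where "c0 = cluster_count e (edges UNIV - {e})" and "c1 = cluster_count e (insert e (edges UNIV - {e}))"
  have p: "0 \<le> p" "p < 1" "exp (-\<beta>) \<le> 1 - p"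
    using edge_prob_bounds[where J = J and e = e] assms(2) by (auto simp: p_def)
  have "c1 \<le> c0"
    using cluster_count_insert[of e x y "edges UNIV - {e}"] by (auto simp: c0_def c1_def e)
  then have c: "q ^ c1 \<le> q ^ c0" using q by (intro power_increasing) auto
  have "Pow {e} = {{}, {e}}" by auto
  then have eq: "wired_prob q \<beta> J {e} (\<lambda>X. e \<notin> X) = (1 - p) * q ^ c0 / ((1 - p) * q ^ c0 + p * q ^ c1)"
    by (simp add: wired_prob_def wired_weight_def p_def c0_def c1_def)
  have "(1 - p) * q ^ c0 + p * q ^ c1 \<le> (1 - p) * q ^ c0 + p * q ^ c0"
    using c p by (intro add_left_mono mult_left_mono) auto
  then have le: "(1 - p) * q ^ c0 + p * q ^ c1 \<le> q ^ c0" by (simp add: algebra_simps)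
  have pos: "0 < (1 - p) * q ^ c0 + p * q ^ c1"
    using p q by (intro add_pos_nonneg mult_pos_pos) auto
  have "1 - p = (1 - p) * q ^ c0 / q ^ c0" using q by simp
  also have "\<dots> \<le> (1 - p) * q ^ c0 / ((1 - p) * q ^ c0 + p * q ^ c1)"
    using le pos p q by (intro divide_left_mono) auto
  finally show ?thesis using p eq by simp
qed

lemma wired_prob_closed_edges:
  assumes fin: "finite E" and E: "E \<subseteq> edges UNIV"
    and J: "J \<in> E \<rightarrow> {0..1}" and "F \<subseteq> E"
  shows "exp (-\<beta> * card F) \<le> wired_prob q \<beta> J E (\<lambda>X. X \<inter> F = {})"
proof -
  have "finite F" using assms finite_subset by blast
  then show ?thesis using \<open>F \<subseteq> E\<close>
  proof (induction F rule: finite_induct)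
    case empty
    then show ?case using wired_prob_True[OF fin J] by simp
  next
    case (insert e F)
    have closed: "exp (-\<beta>) \<le> wired_prob q \<beta> J {e} (\<lambda>X. e \<notin> X)"
      using insert.prems J E by (intro wired_prob_closed_edge) auto
    have "exp (-\<beta>) * exp (-\<beta> * card F) \<le> wired_prob q \<beta> J {e} (\<lambda>X. e \<notin> X) * wired_prob q \<beta> J E (\<lambda>X. X \<inter> F = {})"
      using insert closed by (intro mult_mono order_trans[OF exp_ge_zero closed]) auto
    also have "\<dots> \<le> wired_prob q \<beta> J E (\<lambda>X. e \<notin> X \<inter> {e} \<and> X \<inter> F = {})"
      using insert J E fin
      by (intro wired_prob_decreasing_product) (auto simp: decreasing_event_def)
    also have "(\<lambda>X. e \<notin> X \<inter> {e} \<and> X \<inter> F = {}) = (\<lambda>X. X \<inter> insert e F = {})" by auto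
    also have "exp (-\<beta>) * exp (-\<beta> * card F) = exp (-\<beta> * card (insert e F))"
      using insert by (simp add: algebra_simps flip: exp_add)
    finally show ?case .
  qed
qed

theorem wired_prob_local_events:
  assumes fin: "finite E" and E: "E \<subseteq> edges UNIV"
    and J: "J \<in> E \<rightarrow> {0..1}" and F: "F \<subseteq> E"
    and I: "finite I" "\<And>i. i \<in> I \<Longrightarrow> E' i \<subseteq> E" "\<And>i. i \<in> I \<Longrightarrow> decreasing_event (A i)"
  shows "exp (-\<beta> * card F) * (\<Prod>i\<in>I. wired_prob q \<beta> J (E' i) (A i))
    \<le> wired_prob q \<beta> J E (\<lambda>X. (\<forall>i\<in>I. A i (X \<inter> E' i)) \<and> X \<inter> F = {})"
  using I
proof (induction I rule: finite_induct)
  case empty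
  then show ?case using wired_prob_closed_edges[OF fin E J F] by simp
next
  case (insert i I)
  let ?B = "\<lambda>X. (\<forall>i\<in>I. A i (X \<inter> E' i)) \<and> X \<inter> F = {}"
  have "J \<in> E' i \<rightarrow> {0..1}" using insert.prems J by blast
  then have "0 \<le> wired_prob q \<beta> J (E' i) (A i)" by (rule wired_prob_nonneg)
  then have "wired_prob q \<beta> J (E' i) (A i) * (exp (-\<beta> * card F) * (\<Prod>i\<in>I. wired_prob q \<beta> J (E' i) (A i)))
    \<le> wired_prob q \<beta> J (E' i) (A i) * wired_prob q \<beta> J E ?B"
    using insert by (intro mult_left_mono) auto
  also have "\<dots> \<le> wired_prob q \<beta> J E (\<lambda>X. A i (X \<inter> E' i) \<and> ?B X)"
  proof (rule wired_prob_decreasing_product[OF fin E _ J])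
    show "decreasing_event ?B"
      unfolding decreasing_event_def
    proof (intro allI impI)
      fix X Y assume XY: "X \<subseteq> Y" and Y: "?B Y"
      have "A j (X \<inter> E' j)" if "j \<in> I" for j
      proof -
        have "decreasing_event (A j)" "A j (Y \<inter> E' j)" using that Y insert.prems by auto
        then show ?thesis using XY unfolding decreasing_event_def by (meson Int_mono subset_refl)
      qed
      then show "?B X" using XY Y by auto
    qed
  qed (use insert.prems in auto)
  finally show ?case using insert.hyps by (simp add: algebra_simps conj_assoc)
qed

end

section \<open>Cuts of a box and their cost\<close>

lemma adj_sym: "x \<sim> y \<longleftrightarrow> y \<sim> x"
  by (simp add: adj_def norm_minus_commute)

lemma edgesD: "{x, y} \<in> edges \<Lambda> \<Longrightarrow> x \<in> \<Lambda> \<and> y \<in> \<Lambda> \<and> x \<sim> y"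
  by (auto simp: edges_def doubleton_eq_iff adj_sym)

lemma edgesI: "x \<in> \<Lambda> \<Longrightarrow> y \<in> \<Lambda> \<Longrightarrow> x \<sim> y \<Longrightarrow> {x, y} \<in> edges \<Lambda>"
  by (auto simp: edges_def)

lemma edges_mono: "A \<subseteq> B \<Longrightarrow> edges A \<subseteq> edges B"
  by (auto simp: edges_def)

lemma finite_edges: "finite \<Lambda> \<Longrightarrow> finite (edges \<Lambda>)"
  by (rule finite_subset[of _ "Pow \<Lambda>"]) (auto simp: edges_def)

lemma edges_subset_UNIV: "edges \<Lambda> \<subseteq> edges UNIV"
  by (rule edges_mono) simp

text \<open>The event \<open>\<D>\<close> in terms of the set of open edges.\<close>
definition cut :: "real ^ 'd \<Rightarrow> real ^ 'd \<Rightarrow> 'd site set \<Rightarrow> ('d::finite) edge set \<Rightarrow> bool" where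
  "cut x n \<Lambda> X \<longleftrightarrow> \<not> (\<exists>y\<in>bdry_plus x n \<Lambda>. \<exists>z\<in>bdry_minus x n \<Lambda>. (y, z) \<in> (links X)\<^sup>*)"

lemma decreasing_cut: "decreasing_event (cut x n \<Lambda>)"
  unfolding decreasing_event_def cut_def
  by (meson links_mono rtrancl_mono subsetD)

lemma cut_empty: "cut x n \<Lambda> {}"
  by (auto simp: cut_def links_def bdry_plus_def bdry_minus_def)

text \<open>Local interfaces glue to a global one. The static label \<open>\<sigma>\<close> assigns each site to one of the two
  sides: inside a block according to the height relative to the centre of the block, on the boundary of \<open>\<Lambda>\<close>
  according to the height relative to \<open>x\<close>, and arbitrarily elsewhere. If every open edge with
  endpoints of different labels lies in a block, then the local cuts separate the two sides.\<close>
lemma cut_from_local_cuts: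
  assumes disj: "\<And>i j. i \<in> I \<Longrightarrow> j \<in> I \<Longrightarrow> i \<noteq> j \<Longrightarrow> B i \<inter> B j = {}"
    and inside: "\<And>i. i \<in> I \<Longrightarrow> B i \<inter> bdry \<Lambda> = {}"
    and loc: "\<And>i y. i \<in> I \<Longrightarrow> y \<in> B i \<Longrightarrow> \<sigma> y \<longleftrightarrow> (emb y - z i) \<bullet> n \<ge> 0"
    and glob: "\<And>y. y \<in> bdry \<Lambda> \<Longrightarrow> \<sigma> y \<longleftrightarrow> (emb y - x) \<bullet> n \<ge> 0"
    and X: "X \<subseteq> edges \<Lambda>"
    and cuts: "\<And>i. i \<in> I \<Longrightarrow> cut (z i) n (B i) (X \<inter> edges (B i))"
    and closed: "\<And>u v. {u, v} \<in> X \<Longrightarrow> \<sigma> u \<Longrightarrow> \<not> \<sigma> v \<Longrightarrow> \<exists>i\<in>I. {u, v} \<subseteq> B i"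
  shows "cut x n \<Lambda> X"
proof -
  \<comment> \<open>The dynamic label \<open>l\<close> moves the local interfaces into the
    blocks: a site of a block is on the upper side if it is connected to the upper boundary of the
    block inside the block. The local cuts say that on the boundaries of the blocks the dynamic
    label agrees with the static one.\<close>
  define reach where "reach i v \<longleftrightarrow>
    (\<exists>y\<in>bdry_plus (z i) n (B i). (y, v) \<in> (links (X \<inter> edges (B i)))\<^sup>*)" for i v
  define l where "l v \<longleftrightarrow> (if \<exists>i\<in>I. v \<in> B i then \<exists>i\<in>I. v \<in> B i \<and> reach i v else \<sigma> v)" for v
  have l_in: "l v \<longleftrightarrow> reach i v" if "i \<in> I" "v \<in> B i" for i v
    using that disj unfolding l_def by (auto simp: disjoint_iff)
  have l_bdry: "l w = \<sigma> w" if w: "\<And>i. i \<in> I \<Longrightarrow> w \<in> B i \<Longrightarrow> w \<in> bdry (B i)" for w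
  proof (cases "\<exists>i\<in>I. w \<in> B i")
    case True
    then obtain i where i: "i \<in> I" "w \<in> B i" by auto
    have "reach i w \<longleftrightarrow> \<sigma> w"
    proof (cases "\<sigma> w")
      case True
      then have "w \<in> bdry_plus (z i) n (B i)"
        using w[OF i] loc[OF i] by (simp add: bdry_plus_def)
      then show ?thesis using True by (auto simp: reach_def)
    next
      case False
      then have "w \<in> bdry_minus (z i) n (B i)"
        using w[OF i] loc[OF i] by (auto simp: bdry_minus_def)
      then show ?thesis using False cuts[OF i(1)] by (auto simp: reach_def cut_def)
    qed
    then show ?thesis using l_in[OF i] by simp
  qed (simp add: l_def)
  have step: "l v" if "(u, v) \<in> links X" "l u" for u v
  proof (cases "\<exists>i\<in>I. {u, v} \<subseteq> B i")
    case True
    then obtain i where i: "i \<in> I" "u \<in> B i" "v \<in> B i" by auto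
    have uv: "{u, v} \<in> X" using that by (simp add: links_def)
    then have "{u, v} \<in> X \<inter> edges (B i)"
      using X i edgesD[of u v \<Lambda>] edgesI[of u "B i" v] by auto
    then have "(u, v) \<in> links (X \<inter> edges (B i))" by (simp add: links_def)
    moreover have "reach i u" using that l_in i by simp
    ultimately have "reach i v" unfolding reach_def by (meson rtrancl.rtrancl_into_rtrancl)
    then show ?thesis using l_in i by simp
  next
    case False
    have uv: "{u, v} \<in> X" "u \<sim> v" "v \<sim> u"
      using that X edgesD[of u v \<Lambda>] by (auto simp: links_def adj_sym)
    have "l u = \<sigma> u" using False uv by (intro l_bdry) (auto simp: bdry_def)
    moreover have "l v = \<sigma> v" using False uv by (intro l_bdry) (auto simp: bdry_def)
    ultimately show ?thesis using that closed[OF uv(1)] False by blast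
  qed
  have path: "l v" if "(u, v) \<in> (links X)\<^sup>*" "l u" for u v
    using that by (induction rule: rtrancl_induct) (auto intro: step)
  have l_glob: "l y = \<sigma> y" if "y \<in> bdry \<Lambda>" for y
    using that inside unfolding l_def by (auto simp: disjoint_iff)
  show ?thesis
    unfolding cut_def bdry_plus_def bdry_minus_def
    using path l_glob glob by (auto simp: not_less[symmetric])
qed

text \<open>The surface tension before normalization by the area (see \<open>tau_J_eq_cut_cost\<close>).\<close>
definition cut_cost ::
    "real \<Rightarrow> real \<Rightarrow> ('d::finite edge \<Rightarrow> real) \<Rightarrow> real ^ 'd \<Rightarrow> real ^ 'd \<Rightarrow> 'd site set \<Rightarrow> real" where
  "cut_cost q \<beta> J x n \<Lambda> = - ln (wired_prob q \<beta> J (edges \<Lambda>) (cut x n \<Lambda>))"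

context rc_params
begin

lemma cut_cost_nonneg:
  assumes "finite \<Lambda>" "J \<in> edges \<Lambda> \<rightarrow> {0..1}"
  shows "0 \<le> cut_cost q \<beta> J x n \<Lambda>"
  using wired_prob_le_1[OF finite_edges[OF assms(1)] assms(2), of "cut x n \<Lambda>"]
    wired_prob_pos[OF finite_edges[OF assms(1)] assms(2), of "cut x n \<Lambda>"] cut_empty[of x n \<Lambda>]
  by (simp add: cut_cost_def)

text \<open>The deterministic core: \<open>F\<close> consists of the edges that have to be closed in addition to the local
  cuts, and each of them costs at most \<open>\<beta>\<close>.\<close>
theorem cut_cost_subadditive:
  assumes fin: "finite \<Lambda>" "finite I" and J: "J \<in> edges \<Lambda> \<rightarrow> {0..1}"
    and sub: "\<And>i. i \<in> I \<Longrightarrow> B i \<subseteq> \<Lambda> - bdry \<Lambda>"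
    and disj: "\<And>i j. i \<in> I \<Longrightarrow> j \<in> I \<Longrightarrow> i \<noteq> j \<Longrightarrow> B i \<inter> B j = {}"
    and loc: "\<And>i y. i \<in> I \<Longrightarrow> y \<in> B i \<Longrightarrow> \<sigma> y \<longleftrightarrow> (emb y - z i) \<bullet> n \<ge> 0"
    and glob: "\<And>y. y \<in> bdry \<Lambda> \<Longrightarrow> \<sigma> y \<longleftrightarrow> (emb y - x) \<bullet> n \<ge> 0"
  defines "F \<equiv> {{u, v} | u v. {u, v} \<in> edges \<Lambda> \<and> \<sigma> u \<and> \<not> \<sigma> v \<and> (\<forall>i\<in>I. \<not> {u, v} \<subseteq> B i)}"
  shows "cut_cost q \<beta> J x n \<Lambda> \<le> (\<Sum>i\<in>I. cut_cost q \<beta> J (z i) n (B i)) + \<beta> * card F"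
proof -
  let ?E = "edges \<Lambda>"
  have finE: "finite ?E" using fin finite_edges by blast
  have J': "J \<in> edges (B i) \<rightarrow> {0..1}" if "i \<in> I" for i
  proof -
    have "edges (B i) \<subseteq> edges \<Lambda>" using sub[OF that] by (intro edges_mono) auto
    then show ?thesis using J by (auto simp: Pi_iff)
  qed
  have finE': "finite (edges (B i))" if "i \<in> I" for i
    using finite_edges fin sub[OF that] finite_subset by blast
  have pos: "0 < wired_prob q \<beta> J (edges (B i)) (cut (z i) n (B i))" if "i \<in> I" for i
    using wired_prob_pos[OF finE' J'] that cut_empty by blast
  have prodpos: "0 < (\<Prod>i\<in>I. wired_prob q \<beta> J (edges (B i)) (cut (z i) n (B i)))"
    using pos by (intro prod_pos) auto
  have "exp (-\<beta> * card F) * (\<Prod>i\<in>I. wired_prob q \<beta> J (edges (B i)) (cut (z i) n (B i)))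
    \<le> wired_prob q \<beta> J ?E (\<lambda>X. (\<forall>i\<in>I. cut (z i) n (B i) (X \<inter> edges (B i))) \<and> X \<inter> F = {})"
    using sub by (intro wired_prob_local_events finE edges_subset_UNIV J fin decreasing_cut edges_mono)
      (auto simp: F_def)
  also have "\<dots> \<le> wired_prob q \<beta> J ?E (cut x n \<Lambda>)"
  proof (rule wired_prob_mono[OF finE J])
    fix X assume X: "X \<subseteq> ?E" and c: "(\<forall>i\<in>I. cut (z i) n (B i) (X \<inter> edges (B i))) \<and> X \<inter> F = {}"
    have closed: "\<exists>i\<in>I. {u, v} \<subseteq> B i" if "{u, v} \<in> X" "\<sigma> u" "\<not> \<sigma> v" for u v
    proof (rule ccontr)
      assume "\<not> (\<exists>i\<in>I. {u, v} \<subseteq> B i)"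
      then have "{u, v} \<in> F" using that X unfolding F_def by blast
      then show False using that c by auto
    qed
    show "cut x n \<Lambda> X"
    proof (rule cut_from_local_cuts[OF disj _ loc glob X _ closed])
      show "B i \<inter> bdry \<Lambda> = {}" if "i \<in> I" for i using sub[OF that] by auto
      show "cut (z i) n (B i) (X \<inter> edges (B i))" if "i \<in> I" for i using c that by simp
    qed
  qed
  finally have "ln (exp (-\<beta> * card F) * (\<Prod>i\<in>I. wired_prob q \<beta> J (edges (B i)) (cut (z i) n (B i))))
    \<le> ln (wired_prob q \<beta> J ?E (cut x n \<Lambda>))"
    using prodpos wired_prob_pos[where P = "cut x n \<Lambda>", OF finE J cut_empty]
    by (subst ln_le_cancel_iff) (auto simp: zero_less_mult_iff)
  also have "ln (exp (-\<beta> * card F) * (\<Prod>i\<in>I. wired_prob q \<beta> J (edges (B i)) (cut (z i) n (B i))))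
    = -\<beta> * card F + (\<Sum>i\<in>I. ln (wired_prob q \<beta> J (edges (B i)) (cut (z i) n (B i))))"
  proof -
    have "ln (\<Prod>i\<in>I. wired_prob q \<beta> J (edges (B i)) (cut (z i) n (B i)))
      = (\<Sum>i\<in>I. ln (wired_prob q \<beta> J (edges (B i)) (cut (z i) n (B i))))"
      using pos fin by (intro ln_prod) (auto dest: pos[THEN less_imp_neq])
    then show ?thesis using prodpos by (subst ln_mult_pos) auto
  qed
  finally show ?thesis by (simp add: cut_cost_def sum_negf)
qed

lemma measure_rc_measure_wired:
  assumes fin: "finite E" and E: "E \<subseteq> edges UNIV" and J: "J \<in> E \<rightarrow> {0..1}"
  shows "measure (rc_measure q \<beta> J E wired) {\<omega> \<in> configs E. P {e \<in> E. \<omega> e = 1}} = wired_prob q \<beta> J E P"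
proof -
  define op where "op \<omega> = {e \<in> E. \<omega> e = (1::nat)}" for \<omega>
  have bij: "bij_betw op (configs E) (Pow E)"
  proof (rule bij_betw_byWitness[where f' = "\<lambda>X. \<lambda>e\<in>E. if e \<in> X then 1 else 0"])
    show "\<forall>a\<in>configs E. (\<lambda>e\<in>E. if e \<in> op a then 1 else 0) = a"
      by (auto simp: configs_def op_def fun_eq_iff PiE_iff extensional_def)
  qed (auto simp: op_def configs_def split: if_splits)
  have links: "open_links E \<omega> \<union> open_links (edges UNIV - E) wired = links (op \<omega> \<union> (edges UNIV - E))" for \<omega>
    by (auto simp: open_links_def wired_def links_def op_def)
  have weight: "rc_weight q \<beta> J E wired \<omega> = wired_weight q \<beta> J E (op \<omega>)" if "\<omega> \<in> configs E" for \<omega>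
  proof -
    have "num_clusters E wired \<omega> = cluster_count (\<Union>E) (op \<omega> \<union> (edges UNIV - E))"
      unfolding num_clusters_def cluster_count_def links ..
    moreover have "(\<Prod>e\<in>E. edge_prob \<beta> J e ^ \<omega> e * (1 - edge_prob \<beta> J e) ^ (1 - \<omega> e))
        = (\<Prod>e\<in>E. if e \<in> op \<omega> then edge_prob \<beta> J e else 1 - edge_prob \<beta> J e)"
      using that by (intro prod.cong) (auto simp: configs_def op_def PiE_iff)
    ultimately show ?thesis by (simp add: rc_weight_def wired_weight_def)
  qed
  have finC: "finite (configs E)" unfolding configs_def using fin by (intro finite_PiE) auto
  define Z where "Z = (\<Sum>X\<in>Pow E. wired_weight q \<beta> J E X)"
  have Z: "(\<Sum>\<omega>\<in>configs E. rc_weight q \<beta> J E wired \<omega>) = Z"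
    unfolding Z_def using weight sum.reindex_bij_betw[OF bij, of "wired_weight q \<beta> J E"] by simp
  have nn: "0 \<le> wired_weight q \<beta> J E X / Z" for X
    using partition_function_pos[OF fin J] wired_weight_nonneg[OF J] by (simp add: Z_def less_imp_le)
  have "emeasure (rc_measure q \<beta> J E wired) {\<omega> \<in> configs E. P (op \<omega>)}
    = (\<Sum>\<omega>\<in>{\<omega> \<in> configs E. P (op \<omega>)}. ennreal (rc_weight q \<beta> J E wired \<omega> / Z))"
    unfolding rc_measure_def Z using finC by (subst emeasure_point_measure_finite) auto
  also have "\<dots> = (\<Sum>\<omega>\<in>{\<omega> \<in> configs E. P (op \<omega>)}. ennreal (wired_weight q \<beta> J E (op \<omega>) / Z))"
    using weight by (intro sum.cong) auto
  also have "\<dots> = ennreal (\<Sum>\<omega>\<in>{\<omega> \<in> configs E. P (op \<omega>)}. wired_weight q \<beta> J E (op \<omega>) / Z)"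
    using nn by (subst sum_ennreal) auto
  also have "(\<Sum>\<omega>\<in>{\<omega> \<in> configs E. P (op \<omega>)}. wired_weight q \<beta> J E (op \<omega>) / Z)
    = (\<Sum>\<omega>\<in>configs E. if P (op \<omega>) then wired_weight q \<beta> J E (op \<omega>) / Z else 0)"
    using finC by (rule sum.inter_filter)
  also have "\<dots> = (\<Sum>X\<in>Pow E. if P X then wired_weight q \<beta> J E X / Z else 0)"
    by (rule sum.reindex_bij_betw[OF bij, of "\<lambda>X. if P X then wired_weight q \<beta> J E X / Z else 0"])
  also have "\<dots> = wired_prob q \<beta> J E P"
    unfolding wired_prob_def sum_divide_distrib Z_def by (intro sum.cong) auto
  finally show ?thesis
    using wired_prob_nonneg[OF J] unfolding op_def by (simp add: measure_def)
qed

lemma tau_J_eq_cut_cost: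
  fixes x :: "real ^ 'd::finite"
  assumes "finite (sites (rect x L H S n))" "J \<in> edges (sites (rect x L H S n)) \<rightarrow> {0..1}"
  shows "tau_J q \<beta> J x L H S n
    = cut_cost q \<beta> J x n (sites (rect x L H S n)) / L ^ (CARD('d) - 1)"
proof -
  define \<Lambda> where "\<Lambda> = sites (rect x L H S n)"
  have *: "open_links (edges \<Lambda>) \<omega> = links {e \<in> edges \<Lambda>. \<omega> e = 1}" for \<omega>
    by (auto simp: open_links_def links_def)
  have "disconnection x L H S n = {\<omega> \<in> configs (edges \<Lambda>). cut x n \<Lambda> {e \<in> edges \<Lambda>. \<omega> e = 1}}"
    unfolding disconnection_def Let_def \<Lambda>_def[symmetric] cut_def * ..
  then have "measure (rc_measure q \<beta> J (edges \<Lambda>) wired) (disconnection x L H S n)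
    = wired_prob q \<beta> J (edges \<Lambda>) (cut x n \<Lambda>)"
    using measure_rc_measure_wired[OF finite_edges edges_subset_UNIV, of \<Lambda> J] assms by (simp add: \<Lambda>_def)
  then show ?thesis by (simp add: tau_J_def cut_cost_def \<Lambda>_def)
qed

end

section \<open>Lebesgue measure and orthogonal maps\<close>

lemma linear_scales_lebesgue_if_boxes:
  fixes f :: "real ^ 'n \<Rightarrow> real ^ 'n"
  assumes "linear f" "\<And>a b. measure lebesgue (f ` cbox a b) = c * measure lebesgue (cbox a b)"
  shows "\<exists>c. \<forall>S\<in>lmeasurable. f ` S \<in> lmeasurable \<and> measure lebesgue (f ` S) = c * measure lebesgue S"
proof (intro exI ballI)
  fix S :: "(real ^ 'n) set" assume "S \<in> lmeasurable"
  then have "f ` S \<in> lmeasurable \<and> c * measure lebesgue S = measure lebesgue (f ` S)"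
    using assms by (intro measure_linear_sufficient)
  then show "f ` S \<in> lmeasurable \<and> measure lebesgue (f ` S) = c * measure lebesgue S" by simp
qed

text \<open>Every linear map is a composition of the elementary maps of Gaussian elimination, each of which
  multiplies volumes by a constant. For an orthogonal map the constant is then found
  by looking at a ball.\<close>
lemma linear_scales_lebesgue:
  fixes f :: "real ^ 'n \<Rightarrow> real ^ 'n"
  assumes "linear f"
  shows "\<exists>c. \<forall>S\<in>lmeasurable. f ` S \<in> lmeasurable \<and> measure lebesgue (f ` S) = c * measure lebesgue S"
  using assms
proof (rule induct_linear_elementary)
  fix f g :: "real ^ 'n \<Rightarrow> real ^ 'n"
  assume "\<exists>c. \<forall>S\<in>lmeasurable. f ` S \<in> lmeasurable \<and> measure lebesgue (f ` S) = c * measure lebesgue S"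
    and "\<exists>c. \<forall>S\<in>lmeasurable. g ` S \<in> lmeasurable \<and> measure lebesgue (g ` S) = c * measure lebesgue S"
  then obtain c d where
    f: "\<And>S. S \<in> lmeasurable \<Longrightarrow> f ` S \<in> lmeasurable \<and> measure lebesgue (f ` S) = c * measure lebesgue S" and
    g: "\<And>S. S \<in> lmeasurable \<Longrightarrow> g ` S \<in> lmeasurable \<and> measure lebesgue (g ` S) = d * measure lebesgue S"
    by blast
  show "\<exists>c. \<forall>S\<in>lmeasurable. (f \<circ> g) ` S \<in> lmeasurable
      \<and> measure lebesgue ((f \<circ> g) ` S) = c * measure lebesgue S"
  proof (intro exI[of _ "c * d"] ballI)
    fix S :: "(real ^ 'n) set" assume S: "S \<in> lmeasurable"
    show "(f \<circ> g) ` S \<in> lmeasurable \<and> measure lebesgue ((f \<circ> g) ` S) = c * d * measure lebesgue S"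
      unfolding image_comp[symmetric] using f[of "g ` S"] g[OF S] by simp
  qed
next
  fix f :: "real ^ 'n \<Rightarrow> real ^ 'n" and i
  assume lin: "linear f" and 0: "\<And>x. f x $ i = 0"
  have "\<not> surj f"
  proof
    assume "surj f"
    then obtain x where "f x = axis i 1" by (metis surjD)
    then show False using 0[of x] by simp
  qed
  then have "\<not> inj f" using lin linear_injective_imp_surjective by blast
  then have "negligible (f ` S)" for S
    using lin negligible_linear_singular_image by blast
  then show "\<exists>c. \<forall>S\<in>lmeasurable. f ` S \<in> lmeasurable \<and> measure lebesgue (f ` S) = c * measure lebesgue S"
    by (intro exI[of _ 0]) (auto simp: negligible_imp_measure0 negligible_iff_measure)
next
  fix c :: "'n \<Rightarrow> real"
  show "\<exists>k. \<forall>S\<in>lmeasurable. (\<lambda>x. \<chi> i. c i * x $ i) ` S \<in> lmeasurable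
      \<and> measure lebesgue ((\<lambda>x. \<chi> i. c i * x $ i) ` S) = k * measure lebesgue S"
    using measurable_stretch measure_stretch by blast
next
  fix k l :: 'n assume "k \<noteq> l"
  let ?h = "\<lambda>x::real ^ 'n. \<chi> i. x $ Transposition.transpose k l i"
  have lin: "linear ?h" by (rule linearI) (simp_all add: vec_eq_iff)
  have "measure lebesgue (?h ` cbox a b) = 1 * measure lebesgue (cbox a b)" for a b
  proof (cases "cbox a b = {}")
    case False
    have eq: "?h ` cbox a b = cbox (?h a) (?h b)"
    proof (intro equalityI subsetI)
      fix x assume x: "x \<in> cbox (?h a) (?h b)"
      have "x = ?h (?h x)" by (simp add: vec_eq_iff)
      moreover have "?h x \<in> cbox a b"
        using x unfolding mem_box_cart by (metis transpose_involutory vec_lambda_beta)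
      ultimately show "x \<in> ?h ` cbox a b" by blast
    qed (auto simp: mem_box_cart)
    have "measure lebesgue (cbox (?h a) (?h b)) = (\<Prod>i\<in>UNIV. (b - a) $ Transposition.transpose k l i)"
    proof -
      have "cbox (?h a) (?h b) \<noteq> {}" unfolding eq[symmetric] using False by blast
      then show ?thesis by (simp add: content_cbox_cart)
    qed
    also have "\<dots> = (\<Prod>i\<in>UNIV. (b - a) $ i)"
      by (rule prod.reindex_bij_betw) simp
    also have "\<dots> = measure lebesgue (cbox a b)"
      using False by (simp add: content_cbox_cart)
    finally show ?thesis unfolding eq by simp
  qed simp
  then show "\<exists>c. \<forall>S\<in>lmeasurable. ?h ` S \<in> lmeasurable \<and> measure lebesgue (?h ` S) = c * measure lebesgue S"
    by (rule linear_scales_lebesgue_if_boxes[OF lin])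
next
  fix k l :: 'n assume kl: "k \<noteq> l"
  let ?h = "\<lambda>x::real ^ 'n. \<chi> i. if i = k then x $ k + x $ l else x $ i"
  have lin: "linear ?h" by (rule linearI) (auto simp: vec_eq_iff algebra_simps)
  have "measure lebesgue (?h ` cbox a b) = 1 * measure lebesgue (cbox a b)" for a b
  proof (cases "cbox a b = {}")
    case False
    define v where "v = (axis l (a $ l) :: real ^ 'n)"
    have box: "cbox a b = (+) v ` cbox (a - v) (b - v)"
      using cbox_translation[of v "a - v" "b - v"] by simp
    have "?h ` cbox a b = (+) (?h v) ` ?h ` cbox (a - v) (b - v)"
      unfolding box image_comp comp_def using linear_add[OF lin, of v] by (simp add: image_def)
    then have "measure lebesgue (?h ` cbox a b) = measure lebesgue (?h ` cbox (a - v) (b - v))"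
      by (simp add: measure_translation)
    also have "\<dots> = measure lebesgue (cbox (a - v) (b - v))"
      using kl False box by (intro measure_shear_interval) (auto simp: v_def)
    also have "\<dots> = measure lebesgue (cbox a b)"
      unfolding box by (rule measure_translation[symmetric])
    finally show ?thesis by simp
  qed simp
  then show "\<exists>c. \<forall>S\<in>lmeasurable. ?h ` S \<in> lmeasurable \<and> measure lebesgue (?h ` S) = c * measure lebesgue S"
    by (rule linear_scales_lebesgue_if_boxes[OF lin])
qed

lemma orthogonal_preserves_lebesgue:
  fixes f :: "real ^ 'n \<Rightarrow> real ^ 'n"
  assumes f: "orthogonal_transformation f" and S: "S \<in> lmeasurable"
  shows "f ` S \<in> lmeasurable" "measure lebesgue (f ` S) = measure lebesgue S"
proof -
  obtain c where c: "\<And>S. S \<in> lmeasurable \<Longrightarrow> f ` S \<in> lmeasurable \<and> measure lebesgue (f ` S) = c * measure lebesgue S"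
    using linear_scales_lebesgue[OF orthogonal_transformation_linear[OF f]] by blast
  have "f ` cball 0 1 = cball 0 1"
    using image_orthogonal_transformation_cball[OF f, of 0 1] f
    by (simp add: linear_0 orthogonal_transformation_linear)
  moreover have "0 < measure lebesgue (cball (0 :: real ^ 'n) 1)"
    using content_cball_pos[of 1 "0 :: real ^ 'n"] by simp
  ultimately have "c = 1" using c[of "cball 0 1"] by simp
  then show "f ` S \<in> lmeasurable" "measure lebesgue (f ` S) = measure lebesgue S"
    using c[OF S] by auto
qed

section \<open>Orthonormal frames and rotated boxes\<close>

text \<open>Choosing a coordinate \<open>k0\<close>, an orthonormal basis \<open>u\<^sub>1, \<dots>, u\<^sub>d\<^sub>-\<^sub>1, n\<close> is encoded as the
  orthogonal map \<open>Q\<close> that takes the coordinates with respect to it. The coordinate \<open>k0\<close> is the height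
  \<open>x \<bullet> n\<close>; the other ones are called lateral.\<close>
definition frame :: "real ^ 'd \<Rightarrow> 'd \<Rightarrow> (real ^ 'd \<Rightarrow> real ^ 'd) \<Rightarrow> bool" where
  "frame n k0 Q \<longleftrightarrow> orthogonal_transformation Q \<and> Q n = axis k0 1"

definition box_sites ::
    "(real ^ 'd \<Rightarrow> real ^ 'd) \<Rightarrow> 'd \<Rightarrow> real ^ 'd \<Rightarrow> real \<Rightarrow> real \<Rightarrow> (int ^ 'd) set" where
  "box_sites Q k0 x L H =
     {y. (\<forall>k. k \<noteq> k0 \<longrightarrow> \<bar>Q (emb y - x) $ k\<bar> < L / 2) \<and> \<bar>Q (emb y - x) $ k0\<bar> < H}"

lemma unit_cube_frame:
  fixes n :: "real ^ 'd::finite"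
  assumes "S \<in> unit_cubes n"
  shows "\<exists>Q. frame n k0 Q \<and> (\<forall>x L H. L > 0 \<longrightarrow> sites (rect x L H S n) = box_sites Q k0 x L H)"
proof -
  let ?K = "{1..CARD('d) - 1}"
  obtain u where S: "S = {\<Sum>k\<in>?K. t k *\<^sub>R u k | t :: nat \<Rightarrow> real. \<forall>k\<in>?K. t k \<in> {-1/2..1/2}}"
    and n: "norm n = 1" and un: "\<And>k. k \<in> ?K \<Longrightarrow> norm (u k) = 1 \<and> u k \<bullet> n = 0"
    and uu: "\<And>j k. j \<in> ?K \<Longrightarrow> k \<in> ?K \<Longrightarrow> j \<noteq> k \<Longrightarrow> u j \<bullet> u k = 0"
    using assms unfolding unit_cubes_def by blast
  obtain g where g: "bij_betw g (UNIV - {k0}) ?K"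
    using finite_same_card_bij[of "UNIV - {k0}" ?K] by (auto simp: card_Diff_singleton)
  have gK: "g k \<in> ?K" if "k \<noteq> k0" for k using g that by (auto simp: bij_betw_def)
  have ginj: "g j \<noteq> g k" if "j \<noteq> k0" "k \<noteq> k0" "j \<noteq> k" for j k
    using g that by (auto simp: bij_betw_def inj_on_def)
  define v where "v k = (if k = k0 then n else u (g k))" for k
  have vv: "v j \<bullet> v k = (if j = k then 1 else 0)" for j k
    using n un[OF gK, of j] un[OF gK, of k] uu[OF gK gK ginj, of j k]
    by (auto simp: v_def inner_commute norm_eq_1)
  define R where "R c = (\<Sum>k\<in>UNIV. c $ k *\<^sub>R v k)" for c :: "real ^ 'd"
  have linR: "linear R"
    by (rule linearI) (simp_all add: R_def sum.distrib scaleR_add_left scaleR_sum_right)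
  have "R c \<bullet> R d = c \<bullet> d" for c d
    unfolding R_def inner_sum_left inner_sum_right inner_scaleR_left inner_scaleR_right vv
    by (simp add: inner_vec_def mult.commute if_distrib[where f = "\<lambda>x. _ * x"] cong: if_cong)
  then have orthR: "orthogonal_transformation R"
    using linR by (simp add: orthogonal_transformation_def)
  define Q where "Q = inv R"
  have orthQ: "orthogonal_transformation Q"
    unfolding Q_def by (rule orthogonal_transformation_inv[OF orthR])
  have injR: "inj R" and surjR: "surj R"
    using orthR orthogonal_transformation_inj orthogonal_transformation_surj by blast+
  have QR: "Q (R c) = c" for c using injR by (simp add: Q_def)
  have RQ: "R (Q y) = y" for y using surjR by (simp add: Q_def surj_f_inv_f)
  have "R (axis k0 1) = n"
    by (simp add: R_def v_def axis_def if_distrib[where f = "\<lambda>x. x *\<^sub>R _"] cong: if_cong)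
  then have "Q n = axis k0 1" using QR by metis
  then have fr: "frame n k0 Q" using orthQ by (simp add: frame_def)
  have Rsplit: "R c = c $ k0 *\<^sub>R n + (\<Sum>k\<in>UNIV - {k0}. c $ k *\<^sub>R u (g k))" for c
  proof -
    have "R c = c $ k0 *\<^sub>R v k0 + (\<Sum>k\<in>UNIV - {k0}. c $ k *\<^sub>R v k)"
      unfolding R_def by (rule sum.remove) auto
    also have "(\<Sum>k\<in>UNIV - {k0}. c $ k *\<^sub>R v k) = (\<Sum>k\<in>UNIV - {k0}. c $ k *\<^sub>R u (g k))"
      by (intro sum.cong) (auto simp: v_def)
    finally show ?thesis by (simp add: v_def)
  qed
  have re: "(\<Sum>k\<in>?K. t k *\<^sub>R u k) = (\<Sum>k\<in>UNIV - {k0}. t (g k) *\<^sub>R u (g k))" for t :: "nat \<Rightarrow> real"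
    by (rule sum.reindex_bij_betw[OF g, symmetric])
  have "sites (rect x L H S n) = box_sites Q k0 x L H" if L: "L > 0" for x L H
  proof -
    define a where "a = (\<chi> k. if k = k0 then H else L / 2)"
    have "rect x L H S n = (+) x ` R ` cbox (- a) a"
    proof (intro equalityI subsetI)
      fix y assume "y \<in> rect x L H S n"
      then obtain t h where t: "\<And>k. k \<in> ?K \<Longrightarrow> t k \<in> {-1/2..1/2}" and h: "h \<in> {-H..H}"
        and y: "y = x + L *\<^sub>R (\<Sum>k\<in>?K. t k *\<^sub>R u k) + h *\<^sub>R n"
        unfolding rect_def S by blast
      define c where "c = (\<chi> k. if k = k0 then h else L * t (g k))"
      have "R c = L *\<^sub>R (\<Sum>k\<in>?K. t k *\<^sub>R u k) + h *\<^sub>R n"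
        unfolding Rsplit re scaleR_sum_right by (auto simp: c_def intro!: sum.cong)
      then have "y = x + R c" by (simp add: y)
      moreover have "c \<in> cbox (- a) a"
        unfolding mem_box_cart
      proof
        fix k
        show "(- a) $ k \<le> c $ k \<and> c $ k \<le> a $ k"
        proof (cases "k = k0")
          case False
          then have "-1/2 \<le> t (g k)" "t (g k) \<le> 1/2" using t[OF gK] by auto
          then have "L * (-1/2) \<le> L * t (g k)" "L * t (g k) \<le> L * (1/2)"
            using L by (intro mult_left_mono; simp)+
          then show ?thesis using False by (simp add: a_def c_def)
        qed (use h in \<open>simp add: a_def c_def\<close>)
      qed
      ultimately show "y \<in> (+) x ` R ` cbox (- a) a" by blast
    next
      fix y assume "y \<in> (+) x ` R ` cbox (- a) a"
      then obtain c where c: "c \<in> cbox (- a) a" and y: "y = x + R c" by auto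
      define t where "t k = c $ inv_into (UNIV - {k0}) g k / L" for k
      have tg: "t (g k) = c $ k / L" if "k \<noteq> k0" for k
        using g that by (simp add: t_def bij_betw_def)
      have "R c = c $ k0 *\<^sub>R n + L *\<^sub>R (\<Sum>k\<in>?K. t k *\<^sub>R u k)"
        unfolding Rsplit re scaleR_sum_right using L tg by (auto intro!: sum.cong)
      then have y': "y = x + L *\<^sub>R (\<Sum>k\<in>?K. t k *\<^sub>R u k) + c $ k0 *\<^sub>R n" by (simp add: y)
      have "t k \<in> {-1/2..1/2}" if "k \<in> ?K" for k
      proof -
        have "k \<in> g ` (UNIV - {k0})" using that g unfolding bij_betw_def by blast
        then obtain l where l: "l \<noteq> k0" "k = g l" by blast
        then have "- (L / 2) \<le> c $ l" "c $ l \<le> L / 2"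
          using c unfolding mem_box_cart by (auto simp: a_def dest: spec[of _ l])
        then show ?thesis unfolding l(2) tg[OF l(1)] using L by (simp add: field_simps)
      qed
      moreover have "c $ k0 \<in> {-H..H}"
        using c unfolding mem_box_cart by (auto simp: a_def dest: spec[of _ k0])
      ultimately show "y \<in> rect x L H S n" unfolding rect_def S y' by blast
    qed
    then have "interior (rect x L H S n) = (+) x ` R ` box (- a) a"
      using interior_injective_linear_image[OF linR injR]
      by (simp add: interior_translation interior_cbox)
    moreover have "y \<in> (+) x ` R ` box (- a) a \<longleftrightarrow> Q (y - x) \<in> box (- a) a" for y
    proof
      assume "Q (y - x) \<in> box (- a) a"
      moreover have "y = x + R (Q (y - x))" using RQ by simp
      ultimately show "y \<in> (+) x ` R ` box (- a) a" by blast
    qed (auto simp: QR)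
    moreover have "w \<in> box (- a) a \<longleftrightarrow> (\<forall>k. k \<noteq> k0 \<longrightarrow> \<bar>w $ k\<bar> < L / 2) \<and> \<bar>w $ k0\<bar> < H" for w
    proof -
      have "w \<in> box (- a) a \<longleftrightarrow> (\<forall>k. \<bar>w $ k\<bar> < a $ k)"
        by (simp add: mem_box_cart abs_less_iff minus_less_iff conj_commute)
      also have "\<dots> \<longleftrightarrow> (\<forall>k. k \<noteq> k0 \<longrightarrow> \<bar>w $ k\<bar> < L / 2) \<and> \<bar>w $ k0\<bar> < H"
        by (auto simp: a_def split: if_splits)
      finally show ?thesis .
    qed
    ultimately show ?thesis
      unfolding sites_def box_sites_def by simp
  qed
  then show ?thesis using fr by blast
qed

lemma frame_linear: "frame n k0 Q \<Longrightarrow> linear Q"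
  by (simp add: frame_def orthogonal_transformation_linear)

lemma frame_diff: "frame n k0 Q \<Longrightarrow> Q (x - y) = Q x - Q y"
  by (simp add: frame_linear linear_diff)

lemma frame_norm: "frame n k0 Q \<Longrightarrow> norm (Q x) = norm x"
  by (simp add: frame_def orthogonal_transformation_norm)

lemma frame_component_le: "frame n k0 Q \<Longrightarrow> \<bar>Q x $ k\<bar> \<le> norm x"
  using component_le_norm_cart[of "Q x" k] frame_norm by metis

lemma frame_normal: "frame n k0 Q \<Longrightarrow> Q x $ k0 = x \<bullet> n"
proof -
  assume fr: "frame n k0 Q"
  then have "x \<bullet> n = Q x \<bullet> axis k0 1"
    unfolding frame_def orthogonal_transformation_def by metis
  then show ?thesis by (simp add: inner_axis)
qed

text \<open>Two frames with the same normal vector differ by an isometry of the hyperplane orthogonal to it.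
  So lateral bounds in one of them imply lateral bounds in the other, whatever the height is.\<close>
lemma frame_change_lateral:
  fixes n :: "real ^ 'd::finite"
  assumes Q: "frame n k0 Q" and Q': "frame n k0 Q'"
    and s: "\<And>j. j \<noteq> k0 \<Longrightarrow> \<bar>Q' w $ j\<bar> \<le> s" and k: "k \<noteq> k0"
  shows "\<bar>Q w $ k\<bar> \<le> (real CARD('d) - 1) * s"
proof -
  define w' where "w' = w - (w \<bullet> n) *\<^sub>R n"
  have Qw': "P w' = P w - (w \<bullet> n) *\<^sub>R axis k0 1" if "frame n k0 P" for P
    using that by (simp add: w'_def linear_diff linear_scale frame_linear frame_def orthogonal_transformation_linear)
  have "\<bar>Q w $ k\<bar> = \<bar>Q w' $ k\<bar>" using k Qw'[OF Q] by (simp add: axis_def)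
  also have "\<dots> \<le> norm w'" by (rule frame_component_le[OF Q])
  also have "\<dots> = norm (Q' w')" by (rule frame_norm[OF Q', symmetric])
  also have "\<dots> \<le> (\<Sum>j\<in>UNIV. \<bar>Q' w' $ j\<bar>)" by (rule norm_le_l1_cart)
  also have "\<dots> = \<bar>Q' w' $ k0\<bar> + (\<Sum>j\<in>UNIV - {k0}. \<bar>Q' w' $ j\<bar>)"
    by (rule sum.remove) auto
  also have "Q' w' $ k0 = 0" using Qw'[OF Q'] frame_normal[OF Q'] by simp
  also have "(\<Sum>j\<in>UNIV - {k0}. \<bar>Q' w' $ j\<bar>) \<le> (\<Sum>j\<in>UNIV - {k0}. s)"
    using s Qw'[OF Q'] by (intro sum_mono) (auto simp: axis_def)
  also have "\<dots> = (real CARD('d) - 1) * s"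
    by (simp add: card_Diff_singleton of_nat_diff)
  finally show ?thesis by simp
qed

lemma emb_add: "emb (x + y) = emb x + emb y" and emb_diff: "emb (x - y) = emb x - emb y"
  by (simp_all add: emb_def vec_eq_iff)

lemma norm_emb_ge_1:
  assumes "x \<noteq> 0" shows "1 \<le> norm (emb x)"
proof -
  obtain k where "x $ k \<noteq> 0" using assms by (auto simp: vec_eq_iff)
  then have "1 \<le> \<bar>emb x $ k\<bar>" by (simp add: emb_def)
  then show ?thesis using component_le_norm_cart[of "emb x" k] by linarith
qed

lemma adj_frame_le: "frame n k0 Q \<Longrightarrow> u \<sim> v \<Longrightarrow> \<bar>Q (emb u) $ k - Q (emb v) $ k\<bar> \<le> 1"
  using frame_component_le[of n k0 Q "emb u - emb v" k]
  by (simp add: adj_def frame_diff)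

section \<open>Counting lattice points in rotated sets\<close>

text \<open>The intervals of length \<open>1/D\<close> that meet \<open>A\<close>, represented by their indices.\<close>
definition mesh_cells :: "nat \<Rightarrow> real set \<Rightarrow> int set" where
  "mesh_cells D A = (\<lambda>t. \<lfloor>real D * t\<rfloor>) ` A"

text \<open>A rotated mesh of width \<open>1/d\<close> has at most one lattice point in each cell: two points in one cell
  are at distance less than \<open>d \<cdot> (1/d) = 1\<close>. Up to a constant this replaces volumes in all upper bounds on
  numbers of sites.\<close>
lemma count_sites:
  fixes Q :: "real ^ 'd::finite \<Rightarrow> real ^ 'd" and A :: "'d \<Rightarrow> real set"
  assumes Q: "orthogonal_transformation Q" and fin: "\<And>k. finite (mesh_cells CARD('d) (A k))"
  defines "Y \<equiv> {y :: int ^ 'd. \<forall>k. Q (emb y) $ k \<in> A k}"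
  shows "finite Y" "card Y \<le> (\<Prod>k\<in>UNIV. card (mesh_cells CARD('d) (A k)))"
proof -
  define D where "D = real CARD('d)"
  have D: "D \<ge> 1" unfolding D_def using zero_less_card_finite[where 'a = 'd] by linarith
  define \<phi> where "\<phi> y = (\<lambda>k. \<lfloor>D * Q (emb y) $ k\<rfloor>)" for y :: "int ^ 'd"
  have lin: "linear Q" by (rule orthogonal_transformation_linear[OF Q])
  have inj: "inj_on \<phi> Y"
  proof (rule inj_onI, rule ccontr)
    fix x y assume eq: "\<phi> x = \<phi> y" and ne: "x \<noteq> y"
    define w where "w = Q (emb (x - y))"
    have w: "\<bar>w $ k\<bar> < 1 / D" for k
    proof -
      have "\<lfloor>D * Q (emb x) $ k\<rfloor> = \<lfloor>D * Q (emb y) $ k\<rfloor>" using eq by (simp add: \<phi>_def fun_eq_iff)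
      then have "\<bar>D * Q (emb x) $ k - D * Q (emb y) $ k\<bar> < 1" by linarith
      moreover have "D * Q (emb x) $ k - D * Q (emb y) $ k = D * w $ k"
        by (simp add: w_def emb_diff linear_diff[OF lin] algebra_simps)
      ultimately have "\<bar>w $ k\<bar> * D < 1" using D by (simp add: abs_mult mult.commute)
      then show ?thesis using D by (simp add: field_simps)
    qed
    have "1 \<le> norm w"
      using norm_emb_ge_1[of "x - y"] ne Q by (simp add: w_def orthogonal_transformation_norm)
    also have "norm w \<le> (\<Sum>k\<in>UNIV. \<bar>w $ k\<bar>)" by (rule norm_le_l1_cart)
    also have "\<dots> < (\<Sum>k\<in>(UNIV :: 'd set). 1 / D)"
      using w by (intro sum_strict_mono) auto
    also have "\<dots> = 1" using D by (simp add: D_def)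
    finally show False by simp
  qed
  have sub: "\<phi> ` Y \<subseteq> (\<Pi>\<^sub>E k\<in>UNIV. mesh_cells CARD('d) (A k))"
    by (auto simp: \<phi>_def Y_def mesh_cells_def D_def)
  have finP: "finite (\<Pi>\<^sub>E k\<in>UNIV. mesh_cells CARD('d) (A k))"
    using fin by (intro finite_PiE) auto
  show "finite Y" using finite_imageD[OF finite_subset[OF sub finP] inj] .
  have "card Y = card (\<phi> ` Y)" by (rule card_image[OF inj, symmetric])
  also have "\<dots> \<le> card (\<Pi>\<^sub>E k\<in>UNIV. mesh_cells CARD('d) (A k))" by (rule card_mono[OF finP sub])
  also have "\<dots> = (\<Prod>k\<in>UNIV. card (mesh_cells CARD('d) (A k)))" by (simp add: card_PiE)
  finally show "card Y \<le> (\<Prod>k\<in>UNIV. card (mesh_cells CARD('d) (A k)))" .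
qed

lemma mesh_cells_interval:
  "finite (mesh_cells D {a..b})" "a \<le> b \<Longrightarrow> real (card (mesh_cells D {a..b})) \<le> real D * (b - a) + 2"
proof -
  have sub: "mesh_cells D {a..b} \<subseteq> {\<lfloor>real D * a\<rfloor>..\<lfloor>real D * b\<rfloor>}"
    by (auto simp: mesh_cells_def intro!: floor_mono mult_left_mono)
  show "finite (mesh_cells D {a..b})" by (rule finite_subset[OF sub]) simp
  assume ab: "a \<le> b"
  have le: "\<lfloor>real D * a\<rfloor> \<le> \<lfloor>real D * b\<rfloor>" using ab by (intro floor_mono mult_left_mono) auto
  have "real (card (mesh_cells D {a..b})) \<le> real (card {\<lfloor>real D * a\<rfloor>..\<lfloor>real D * b\<rfloor>})"
    using card_mono[OF _ sub] by simp
  also have "\<dots> = real_of_int (\<lfloor>real D * b\<rfloor> - \<lfloor>real D * a\<rfloor> + 1)" using le by simp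
  also have "\<dots> \<le> real D * b - real D * a + 2" by linarith
  finally show "real (card (mesh_cells D {a..b})) \<le> real D * (b - a) + 2" by (simp add: algebra_simps)
qed

lemma mesh_cells_Un: "mesh_cells D (A \<union> B) = mesh_cells D A \<union> mesh_cells D B"
  and mesh_cells_UN: "mesh_cells D (\<Union>i\<in>I. S i) = (\<Union>i\<in>I. mesh_cells D (S i))"
  by (auto simp: mesh_cells_def)

text \<open>The case in which the height is restricted to an interval and one lateral coordinate to a small
  set \<open>B\<close>; the other \<open>d - 2\<close> coordinates are bounded by \<open>M\<close>.\<close>
lemma count_sites_slab:
  fixes n :: "real ^ 'd::finite" and a b m M :: real
  assumes Q: "frame n k0 Q" and k: "k \<noteq> k0" and ab: "a \<le> b" and M: "0 \<le> M"
    and B: "finite (mesh_cells CARD('d) B)" "real (card (mesh_cells CARD('d) B)) \<le> m"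
    and Y: "\<And>y. y \<in> Y \<Longrightarrow> emb y \<bullet> n \<in> {a..b} \<and> Q (emb y) $ k \<in> B \<and> (\<forall>j. j \<noteq> k0 \<longrightarrow> \<bar>Q (emb y) $ j\<bar> \<le> M)"
  shows "finite Y" "real (card Y) \<le> (real CARD('d) * (b - a) + 2) * m * (2 * real CARD('d) * M + 2) ^ (CARD('d) - 2)"
proof -
  let ?D = "CARD('d)"
  define A where "A j = (if j = k0 then {a..b} else if j = k then B else {-M..M})" for j
  have fin: "finite (mesh_cells ?D (A j))" for j
    using B mesh_cells_interval(1) by (simp add: A_def)
  have orth: "orthogonal_transformation Q" using Q by (simp add: frame_def)
  have sub: "Y \<subseteq> {y. \<forall>j. Q (emb y) $ j \<in> A j}"
    using Y frame_normal[OF Q] by (force simp: A_def abs_le_iff)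
  note cs = count_sites[where A = A, OF orth fin]
  show "finite Y" using finite_subset[OF sub cs(1)] .
  have "card Y \<le> (\<Prod>j\<in>UNIV. card (mesh_cells ?D (A j)))"
    using card_mono[OF cs(1) sub] cs(2) by linarith
  then have "real (card Y) \<le> (\<Prod>j\<in>UNIV. real (card (mesh_cells ?D (A j))))"
    by (metis of_nat_le_iff of_nat_prod)
  also have "\<dots> = real (card (mesh_cells ?D (A k0))) * (real (card (mesh_cells ?D (A k)))
      * (\<Prod>j\<in>UNIV - {k0} - {k}. real (card (mesh_cells ?D (A j)))))"
    using k by (subst prod.remove[of _ k0]; simp; subst prod.remove[of _ k]; simp)
  also have "\<dots> \<le> (real ?D * (b - a) + 2) * (m * (\<Prod>j\<in>UNIV - {k0} - {k}. 2 * real ?D * M + 2))"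
  proof (intro mult_mono prod_mono)
    show "real (card (mesh_cells ?D (A k0))) \<le> real ?D * (b - a) + 2"
      using mesh_cells_interval(2)[OF ab] by (simp add: A_def)
    show "real (card (mesh_cells ?D (A k))) \<le> m" using k B by (simp add: A_def)
    fix j assume j: "j \<in> UNIV - {k0} - {k}"
    have "real (card (mesh_cells ?D {-M..M})) \<le> real ?D * (M - (-M)) + 2" using M by (intro mesh_cells_interval) auto
    then show "0 \<le> real (card (mesh_cells ?D (A j))) \<and> real (card (mesh_cells ?D (A j))) \<le> 2 * real ?D * M + 2"
      using j by (simp add: A_def)
  qed (use ab M B in \<open>auto intro!: mult_nonneg_nonneg add_nonneg_nonneg prod_nonneg order_trans[OF _ B(2)]\<close>)
  also have "(\<Prod>j\<in>UNIV - {k0} - {k}. 2 * real ?D * M + 2) = (2 * real ?D * M + 2) ^ (?D - 2)"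
    using k by (simp add: card_Diff_singleton numeral_2_eq_2)
  finally show "real (card Y) \<le> (real ?D * (b - a) + 2) * m * (2 * real ?D * M + 2) ^ (?D - 2)"
    by (simp add: algebra_simps)
qed

lemma frame_diff_nth: "frame n k0 Q \<Longrightarrow> Q (x - y) $ k = Q x $ k - Q y $ k"
  by (simp add: frame_diff)

lemma frame_inv: "frame n k0 Q \<Longrightarrow> Q (inv Q x) = x" "frame n k0 Q \<Longrightarrow> inv Q (Q x) = x"
  unfolding frame_def
  by (auto simp: surj_f_inv_f orthogonal_transformation_surj orthogonal_transformation_inj)

lemma finite_bounded_sites:
  fixes Q :: "real ^ 'd::finite \<Rightarrow> real ^ 'd"
  assumes "orthogonal_transformation Q"
  shows "finite {y :: int ^ 'd. \<forall>k. \<bar>Q (emb y) $ k\<bar> \<le> M}"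
  using count_sites(1)[where A = "\<lambda>_. {-M..M}", OF assms mesh_cells_interval(1)]
  by (simp add: abs_le_iff minus_le_iff conj_commute)

lemma finite_box_sites:
  fixes n :: "real ^ 'd::finite"
  assumes Q: "frame n k0 Q" shows "finite (box_sites Q k0 x L H)"
proof -
  have "box_sites Q k0 x L H \<subseteq> {y. \<forall>k. \<bar>Q (emb y) $ k\<bar> \<le> norm x + max (L / 2) H}"
  proof (safe)
    fix y k assume y: "y \<in> box_sites Q k0 x L H"
    have "\<bar>Q (emb y - x) $ k\<bar> \<le> max (L / 2) H"
      using y by (cases "k = k0") (auto simp: box_sites_def less_max_iff_disj intro: less_imp_le)
    moreover have "\<bar>Q (emb y) $ k\<bar> \<le> \<bar>Q x $ k\<bar> + \<bar>Q (emb y - x) $ k\<bar>"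
      by (simp add: frame_diff[OF Q])
    ultimately show "\<bar>Q (emb y) $ k\<bar> \<le> norm x + max (L / 2) H"
      using frame_component_le[OF Q, of x k] by linarith
  qed
  then show ?thesis
    using finite_bounded_sites[of Q] Q by (auto simp: frame_def intro: finite_subset)
qed

definition unit_steps :: "(int ^ 'd) set" where
  "unit_steps = {w. norm (emb w) = 1}"

lemma finite_unit_steps: "finite (unit_steps :: (int ^ 'd::finite) set)"
proof (rule finite_subset)
  show "(unit_steps :: (int ^ 'd) set) \<subseteq> {y. \<forall>k. \<bar>emb y $ k\<bar> \<le> 1}"
    unfolding unit_steps_def by (auto intro: order_trans[OF component_le_norm_cart])
  show "finite {y :: int ^ 'd. \<forall>k. \<bar>emb y $ k\<bar> \<le> 1}"
    using finite_bounded_sites[OF orthogonal_transformation_id] .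
qed

lemma card_edges_le:
  fixes A :: "(int ^ 'd::finite) set"
  assumes "finite A" and F: "\<And>e. e \<in> F \<Longrightarrow> \<exists>u v. e = {u, v} \<and> u \<in> A \<and> u \<sim> v"
  shows "finite F" "card F \<le> card A * card (unit_steps :: (int ^ 'd) set)"
proof -
  let ?f = "\<lambda>(u, w). {u, u + w :: int ^ 'd}"
  have fin: "finite (A \<times> (unit_steps :: (int ^ 'd) set))" using assms finite_unit_steps by blast
  have sub: "F \<subseteq> ?f ` (A \<times> unit_steps)"
  proof
    fix e assume "e \<in> F"
    then obtain u v where e: "e = {u, v}" "u \<in> A" "u \<sim> v" using F by blast
    then have "v - u \<in> unit_steps" by (simp add: unit_steps_def adj_def emb_diff norm_minus_commute)
    moreover have "e = ?f (u, v - u)" by (simp add: e)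
    ultimately show "e \<in> ?f ` (A \<times> unit_steps)" using e(2) by blast
  qed
  show "finite F" using finite_subset[OF sub] fin by blast
  show "card F \<le> card A * card (unit_steps :: (int ^ 'd) set)"
    using card_mono[OF _ sub] card_image_le[OF fin, of ?f] fin by (simp add: card_cartesian_product)
qed

section \<open>A grid of lattice-centred blocks\<close>

text \<open>\<open>Q\<close> is the frame of the big box and \<open>Q'\<close> the frame of the small blocks, of width \<open>L\<close> and half
  height \<open>h\<close>. The blocks sit near the nodes of a grid that is aligned with \<open>Q'\<close>, with lateral period
  \<open>P\<close> and vertical period \<open>T\<close>. To make the law of the couplings in a block independent of the block, the
  centre of a block is obtained by rounding the node to a lattice point; this moves coordinates
  by at most \<open>D = d\<close>, whence the periods.\<close>
locale block_grid =
  fixes n :: "real ^ 'd::finite" and k0 :: 'd and Q Q' :: "real ^ 'd \<Rightarrow> real ^ 'd" and L h :: real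
  assumes Q: "frame n k0 Q" and Q': "frame n k0 Q'" and L: "L > 0" and h: "h > 0"
    and dim: "CARD('d) \<ge> 2"
begin

definition "D = real CARD('d)"
definition "P = L + 2 * D"
definition "T = 2 * h + 2 * D"

lemma D: "D \<ge> 2" using dim by (simp add: D_def)

lemma P: "P \<ge> 4" "P > L" using D L by (simp_all add: P_def)

lemma T: "T > 0" using D h by (simp add: T_def)

definition node :: "int ^ 'd \<Rightarrow> real ^ 'd" where
  "node i = inv Q' (\<chi> k. (if k = k0 then T else P) * real_of_int (i $ k))"

definition centre :: "int ^ 'd \<Rightarrow> int ^ 'd" where
  "centre i = (\<chi> k. \<lfloor>node i $ k\<rfloor>)"

definition block :: "int ^ 'd \<Rightarrow> (int ^ 'd) set" where
  "block i = box_sites Q' k0 (emb (centre i)) L h"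

lemma node: "Q' (node i) $ k = (if k = k0 then T else P) * real_of_int (i $ k)"
  by (simp add: node_def frame_inv[OF Q'])

lemma centre_near: "\<bar>R (emb (centre i) - node i) $ k\<bar> \<le> D" if "frame n k0 R"
proof -
  have "\<bar>R (emb (centre i) - node i) $ k\<bar> \<le> norm (emb (centre i) - node i)"
    by (rule frame_component_le[OF that])
  also have "\<dots> \<le> (\<Sum>k\<in>UNIV. \<bar>(emb (centre i) - node i) $ k\<bar>)" by (rule norm_le_l1_cart)
  also have "\<dots> \<le> (\<Sum>k\<in>(UNIV :: 'd set). 1)"
    by (intro sum_mono) (simp add: centre_def emb_def; linarith)
  finally show ?thesis by (simp add: D_def)
qed

lemma block_near_node:
  assumes "y \<in> block i"
  shows "k \<noteq> k0 \<Longrightarrow> \<bar>Q' (emb y - node i) $ k\<bar> < P / 2" "\<bar>Q' (emb y - node i) $ k0\<bar> < T / 2"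
proof -
  have *: "\<bar>Q' (emb y - node i) $ k\<bar> \<le> \<bar>Q' (emb y - emb (centre i)) $ k\<bar> + D" for k
    using centre_near[OF Q', of i k] by (simp add: frame_diff[OF Q'])
  show "k \<noteq> k0 \<Longrightarrow> \<bar>Q' (emb y - node i) $ k\<bar> < P / 2" "\<bar>Q' (emb y - node i) $ k0\<bar> < T / 2"
    using assms *[of k] *[of k0] by (auto simp: block_def box_sites_def P_def T_def)
qed

text \<open>Blocks stay within half a period of their nodes in each coordinate.\<close>
lemma blocks_disjoint: "i \<noteq> j \<Longrightarrow> block i \<inter> block j = {}"
proof (rule ccontr)
  assume "i \<noteq> j" and "block i \<inter> block j \<noteq> {}"
  then obtain y k where y: "y \<in> block i" "y \<in> block j" and k: "i $ k \<noteq> j $ k"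
    by (auto simp: vec_eq_iff)
  define s where "s = (if k = k0 then T else P)"
  have s: "s > 0" using T P by (simp add: s_def)
  have "\<bar>Q' (emb y - node i) $ k\<bar> < s / 2" "\<bar>Q' (emb y - node j) $ k\<bar> < s / 2"
    using block_near_node y by (auto simp: s_def)
  then have "\<bar>Q' (node i) $ k - Q' (node j) $ k\<bar> < s" unfolding frame_diff_nth[OF Q'] by linarith
  moreover have "\<bar>Q' (node i) $ k - Q' (node j) $ k\<bar> = s * \<bar>real_of_int (i $ k - j $ k)\<bar>"
    using s by (simp add: node s_def abs_mult flip: right_diff_distrib)
  moreover have "\<bar>real_of_int (i $ k - j $ k)\<bar> \<ge> 1" using k by linarith
  ultimately show False using s mult_left_mono[of 1 "\<bar>real_of_int (i $ k - j $ k)\<bar>" s] by simp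
qed

text \<open>The blocks of layer \<open>j\<close> that are used in a box of width \<open>N\<close>. The margin \<open>D * P\<close> ensures that
  the whole grid cell, which is aligned with the frame \<open>Q'\<close>, fits into the box aligned with \<open>Q\<close>.\<close>
definition columns :: "real \<Rightarrow> int \<Rightarrow> (int ^ 'd) set" where
  "columns N j = {i. i $ k0 = j \<and> (\<forall>k. k \<noteq> k0 \<longrightarrow> \<bar>Q (node i) $ k\<bar> \<le> N / 2 - D * P)}"

lemma lateral_change:
  assumes "frame n k0 R" "frame n k0 R'" "\<And>k. k \<noteq> k0 \<Longrightarrow> \<bar>R w $ k\<bar> \<le> s" "k \<noteq> k0"
  shows "\<bar>R' w $ k\<bar> \<le> (D - 1) * s"
  using frame_change_lateral[OF assms(2,1,3,4)] by (simp add: D_def)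

lemma finite_columns: "finite (columns N j)"
proof (rule finite_subset)
  define M where "M = max (\<bar>real_of_int j\<bar>) ((D - 1) * (N / 2 - D * P) / P)"
  show "columns N j \<subseteq> {i. \<forall>k. \<bar>emb i $ k\<bar> \<le> M}"
  proof safe
    fix i k assume i: "i \<in> columns N j"
    show "\<bar>emb i $ k\<bar> \<le> M"
    proof (cases "k = k0")
      case True
      then show ?thesis using i by (simp add: columns_def M_def emb_def)
    next
      case False
      have "\<bar>Q' (node i) $ k\<bar> \<le> (D - 1) * (N / 2 - D * P)"
        using i False by (intro lateral_change[OF Q Q']) (auto simp: columns_def)
      then have "P * \<bar>emb i $ k\<bar> \<le> (D - 1) * (N / 2 - D * P)"
        using False P by (simp add: node abs_mult emb_def)
      then have "\<bar>emb i $ k\<bar> \<le> (D - 1) * (N / 2 - D * P) / P"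
        using P by (simp add: field_simps)
      then show ?thesis by (simp add: M_def)
    qed
  qed
  show "finite {i :: int ^ 'd. \<forall>k. \<bar>emb i $ k\<bar> \<le> M}"
    using finite_bounded_sites[OF orthogonal_transformation_id] .
qed

lemma inner_eq_coord: "x \<bullet> n = Q' x $ k0" "Q x $ k0 = Q' x $ k0"
  using frame_normal[OF Q] frame_normal[OF Q'] by simp_all

lemma block_height:
  assumes "i \<in> columns N j"
  shows "\<bar>emb (centre i) \<bullet> n - T * j\<bar> \<le> D"
  using centre_near[OF Q', of i k0] assms
  by (simp add: inner_eq_coord frame_diff[OF Q'] node columns_def)

lemma block_inside:
  assumes i: "i \<in> columns N j" and H: "\<bar>T * j\<bar> + h + D + 1 \<le> H"
  shows "block i \<subseteq> box_sites Q k0 0 N H - bdry (box_sites Q k0 0 N H)"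
proof -
  have *: "z \<in> box_sites Q k0 0 N H" if y: "y \<in> block i" and yz: "norm (emb z - emb y) \<le> 1" for y z
  proof -
    have yz': "\<bar>Q' (emb z) $ k - Q' (emb y) $ k\<bar> \<le> 1" for k
      using frame_component_le[OF Q', of "emb z - emb y" k] yz by (simp add: frame_diff[OF Q'])
    have "\<bar>Q (emb z) $ k\<bar> < N / 2" if k: "k \<noteq> k0" for k
    proof -
      have "\<bar>Q' (emb z - node i) $ l\<bar> \<le> P" if "l \<noteq> k0" for l
        using block_near_node(1)[OF y that] yz'[of l] P unfolding frame_diff_nth[OF Q'] by linarith
      then have "\<bar>Q (emb z - node i) $ k\<bar> \<le> (D - 1) * P"
        using k by (intro lateral_change[OF Q' Q])
      moreover have "\<bar>Q (node i) $ k\<bar> \<le> N / 2 - D * P" using i k by (simp add: columns_def)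
      ultimately show ?thesis using P by (simp add: frame_diff[OF Q] algebra_simps)
    qed
    moreover have "\<bar>Q (emb z) $ k0\<bar> < H"
    proof -
      have "\<bar>Q' (emb y) $ k0 - Q' (emb (centre i)) $ k0\<bar> < h"
        using y by (simp add: block_def box_sites_def frame_diff[OF Q'])
      then show ?thesis
        using yz'[of k0] block_height[OF i] H unfolding inner_eq_coord by linarith
    qed
    ultimately show ?thesis by (simp add: box_sites_def)
  qed
  have "y \<in> box_sites Q k0 0 N H" if "y \<in> block i" for y using *[OF that, of y] by simp
  moreover have "y \<notin> bdry (box_sites Q k0 0 N H)" if "y \<in> block i" for y
    using *[OF that] by (force simp: bdry_def adj_def)
  ultimately show ?thesis by blast
qed

text \<open>The grid cells of one layer, thickened to height 1, are disjoint up to null sets and contained in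
  a cuboid of width \<open>N\<close> and height 1. The sharp constant \<open>1\<close> is what makes the limit independent of
  the choice of the cube \<open>\<S>\<close>.\<close>
lemma columns_volume:
  assumes N: "N > 0"
  shows "real (card (columns N j)) * P ^ (CARD('d) - 1) \<le> N ^ (CARD('d) - 1)"
proof -
  have split: "(\<Prod>k\<in>UNIV. if k = k0 then 1 else s) = s ^ (CARD('d) - 1)" for s :: real
    by (subst prod.remove[of _ k0]) (auto simp: card_Diff_singleton)
  \<comment> \<open>The cuboid with lateral width \<open>s\<close> and height 1 in the
    coordinates of a frame.\<close>
  define cuboid where "cuboid s = (cbox (\<chi> k. if k = k0 then -(1/2) else -(s/2)) (\<chi> k. if k = k0 then 1/2 else s/2) :: (real ^ 'd) set)" for s :: real
  have mem: "x \<in> cuboid s \<longleftrightarrow> (\<forall>k. \<bar>x $ k\<bar> \<le> (if k = k0 then 1/2 else s/2))" for x s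
    unfolding cuboid_def mem_box_cart by (intro all_cong1) (auto simp: abs_le_iff)
  have vol: "measure lebesgue (cuboid s) = s ^ (CARD('d) - 1)" "cuboid s \<in> lmeasurable" if "s > 0" for s
  proof -
    have "0 \<in> cuboid s" using that by (simp add: mem)
    then have "cuboid s \<noteq> {}" by blast
    then have "measure lebesgue (cuboid s) = (\<Prod>k\<in>UNIV. if k = k0 then 1 else s)"
      unfolding cuboid_def by (simp add: content_cbox_cart) (intro prod.cong, auto)
    then show "measure lebesgue (cuboid s) = s ^ (CARD('d) - 1)" unfolding split .
    show "cuboid s \<in> lmeasurable" by (simp add: cuboid_def)
  qed
  define R R' where "R = inv Q" and "R' = inv Q'"
  have orth: "orthogonal_transformation R" "orthogonal_transformation R'"
    using Q Q' by (auto simp: R_def R'_def frame_def orthogonal_transformation_inv)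
  have QR: "Q (R x) = x" "Q' (R' x) = x" "R (Q x) = x" for x
    using frame_inv[OF Q] frame_inv[OF Q'] by (simp_all add: R_def R'_def)
  define cell where "cell i = (+) (node i) ` R' ` cuboid P" for i
  have mem_cell: "\<bar>Q' (x - node i) $ k\<bar> \<le> (if k = k0 then 1/2 else P/2)" if "x \<in> cell i" for x i k
  proof -
    obtain c where c: "c \<in> cuboid P" "x = node i + R' c" using \<open>x \<in> cell i\<close> by (auto simp: cell_def)
    then have "Q' (x - node i) = c" by (simp add: QR)
    then show ?thesis using c(1) unfolding mem by blast
  qed
  have cell_meas: "cell i \<in> lmeasurable" "measure lebesgue (cell i) = P ^ (CARD('d) - 1)" for i
    using orthogonal_preserves_lebesgue[OF orth(2) vol(2)] vol P
    by (auto simp: cell_def measure_translation intro: measurable_translation)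
  define big where "big = R ` cuboid N"
  have big_meas: "big \<in> lmeasurable" "measure lebesgue big = N ^ (CARD('d) - 1)"
    using orthogonal_preserves_lebesgue[OF orth(1) vol(2)] vol N by (auto simp: big_def)
  let ?C = "columns N j"
  have "negligible (cell i \<inter> cell i')" if "i \<in> ?C" "i' \<in> ?C" "i \<noteq> i'" for i i'
  proof -
    obtain k where k: "i $ k \<noteq> i' $ k" using \<open>i \<noteq> i'\<close> by (auto simp: vec_eq_iff)
    then have kk: "k \<noteq> k0" using that by (auto simp: columns_def)
    \<comment> \<open>The cells can only meet in the hyperplane that bounds the cell of
      \<open>i\<close> on the side of \<open>i'\<close>.\<close>
    define c where "c = (if i $ k < i' $ k then P * i $ k + P / 2 else P * i $ k - P / 2)"
    have "cell i \<inter> cell i' \<subseteq> R' ` {x. x \<bullet> axis k 1 = c}"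
    proof
      fix x assume "x \<in> cell i \<inter> cell i'"
      then have x: "\<bar>Q' x $ k - P * i $ k\<bar> \<le> P / 2" "\<bar>Q' x $ k - P * i' $ k\<bar> \<le> P / 2"
        using mem_cell[of x i k] mem_cell[of x i' k] kk by (auto simp: frame_diff[OF Q'] node)
      have "Q' x $ k = c"
      proof (cases "i $ k < i' $ k")
        case True
        then have "P * (i $ k + 1) \<le> P * i' $ k" using P by (intro mult_left_mono) auto
        then have "P * i $ k + P \<le> P * i' $ k" by (simp add: algebra_simps)
        then show ?thesis using x unfolding c_def if_P[OF True] by linarith
      next
        case False
        then have "P * (i' $ k + 1) \<le> P * i $ k" using P k by (intro mult_left_mono) auto
        then have "P * i' $ k + P \<le> P * i $ k" by (simp add: algebra_simps)
        then show ?thesis using x unfolding c_def if_not_P[OF False] by linarith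
      qed
      then have "Q' x \<in> {x. x \<bullet> axis k 1 = c}" by (simp add: inner_axis)
      moreover have "x = R' (Q' x)"
        using frame_inv[OF Q'] by (simp add: R'_def)
      ultimately show "x \<in> R' ` {x. x \<bullet> axis k 1 = c}" by blast
    qed
    moreover have "negligible (R' ` {x. x \<bullet> axis k 1 = c})"
    proof -
      have "negligible {x :: real ^ 'd. x \<bullet> axis k 1 = c}"
        using negligible_hyperplane[of "axis k 1 :: real ^ 'd" c]
        by (simp add: inner_commute axis_eq_0_iff)
      then show ?thesis
        using orthogonal_preserves_lebesgue[OF orth(2)] unfolding negligible_iff_measure by metis
    qed
    ultimately show ?thesis using negligible_subset by blast
  qed
  then have "measure lebesgue (\<Union>i\<in>?C. cell i) = (\<Sum>i\<in>?C. measure lebesgue (cell i))"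
    using cell_meas finite_columns by (intro measure_negligible_finite_Union_image) (auto simp: pairwise_def)
  then have "real (card ?C) * P ^ (CARD('d) - 1) = measure lebesgue (\<Union>i\<in>?C. cell i)"
    by (simp add: cell_meas)
  also have "\<dots> \<le> measure lebesgue ((\<lambda>x. x + (T * j) *\<^sub>R n) ` big)"
  proof (rule measure_mono_fmeasurable)
    show "(\<Union>i\<in>?C. cell i) \<subseteq> (\<lambda>x. x + (T * j) *\<^sub>R n) ` big"
    proof safe
      fix i x assume i: "i \<in> ?C" and x: "x \<in> cell i"
      define y where "y = x - (T * j) *\<^sub>R n"
      have Qn: "S n $ k = (if k = k0 then 1 else 0)" if "frame n k0 S" for S k
        using that by (simp add: frame_def axis_def)
      have Qy: "S y $ k = S x $ k - (if k = k0 then T * j else 0)" if S: "frame n k0 S" for S k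
        using Qn[OF S, of k] frame_linear[OF S] by (simp add: y_def linear_diff linear_scale)
      have "\<bar>Q y $ k\<bar> \<le> (if k = k0 then 1/2 else N/2)" for k
      proof (cases "k = k0")
        case True
        then show ?thesis
          using mem_cell[OF x, of k0] i Qy[OF Q, of k0]
          by (simp add: inner_eq_coord frame_diff[OF Q'] node columns_def)
      next
        case False
        have "\<bar>Q (x - node i) $ k\<bar> \<le> (D - 1) * (P / 2)"
        proof (rule lateral_change[OF Q' Q _ False])
          fix l assume "l \<noteq> k0"
          then show "\<bar>Q' (x - node i) $ l\<bar> \<le> P / 2" using mem_cell[OF x, of l] by simp
        qed
        moreover have "\<bar>Q (node i) $ k\<bar> \<le> N / 2 - D * P" using i False by (simp add: columns_def)
        moreover have "(D - 1) * (P / 2) \<le> D * P" using D P by (intro mult_mono) auto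
        moreover have "Q y $ k = Q x $ k" using False Qy[OF Q, of k] by simp
        ultimately show ?thesis unfolding if_not_P[OF False] frame_diff_nth[OF Q] by linarith
      qed
      then have "Q y \<in> cuboid N" by (simp add: mem)
      then have "y \<in> big" using QR(3)[of y] unfolding big_def by (metis image_eqI)
      moreover have "x = y + (T * j) *\<^sub>R n" by (simp add: y_def)
      ultimately show "x \<in> (\<lambda>x. x + (T * j) *\<^sub>R n) ` big" by blast
    qed
    show "(\<Union>i\<in>?C. cell i) \<in> sets lebesgue"
      using cell_meas finite_columns by (intro sets.finite_UN) (auto simp: fmeasurableD)
    show "(\<lambda>x. x + (T * j) *\<^sub>R n) ` big \<in> lmeasurable"
      using measurable_translation[OF big_meas(1), of "(T * j) *\<^sub>R n"] by (simp add: add.commute)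
  qed
  also have "\<dots> = N ^ (CARD('d) - 1)"
    using measure_translation[of "(T * j) *\<^sub>R n" big] big_meas by (simp add: add.commute)
  finally show ?thesis .
qed

end

section \<open>Counting the edges closed in one layer\<close>

context block_grid
begin

text \<open>The three kinds of sites at which edges have to be closed are all of the form \<open>sheet\<close>: the height
  and one lateral coordinate are confined, and the other ones are only bounded by the size of the box.
  The confined lateral coordinate lies in a \<open>rim\<close>, at distance at most \<open>s\<close> from the lateral
  boundary, or in the \<open>walls\<close> between the blocks.\<close>
definition sheet :: "real \<Rightarrow> (real ^ 'd \<Rightarrow> real ^ 'd) \<Rightarrow> 'd \<Rightarrow> real set \<Rightarrow> real \<Rightarrow> real \<Rightarrow> (int ^ 'd) set" where
  "sheet M R k B a b = {y. emb y \<bullet> n \<in> {a..b} \<and> R (emb y) $ k \<in> B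
     \<and> (\<forall>j. j \<noteq> k0 \<longrightarrow> \<bar>R (emb y) $ j\<bar> \<le> M)}"

lemma card_sheet:
  assumes R: "frame n k0 R" and k: "k \<noteq> k0" and ab: "a \<le> b" and M: "0 \<le> M" "M \<le> D * N" and N: "N \<ge> 1"
    and B: "finite (mesh_cells CARD('d) B)" "real (card (mesh_cells CARD('d) B)) \<le> m"
  shows "finite (sheet M R k B a b)"
    "real (card (sheet M R k B a b)) \<le> (D * (b - a) + 2) * m * (4 * D\<^sup>2 * N) ^ (CARD('d) - 2)"
proof -
  have Y: "emb y \<bullet> n \<in> {a..b} \<and> R (emb y) $ k \<in> B \<and> (\<forall>j. j \<noteq> k0 \<longrightarrow> \<bar>R (emb y) $ j\<bar> \<le> M)"
    if "y \<in> sheet M R k B a b" for y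
    using that by (simp add: sheet_def)
  note cs = count_sites_slab[where Y = "sheet M R k B a b", OF R k ab M(1) B Y]
  show "finite (sheet M R k B a b)" by (rule cs(1))
  have m: "0 \<le> m" using B(2) by linarith
  have "1 * 1 * 1 \<le> D * D * N" using D N by (intro mult_mono) auto
  moreover have "2 * D * M \<le> 2 * D * (D * N)" using M D by (intro mult_left_mono) auto
  ultimately have "2 * D * M + 2 \<le> 2 * D * (D * N) + 2 * (D * D * N)" by linarith
  then have "2 * D * M + 2 \<le> 4 * D\<^sup>2 * N" by (simp add: power2_eq_square algebra_simps)
  then have "(2 * D * M + 2) ^ (CARD('d) - 2) \<le> (4 * D\<^sup>2 * N) ^ (CARD('d) - 2)"
    using M D by (intro power_mono) auto
  then have "(D * (b - a) + 2) * m * (2 * D * M + 2) ^ (CARD('d) - 2)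
      \<le> (D * (b - a) + 2) * m * (4 * D\<^sup>2 * N) ^ (CARD('d) - 2)"
    using m ab D by (intro mult_left_mono mult_nonneg_nonneg add_nonneg_nonneg) auto
  then show "real (card (sheet M R k B a b)) \<le> (D * (b - a) + 2) * m * (4 * D\<^sup>2 * N) ^ (CARD('d) - 2)"
    using cs(2) by (simp add: D_def)
qed

definition rim :: "real \<Rightarrow> real \<Rightarrow> real set" where
  "rim N s = {-(N / 2)..-(N / 2 - s)} \<union> {N / 2 - s..N / 2}"

lemma mem_rim: "N / 2 - s \<le> \<bar>t\<bar> \<Longrightarrow> \<bar>t\<bar> \<le> N / 2 \<Longrightarrow> t \<in> rim N s"
  by (auto simp: rim_def)

lemma mesh_cells_rim:
  assumes "s \<ge> 0"
  shows "finite (mesh_cells CARD('d) (rim N s))" "real (card (mesh_cells CARD('d) (rim N s))) \<le> 2 * (D * s + 2)"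
proof -
  show "finite (mesh_cells CARD('d) (rim N s))"
    by (simp add: rim_def mesh_cells_Un mesh_cells_interval(1))
  have "real (card (mesh_cells CARD('d) {-(N / 2)..-(N / 2 - s)})) \<le> D * s + 2"
    "real (card (mesh_cells CARD('d) {N / 2 - s..N / 2})) \<le> D * s + 2"
    using mesh_cells_interval(2)[of "-(N / 2)" "-(N / 2 - s)" "CARD('d)"]
      mesh_cells_interval(2)[of "N / 2 - s" "N / 2" "CARD('d)"] assms by (simp_all add: D_def)
  moreover have "real (card (mesh_cells CARD('d) (rim N s)))
      \<le> real (card (mesh_cells CARD('d) {-(N / 2)..-(N / 2 - s)})) + real (card (mesh_cells CARD('d) {N / 2 - s..N / 2}))"
    unfolding rim_def mesh_cells_Un using card_Un_le of_nat_mono by (metis of_nat_add)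
  ultimately show "real (card (mesh_cells CARD('d) (rim N s))) \<le> 2 * (D * s + 2)" by (simp add: algebra_simps)
qed

definition walls :: "real \<Rightarrow> real set" where
  "walls N = (\<Union>m\<in>{-(\<lfloor>D * N / P\<rfloor> + 1)..\<lfloor>D * N / P\<rfloor> + 1}.
     {P * m - P / 2..P * m - (L / 2 - D - 1)} \<union> {P * m + (L / 2 - D - 1)..P * m + P / 2})"

lemma mem_walls:
  assumes "\<bar>t\<bar> \<le> D * N" and "L / 2 - D - 1 \<le> \<bar>t - P * round (t / P)\<bar>"
  shows "t \<in> walls N"
proof -
  define m where "m = round (t / P)"
  have r: "\<bar>real_of_int m - t / P\<bar> \<le> 1 / 2" unfolding m_def by (rule of_int_round_abs_le)
  have "P * \<bar>real_of_int m - t / P\<bar> \<le> P * (1 / 2)" using r P by (intro mult_left_mono) auto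
  moreover have "P * \<bar>real_of_int m - t / P\<bar> = \<bar>P * m - t\<bar>"
    using P by (simp add: abs_mult_pos' flip: abs_mult) (simp add: algebra_simps)
  ultimately have near: "\<bar>t - P * m\<bar> \<le> P / 2" by linarith
  have "\<bar>t / P\<bar> \<le> D * N / P" using assms(1) P by (simp add: abs_divide divide_right_mono)
  then have "\<bar>real_of_int m\<bar> \<le> D * N / P + 1 / 2" using r by linarith
  then have "m \<in> {-(\<lfloor>D * N / P\<rfloor> + 1)..\<lfloor>D * N / P\<rfloor> + 1}" by simp linarith
  moreover have "t \<in> {P * m - P / 2..P * m - (L / 2 - D - 1)} \<union> {P * m + (L / 2 - D - 1)..P * m + P / 2}"
    using near assms(2) unfolding m_def[symmetric] by (simp; linarith)
  ultimately show ?thesis unfolding walls_def by blast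
qed

lemma mesh_cells_walls:
  assumes "N \<ge> 0"
  shows "finite (mesh_cells CARD('d) (walls N))"
    "real (card (mesh_cells CARD('d) (walls N))) \<le> (2 * (D * N / P) + 3) * (2 * (D * (2 * D + 1) + 2))"
proof -
  let ?M = "\<lfloor>D * N / P\<rfloor> + 1" and ?a = "D * (2 * D + 1) + 2"
  let ?A = "\<lambda>m. {P * m - P / 2..P * m - (L / 2 - D - 1)}" and ?B = "\<lambda>m. {P * m + (L / 2 - D - 1)..P * m + P / 2}"
  have eq: "mesh_cells CARD('d) (walls N) = (\<Union>m\<in>{-?M..?M}. mesh_cells CARD('d) (?A m) \<union> mesh_cells CARD('d) (?B m))"
    unfolding walls_def mesh_cells_UN mesh_cells_Un ..
  show "finite (mesh_cells CARD('d) (walls N))" unfolding eq by (auto simp: mesh_cells_interval(1))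
  have one: "real (card (mesh_cells CARD('d) (?A m) \<union> mesh_cells CARD('d) (?B m))) \<le> 2 * ?a" for m :: int
  proof -
    have int: "real (card (mesh_cells CARD('d) {x..x + (2 * D + 1)})) \<le> ?a" for x
      using mesh_cells_interval(2)[of x "x + (2 * D + 1)" "CARD('d)"] D by (simp add: D_def)
    have "P * m - (L / 2 - D - 1) = (P * m - P / 2) + (2 * D + 1)"
      "P * m + P / 2 = (P * m + (L / 2 - D - 1)) + (2 * D + 1)" by (simp_all add: P_def field_simps)
    then have "real (card (mesh_cells CARD('d) (?A m))) \<le> ?a" "real (card (mesh_cells CARD('d) (?B m))) \<le> ?a"
      using int by metis+
    then have "real (card (mesh_cells CARD('d) (?A m))) + real (card (mesh_cells CARD('d) (?B m))) \<le> 2 * ?a"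
      by (simp only: mult_2 add_mono)
    moreover have "real (card (mesh_cells CARD('d) (?A m) \<union> mesh_cells CARD('d) (?B m)))
        \<le> real (card (mesh_cells CARD('d) (?A m))) + real (card (mesh_cells CARD('d) (?B m)))"
      using of_nat_mono[OF card_Un_le[of "mesh_cells CARD('d) (?A m)" "mesh_cells CARD('d) (?B m)"], where 'a = real]
      by simp
    ultimately show ?thesis by (rule order_trans[rotated])
  qed
  have "card (mesh_cells CARD('d) (walls N)) \<le> (\<Sum>m\<in>{-?M..?M}. card (mesh_cells CARD('d) (?A m) \<union> mesh_cells CARD('d) (?B m)))"
    unfolding eq by (intro card_UN_le) auto
  from of_nat_mono[OF this, where 'a = real]
  have "real (card (mesh_cells CARD('d) (walls N)))
      \<le> (\<Sum>m\<in>{-?M..?M}. real (card (mesh_cells CARD('d) (?A m) \<union> mesh_cells CARD('d) (?B m))))"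
    unfolding of_nat_sum .
  also have "\<dots> \<le> real (card {-?M..?M}) * (2 * ?a)" using one by (intro sum_bounded_above) auto
  also have "\<dots> \<le> (2 * (D * N / P) + 3) * (2 * ?a)"
  proof (intro mult_right_mono)
    have floor_bound: "2 * real_of_int (\<lfloor>x\<rfloor> + 1) + 1 \<le> 2 * x + 3" for x :: real by simp
    have "0 \<le> D * N / P" using assms D P by simp
    then have "0 \<le> \<lfloor>D * N / P\<rfloor>" by simp
    then have "real (card {-?M..?M}) = 2 * real_of_int ?M + 1" by simp
    also have "\<dots> \<le> 2 * (D * N / P) + 3" by (rule floor_bound)
    finally show "real (card {-?M..?M}) \<le> 2 * (D * N / P) + 3" .
  qed (use D in auto)
  finally show "real (card (mesh_cells CARD('d) (walls N))) \<le> (2 * (D * N / P) + 3) * (2 * ?a)" .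
qed

text \<open>The static label for \<open>cut_from_local_cuts\<close>: away from the blocks and the boundary, the interface
  is placed at the height \<open>T * j\<close> of the layer.\<close>
definition side :: "real \<Rightarrow> int \<Rightarrow> (int ^ 'd) set \<Rightarrow> int ^ 'd \<Rightarrow> bool" where
  "side N j \<Lambda> y \<longleftrightarrow>
    (if \<exists>i\<in>columns N j. y \<in> block i then \<exists>i\<in>columns N j. y \<in> block i \<and> emb y \<bullet> n \<ge> emb (centre i) \<bullet> n
     else if y \<in> bdry \<Lambda> then emb y \<bullet> n \<ge> 0 else emb y \<bullet> n \<ge> T * j)"

lemma side_block: "i \<in> columns N j \<Longrightarrow> y \<in> block i \<Longrightarrow> side N j \<Lambda> y \<longleftrightarrow> (emb y - emb (centre i)) \<bullet> n \<ge> 0"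
proof -
  assume i: "i \<in> columns N j" "y \<in> block i"
  have "i' = i" if "y \<in> block i'" for i' using that i(2) blocks_disjoint[of i' i] by blast
  then have "(\<exists>i'\<in>columns N j. y \<in> block i' \<and> emb y \<bullet> n \<ge> emb (centre i') \<bullet> n)
      \<longleftrightarrow> emb y \<bullet> n \<ge> emb (centre i) \<bullet> n"
    using i by metis
  moreover have "\<exists>i\<in>columns N j. y \<in> block i" using i by blast
  ultimately show ?thesis by (simp add: side_def inner_diff_left)
qed

lemma side_height:
  assumes j: "j \<ge> 0"
  shows "side N j \<Lambda> y \<Longrightarrow> emb y \<bullet> n \<ge> - D" "\<not> side N j \<Lambda> y \<Longrightarrow> emb y \<bullet> n \<le> T * j + D"
    "side N j \<Lambda> y \<Longrightarrow> y \<notin> bdry \<Lambda> \<Longrightarrow> emb y \<bullet> n \<ge> T * j - D"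
proof -
  have Tj: "0 \<le> T * j" using T j by simp
  consider i where "i \<in> columns N j" "y \<in> block i" | "\<not> (\<exists>i\<in>columns N j. y \<in> block i)" by blast
  then have "(side N j \<Lambda> y \<longrightarrow> emb y \<bullet> n \<ge> - D \<and> (y \<notin> bdry \<Lambda> \<longrightarrow> emb y \<bullet> n \<ge> T * j - D))
    \<and> (\<not> side N j \<Lambda> y \<longrightarrow> emb y \<bullet> n \<le> T * j + D)"
  proof cases
    case 1
    have s: "side N j \<Lambda> y \<longleftrightarrow> emb y \<bullet> n \<ge> emb (centre i) \<bullet> n"
      using side_block[OF 1, of \<Lambda>] by (simp add: inner_diff_left)
    show ?thesis using block_height[OF 1(1)] Tj unfolding s abs_le_iff by linarith
  next
    case 2
    have s: "side N j \<Lambda> y \<longleftrightarrow> (if y \<in> bdry \<Lambda> then emb y \<bullet> n \<ge> 0 else emb y \<bullet> n \<ge> T * j)"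
      unfolding side_def using 2 by simp
    show ?thesis using Tj D unfolding s by (cases "y \<in> bdry \<Lambda>"; simp; linarith)
  qed
  then show "side N j \<Lambda> y \<Longrightarrow> emb y \<bullet> n \<ge> - D" "\<not> side N j \<Lambda> y \<Longrightarrow> emb y \<bullet> n \<le> T * j + D"
    "side N j \<Lambda> y \<Longrightarrow> y \<notin> bdry \<Lambda> \<Longrightarrow> emb y \<bullet> n \<ge> T * j - D" by blast+
qed

text \<open>A site far from the walls lies in its block together with all its neighbours, in spite of the
  rounding of the centre.\<close>
lemma deep_site_in_block:
  assumes i: "i \<in> columns N j" and u: "\<And>k. k \<noteq> k0 \<Longrightarrow> \<bar>Q' (emb u) $ k - P * i $ k\<bar> < L / 2 - D - 1"
    and hu: "\<bar>emb u \<bullet> n - T * j\<bar> \<le> D + 1" and h2: "h > 2 * D + 2" and uv: "norm (emb v - emb u) \<le> 1"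
  shows "v \<in> block i"
proof -
  have "\<bar>Q' (emb v - emb u) $ k\<bar> \<le> 1" for k
    using frame_component_le[OF Q', of "emb v - emb u" k] uv by linarith
  note uv' = this[unfolded frame_diff_nth[OF Q']]
  have c: "\<bar>Q' (emb (centre i)) $ k - (if k = k0 then T else P) * i $ k\<bar> \<le> D" for k
    using centre_near[OF Q', of i k] unfolding frame_diff_nth[OF Q'] node .
  have "\<bar>Q' (emb v) $ k - Q' (emb (centre i)) $ k\<bar> < L / 2" if "k \<noteq> k0" for k
    using uv'[of k] c[of k] u[OF that] unfolding if_not_P[OF that] by linarith
  moreover have "\<bar>Q' (emb v) $ k0 - Q' (emb (centre i)) $ k0\<bar> < h"
    using uv'[of k0] block_height[OF i] hu h2 unfolding inner_eq_coord by linarith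
  ultimately show ?thesis by (simp add: block_def box_sites_def frame_diff[OF Q'])
qed

lemma bdry_near_rim:
  assumes z: "z \<notin> box_sites Q k0 0 N H" and uz: "norm (emb z - emb u) \<le> 2"
    and hu: "\<bar>emb u \<bullet> n\<bar> + 2 < H"
  shows "\<exists>k. k \<noteq> k0 \<and> N / 2 - 2 \<le> \<bar>Q (emb u) $ k\<bar>"
proof -
  have d: "\<bar>Q (emb z) $ k - Q (emb u) $ k\<bar> \<le> 2" for k
    using frame_component_le[OF Q, of "emb z - emb u" k] uz unfolding frame_diff_nth[OF Q] by linarith
  have "\<bar>Q (emb z) $ k0\<bar> < H"
    using d[of k0] hu frame_normal[OF Q, of "emb u"] by linarith
  then obtain k where k: "k \<noteq> k0" "\<not> \<bar>Q (emb z) $ k\<bar> < N / 2"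
    using z by (auto simp: box_sites_def)
  have "N / 2 - 2 \<le> \<bar>Q (emb u) $ k\<bar>" using d[of k] k(2) by linarith
  then show ?thesis using k(1) by blast
qed

definition bad_sites :: "real \<Rightarrow> int \<Rightarrow> (int ^ 'd) set" where
  "bad_sites N j = (\<Union>k\<in>UNIV - {k0}.
      sheet (N / 2) Q k (rim N 2) (- D - 1) (T * j + D + 1)
    \<union> sheet (N / 2) Q k (rim N (2 * D * P)) (T * j - D - 1) (T * j + D + 1)
    \<union> sheet (D * N) Q' k (walls N) (T * j - D - 1) (T * j + D + 1))"

text \<open>Where labels of neighbours differ outside the blocks. If one of the two sites is on the boundary
  of the box, it is near the lateral boundary at a height between \<open>0\<close> and that of the layer, up to constants.
  Otherwise both are near the height of the layer, and the grid cell of \<open>u\<close> is either not used,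
  hence near the lateral boundary, or used, hence \<open>u\<close> is near a wall.\<close>
lemma mismatch_bad:
  assumes j: "j \<ge> 0" and N: "N \<ge> 1" and h2: "h > 2 * D + 2" and H: "T * j + h + D + 3 \<le> H"
  defines "\<Lambda> \<equiv> box_sites Q k0 0 N H"
  assumes u: "u \<in> \<Lambda>" and v: "v \<in> \<Lambda>" and uv: "u \<sim> v"
    and su: "side N j \<Lambda> u" and sv: "\<not> side N j \<Lambda> v"
    and nb: "\<And>i. i \<in> columns N j \<Longrightarrow> \<not> {u, v} \<subseteq> block i"
  shows "u \<in> bad_sites N j"
proof -
  have Tj: "0 \<le> T * j" using T j by simp
  have uv1: "norm (emb v - emb u) \<le> 1" using uv by (simp add: adj_def norm_minus_commute)
  have hn: "\<bar>emb u \<bullet> n - emb v \<bullet> n\<bar> \<le> 1"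
    using adj_frame_le[OF Q uv, of k0] by (simp add: frame_normal[OF Q])
  have up: "emb u \<bullet> n \<le> T * j + D + 1" and lo: "- D \<le> emb u \<bullet> n"
    using side_height(1)[OF j su] side_height(2)[OF j sv] hn by linarith+
  have lat: "\<bar>Q (emb u) $ k\<bar> \<le> N / 2" if "k \<noteq> k0" for k
    using u that by (simp add: \<Lambda>_def box_sites_def less_imp_le)
  show ?thesis
  proof (cases "u \<in> bdry \<Lambda> \<or> v \<in> bdry \<Lambda>")
    case True
    have hu: "\<bar>emb u \<bullet> n\<bar> + 2 < H" using up lo Tj H h2 D by linarith
    have "\<exists>z. z \<notin> \<Lambda> \<and> norm (emb z - emb u) \<le> 2"
    proof (cases "u \<in> bdry \<Lambda>")
      case True
      then obtain z where "z \<notin> \<Lambda>" "z \<sim> u" by (auto simp: bdry_def)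
      then show ?thesis by (intro exI[of _ z]) (simp add: adj_def)
    next
      case False
      then obtain z where z: "z \<notin> \<Lambda>" "z \<sim> v" using \<open>u \<in> bdry \<Lambda> \<or> v \<in> bdry \<Lambda>\<close> by (auto simp: bdry_def)
      have "norm (emb z - emb u) \<le> norm (emb z - emb v) + norm (emb v - emb u)"
        using norm_triangle_ineq[of "emb z - emb v" "emb v - emb u"] by simp
      then show ?thesis using z uv1 by (intro exI[of _ z]) (simp add: adj_def)
    qed
    then obtain k where k: "k \<noteq> k0" "N / 2 - 2 \<le> \<bar>Q (emb u) $ k\<bar>"
      using bdry_near_rim[OF _ _ hu] unfolding \<Lambda>_def by blast
    then have "u \<in> sheet (N / 2) Q k (rim N 2) (- D - 1) (T * j + D + 1)"
      using lat up lo by (auto simp: sheet_def intro!: mem_rim)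
    then show ?thesis using k(1) by (auto simp: bad_sites_def)
  next
    case False
    then have lo': "T * j - D \<le> emb u \<bullet> n" using side_height(3)[OF j su] by simp
    define i where "i = (\<chi> k. if k = k0 then j else round (Q' (emb u) $ k / P))"
    have ik: "i $ k = round (Q' (emb u) $ k / P)" if "k \<noteq> k0" for k using that by (simp add: i_def)
    have ik0: "i $ k0 = j" by (simp add: i_def)
    have near: "\<bar>Q' (emb u) $ k - P * i $ k\<bar> \<le> P / 2" if "k \<noteq> k0" for k
    proof -
      have "\<bar>real_of_int (i $ k) - Q' (emb u) $ k / P\<bar> \<le> 1 / 2"
        unfolding ik[OF that] by (rule of_int_round_abs_le)
      then have "P * \<bar>real_of_int (i $ k) - Q' (emb u) $ k / P\<bar> \<le> P * (1 / 2)"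
        using P by (intro mult_left_mono) auto
      moreover have "P * \<bar>real_of_int (i $ k) - Q' (emb u) $ k / P\<bar> = \<bar>P * i $ k - Q' (emb u) $ k\<bar>"
        using P by (simp add: abs_mult_pos' flip: abs_mult) (simp add: algebra_simps)
      ultimately show ?thesis by linarith
    qed
    show ?thesis
    proof (cases "i \<in> columns N j")
      case True
      have "\<not> (\<forall>k. k \<noteq> k0 \<longrightarrow> \<bar>Q' (emb u) $ k - P * i $ k\<bar> < L / 2 - D - 1)"
      proof
        assume deep: "\<forall>k. k \<noteq> k0 \<longrightarrow> \<bar>Q' (emb u) $ k - P * i $ k\<bar> < L / 2 - D - 1"
        have hu: "\<bar>emb u \<bullet> n - T * j\<bar> \<le> D + 1" using up lo' by linarith
        have "u \<in> block i" "v \<in> block i"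
          using deep_site_in_block[OF True _ hu h2] deep uv1 by auto
        then show False using nb[OF True] by simp
      qed
      then obtain k where k: "k \<noteq> k0" "L / 2 - D - 1 \<le> \<bar>Q' (emb u) $ k - P * i $ k\<bar>" by force
      have lat': "\<bar>Q' (emb u) $ l\<bar> \<le> D * N" if "l \<noteq> k0" for l
      proof -
        have "\<bar>Q' (emb u) $ l\<bar> \<le> (D - 1) * (N / 2)" by (rule lateral_change[OF Q Q' lat that])
        also have "\<dots> \<le> D * N" using D N by (intro mult_mono) auto
        finally show ?thesis .
      qed
      have "Q' (emb u) $ k \<in> walls N"
        using k(2) lat'[OF k(1)] unfolding ik[OF k(1)] by (intro mem_walls)
      then have "u \<in> sheet (D * N) Q' k (walls N) (T * j - D - 1) (T * j + D + 1)"
        using lat' up lo' by (auto simp: sheet_def)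
      then show ?thesis using k(1) by (auto simp: bad_sites_def)
    next
      case False
      then obtain k where k: "k \<noteq> k0" "\<not> \<bar>Q (node i) $ k\<bar> \<le> N / 2 - D * P"
        using ik0 by (auto simp: columns_def)
      have "\<bar>Q' (emb u - node i) $ l\<bar> \<le> P / 2" if "l \<noteq> k0" for l
        using near[OF that] that by (simp add: frame_diff_nth[OF Q'] node)
      then have "\<bar>Q (emb u - node i) $ k\<bar> \<le> (D - 1) * (P / 2)"
        using k(1) by (intro lateral_change[OF Q' Q])
      moreover have "(D - 1) * (P / 2) \<le> D * P" using D P by (intro mult_mono) auto
      ultimately have "N / 2 - 2 * D * P \<le> \<bar>Q (emb u) $ k\<bar>"
        using k(2) unfolding frame_diff_nth[OF Q] by linarith
      then have "u \<in> sheet (N / 2) Q k (rim N (2 * D * P)) (T * j - D - 1) (T * j + D + 1)"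
        using k(1) lat up lo' by (auto simp: sheet_def intro!: mem_rim)
      then show ?thesis using k(1) by (auto simp: bad_sites_def)
    qed
  qed
qed

definition interface_const :: real where
  "interface_const = 16 * D * (D * (2 * D + 3) + 2) ^ 3 * (4 * D\<^sup>2) ^ (CARD('d) - 2)"

text \<open>The sum of the bounds for the three sheets with the same confined coordinate, in units of \<open>N\<^sup>d\<^sup>-\<^sup>2\<close>
  and with \<open>x = D N / P\<close>, \<open>s = P\<close> and \<open>y = T j\<close>; the constant is not optimized.\<close>
lemma bad_sites_arithmetic:
  fixes x s y a :: real
  assumes a: "a = D * (2 * D + 3) + 2" and s: "s \<ge> 1" and x: "x \<ge> 0" and y: "y \<ge> 0"
  shows "(D * (y + D + 1 - (- D - 1)) + 2) * (2 * (D * 2 + 2))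
    + (D * ((y + D + 1) - (y - D - 1)) + 2) * (2 * (D * (2 * D * s) + 2))
    + (D * ((y + D + 1) - (y - D - 1)) + 2) * ((2 * x + 3) * (2 * (D * (2 * D + 1) + 2)))
    \<le> 16 * a ^ 3 * (x / D + s + y)"
proof -
  have DD: "D \<le> D * D" using D by simp
  then have aD: "D * D * 2 \<le> a" "D + 1 \<le> a" "1 \<le> a" using D by (simp_all add: a algebra_simps)
  have a1: "a \<le> a ^ 3" "a\<^sup>2 \<le> a ^ 3" using aD by (simp_all add: power_increasing[of 1 3 a, simplified] power_increasing)
  have e1: "D * (y + D + 1 - (- D - 1)) + 2 \<le> D * y + a"
    using D by (simp add: a algebra_simps)
  have e2: "D * ((y + D + 1) - (y - D - 1)) + 2 \<le> a" "0 \<le> D * ((y + D + 1) - (y - D - 1)) + 2"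
    using D by (simp_all add: a algebra_simps)
  have "(D * (y + D + 1 - (- D - 1)) + 2) * (2 * (D * 2 + 2)) \<le> (D * y + a) * (2 * (D * 2 + 2))"
    using e1 D by (intro mult_right_mono) auto
  also have "\<dots> = 4 * (D * (D + 1)) * y + 4 * (a * (D + 1))" by (simp add: algebra_simps)
  also have "\<dots> \<le> 4 * a * y + 4 * (a * a)"
    using aD DD y D by (intro add_mono mult_right_mono mult_left_mono) (auto simp: algebra_simps a)
  also have "\<dots> \<le> 4 * a ^ 3 * y + 4 * a ^ 3 * s"
  proof (intro add_mono)
    show "4 * a * y \<le> 4 * a ^ 3 * y" using a1 y by (intro mult_right_mono) auto
    have "a * a \<le> a ^ 3 * s" using mult_mono[of "a\<^sup>2" "a ^ 3" 1 s] a1 s aD by (simp add: power2_eq_square)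
    then show "4 * (a * a) \<le> 4 * a ^ 3 * s" by simp
  qed
  finally have t1: "(D * (y + D + 1 - (- D - 1)) + 2) * (2 * (D * 2 + 2)) \<le> 4 * a ^ 3 * y + 4 * a ^ 3 * s" .
  have "2 * (D * (2 * D * s) + 2) = (4 * (D * D)) * s + 4" by (simp add: algebra_simps)
  also have "\<dots> \<le> (2 * a) * s + 4 * s" using aD s by (intro add_mono mult_right_mono) auto
  also have "\<dots> \<le> 6 * a * s" using aD s mult_right_mono[of 1 a s] by (simp add: algebra_simps)
  finally have "2 * (D * (2 * D * s) + 2) \<le> 6 * a * s" .
  from mult_mono[OF e2(1) this]
  have "(D * ((y + D + 1) - (y - D - 1)) + 2) * (2 * (D * (2 * D * s) + 2)) \<le> a * (6 * a * s)"
    using aD D s by simp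
  also have "\<dots> = 6 * a\<^sup>2 * s" by (simp add: power2_eq_square)
  also have "\<dots> \<le> 6 * a ^ 3 * s" using a1 s by (intro mult_right_mono) auto
  finally have t2: "(D * ((y + D + 1) - (y - D - 1)) + 2) * (2 * (D * (2 * D * s) + 2)) \<le> 6 * a ^ 3 * s" .
  have "(2 * x + 3) * (2 * (D * (2 * D + 1) + 2)) \<le> (2 * x + 3) * (2 * a)"
    using x D by (intro mult_left_mono) (auto simp: a algebra_simps)
  from mult_mono[OF e2(1) this]
  have "(D * ((y + D + 1) - (y - D - 1)) + 2) * ((2 * x + 3) * (2 * (D * (2 * D + 1) + 2))) \<le> a * ((2 * x + 3) * (2 * a))"
    using aD D x by simp
  also have "\<dots> = 4 * (a\<^sup>2 * D) * (x / D) + 6 * a\<^sup>2" using D by (simp add: power2_eq_square field_simps)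
  also have "\<dots> \<le> 4 * a ^ 3 * (x / D) + 6 * a ^ 3 * s"
  proof (intro add_mono mult_right_mono)
    have "a\<^sup>2 * D \<le> a\<^sup>2 * a" using aD by (intro mult_left_mono) auto
    then show "4 * (a\<^sup>2 * D) \<le> 4 * a ^ 3" by (simp add: power2_eq_square power3_eq_cube)
    have "a\<^sup>2 * 1 \<le> a ^ 3 * s" using a1 s aD by (intro mult_mono) auto
    then show "6 * a\<^sup>2 \<le> 6 * a ^ 3 * s" by simp
  qed (use x D in auto)
  finally have t3: "(D * ((y + D + 1) - (y - D - 1)) + 2) * ((2 * x + 3) * (2 * (D * (2 * D + 1) + 2)))
    \<le> 4 * a ^ 3 * (x / D) + 6 * a ^ 3 * s" .
  have "0 \<le> a ^ 3 * (x / D)" "0 \<le> a ^ 3 * y" using x y D aD by simp_all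
  moreover have "16 * a ^ 3 * (x / D + s + y) = 16 * (a ^ 3 * (x / D)) + 16 * (a ^ 3 * s) + 16 * (a ^ 3 * y)"
    by (simp add: algebra_simps)
  ultimately show ?thesis using t1 t2 t3 by linarith
qed

lemma card_bad_sites:
  assumes j: "j \<ge> 0" and N: "N \<ge> 1"
  shows "finite (bad_sites N j)"
    "real (card (bad_sites N j)) \<le> interface_const * N ^ (CARD('d) - 2) * (N / P + P + T * j)"
proof -
  define y where "y = T * j"
  define G where "G = (4 * D\<^sup>2 * N) ^ (CARD('d) - 2)"
  define s1 where "s1 k = sheet (N / 2) Q k (rim N 2) (- D - 1) (y + D + 1)" for k
  define s2 where "s2 k = sheet (N / 2) Q k (rim N (2 * D * P)) (y - D - 1) (y + D + 1)" for k
  define s3 where "s3 k = sheet (D * N) Q' k (walls N) (y - D - 1) (y + D + 1)" for k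
  have y: "y \<ge> 0" using T j by (simp add: y_def)
  have ord: "- D - 1 \<le> y + D + 1" "y - D - 1 \<le> y + D + 1" using y D by simp_all
  have M: "0 \<le> N / 2" "N / 2 \<le> D * N" "0 \<le> D * N"
    using N D mult_right_mono[of "1 / 2" D N] by simp_all
  have DP: "0 \<le> 2 * D * P" using D P by simp
  have N0: "0 \<le> N" using N by simp
  have bad: "bad_sites N j = (\<Union>k\<in>UNIV - {k0}. s1 k \<union> s2 k \<union> s3 k)"
    by (simp add: bad_sites_def s1_def s2_def s3_def y_def)
  note b1 = card_sheet[OF Q _ ord(1) M(1,2) N mesh_cells_rim, of _ 2]
  note b2 = card_sheet[OF Q _ ord(2) M(1,2) N mesh_cells_rim[OF DP]]
  note b3 = card_sheet[OF Q' _ ord(2) M(3) order_refl N mesh_cells_walls[OF N0]]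
  show "finite (bad_sites N j)"
    unfolding bad s1_def s2_def s3_def using b1(1) b2(1) b3(1) by auto
  have one: "real (card (s1 k \<union> s2 k \<union> s3 k)) \<le> 16 * (D * (2 * D + 3) + 2) ^ 3 * (N / P + P + y) * G"
    if k: "k \<noteq> k0" for k
  proof -
    have "card (s1 k \<union> s2 k \<union> s3 k) \<le> card (s1 k) + card (s2 k) + card (s3 k)"
      using card_Un_le[of "s1 k \<union> s2 k" "s3 k"] card_Un_le[of "s1 k" "s2 k"] by linarith
    from of_nat_mono[OF this, where 'a = real]
    have "real (card (s1 k \<union> s2 k \<union> s3 k)) \<le> real (card (s1 k)) + real (card (s2 k)) + real (card (s3 k))" by simp
    also have "\<dots> \<le> (D * (y + D + 1 - (- D - 1)) + 2) * (2 * (D * 2 + 2)) * G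
      + (D * ((y + D + 1) - (y - D - 1)) + 2) * (2 * (D * (2 * D * P) + 2)) * G
      + (D * ((y + D + 1) - (y - D - 1)) + 2) * ((2 * (D * N / P) + 3) * (2 * (D * (2 * D + 1) + 2))) * G"
      unfolding s1_def s2_def s3_def G_def using b1(2) b2(2) b3(2) k by (intro add_mono) auto
    also have "\<dots> = ((D * (y + D + 1 - (- D - 1)) + 2) * (2 * (D * 2 + 2))
      + (D * ((y + D + 1) - (y - D - 1)) + 2) * (2 * (D * (2 * D * P) + 2))
      + (D * ((y + D + 1) - (y - D - 1)) + 2) * ((2 * (D * N / P) + 3) * (2 * (D * (2 * D + 1) + 2)))) * G"
      by (simp only: distrib_right)
    also have "\<dots> \<le> 16 * (D * (2 * D + 3) + 2) ^ 3 * ((D * N / P) / D + P + y) * G"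
      using y P D N by (intro mult_right_mono bad_sites_arithmetic[OF refl]) (auto simp: G_def)
    finally show ?thesis using D by simp
  qed
  have "card (bad_sites N j) \<le> (\<Sum>k\<in>UNIV - {k0}. card (s1 k \<union> s2 k \<union> s3 k))"
    unfolding bad by (intro card_UN_le) auto
  from of_nat_mono[OF this, where 'a = real]
  have "real (card (bad_sites N j)) \<le> (\<Sum>k\<in>UNIV - {k0}. real (card (s1 k \<union> s2 k \<union> s3 k)))"
    unfolding of_nat_sum .
  also have "\<dots> \<le> (\<Sum>k\<in>UNIV - {k0}. 16 * (D * (2 * D + 3) + 2) ^ 3 * (N / P + P + y) * G)"
    using one by (intro sum_mono) auto
  also have "\<dots> = (D - 1) * (16 * (D * (2 * D + 3) + 2) ^ 3 * (N / P + P + y) * G)"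
    by (simp add: card_Diff_singleton D_def of_nat_diff)
  also have "\<dots> \<le> D * (16 * (D * (2 * D + 3) + 2) ^ 3 * (N / P + P + y) * G)"
    using D y P N by (intro mult_right_mono mult_nonneg_nonneg) (auto simp: G_def)
  also have "\<dots> = interface_const * N ^ (CARD('d) - 2) * (N / P + P + T * j)"
    by (simp add: interface_const_def G_def y_def power_mult_distrib algebra_simps)
  finally show "real (card (bad_sites N j)) \<le> interface_const * N ^ (CARD('d) - 2) * (N / P + P + T * j)" .
qed

definition coordination_number :: real where
  "coordination_number = real (card (unit_steps :: (int ^ 'd) set))"

text \<open>The cost of an interface in layer \<open>j\<close>. After division by the area \<open>N\<^sup>d\<^sup>-\<^sup>1\<close> the error is of order
  \<open>1/P + P/N + T j/N\<close>, where the last term is due to the lateral boundary below the layer.\<close>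
theorem slab_subadditive:
  assumes rc: "rc_params q \<beta>" and j: "j \<ge> 0" and N: "N \<ge> 1"
    and h2: "h > 2 * D + 2" and H: "T * j + h + D + 3 \<le> H"
  defines "\<Lambda> \<equiv> box_sites Q k0 0 N H"
  assumes J: "J \<in> edges \<Lambda> \<rightarrow> {0..1}"
  shows "cut_cost q \<beta> J 0 n \<Lambda> \<le> (\<Sum>i\<in>columns N j. cut_cost q \<beta> J (emb (centre i)) n (block i))
    + \<beta> * (coordination_number * interface_const) * N ^ (CARD('d) - 2) * (N / P + P + T * j)"
proof -
  interpret rc_params q \<beta> by (rule rc)
  have Tj: "0 \<le> T * j" using T j by simp
  define F where "F = {{u, v} | u v. {u, v} \<in> edges \<Lambda> \<and> side N j \<Lambda> u \<and> \<not> side N j \<Lambda> v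
    \<and> (\<forall>i\<in>columns N j. \<not> {u, v} \<subseteq> block i)}"
  have F: "\<exists>u v. e = {u, v} \<and> u \<in> bad_sites N j \<and> u \<sim> v" if "e \<in> F" for e
  proof -
    obtain u v where uv: "e = {u, v}" "{u, v} \<in> edges \<Lambda>" "side N j \<Lambda> u" "\<not> side N j \<Lambda> v"
      "\<And>i. i \<in> columns N j \<Longrightarrow> \<not> {u, v} \<subseteq> block i"
      using \<open>e \<in> F\<close> unfolding F_def by blast
    have "u \<in> bad_sites N j"
      using uv edgesD[OF uv(2)] unfolding \<Lambda>_def by (intro mismatch_bad[OF j N h2 H, of u v]) auto
    then show ?thesis using uv edgesD[OF uv(2)] by blast
  qed
  have "cut_cost q \<beta> J 0 n \<Lambda> \<le> (\<Sum>i\<in>columns N j. cut_cost q \<beta> J (emb (centre i)) n (block i)) + \<beta> * card F"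
    unfolding F_def
  proof (rule cut_cost_subadditive)
    show "finite \<Lambda>" unfolding \<Lambda>_def by (rule finite_box_sites[OF Q])
    show "block i \<subseteq> \<Lambda> - bdry \<Lambda>" if "i \<in> columns N j" for i
      unfolding \<Lambda>_def using H Tj by (intro block_inside[OF that]) linarith
    show "side N j \<Lambda> y \<longleftrightarrow> 0 \<le> (emb y - 0) \<bullet> n" if "y \<in> bdry \<Lambda>" for y
    proof -
      have "y \<notin> block i" if "i \<in> columns N j" for i
        using block_inside[OF that, of H] H Tj \<open>y \<in> bdry \<Lambda>\<close> unfolding \<Lambda>_def by force
      then show ?thesis using that by (auto simp: side_def)
    qed
    show "block i \<inter> block i' = {}" if "i \<noteq> i'" for i i' by (rule blocks_disjoint[OF that])
  qed (use J finite_columns side_block in simp_all)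
  also have "\<beta> * card F \<le> \<beta> * ((coordination_number * interface_const) * N ^ (CARD('d) - 2) * (N / P + P + T * j))"
  proof (intro mult_left_mono \<beta>)
    have "card F \<le> card (bad_sites N j) * card (unit_steps :: (int ^ 'd) set)"
      using card_bad_sites(1)[OF j N] F by (rule card_edges_le(2))
    from of_nat_mono[OF this, where 'a = real]
    have "real (card F) \<le> coordination_number * real (card (bad_sites N j))"
      by (simp add: coordination_number_def mult.commute)
    also have "\<dots> \<le> coordination_number * (interface_const * N ^ (CARD('d) - 2) * (N / P + P + T * j))"
      using card_bad_sites(2)[OF j N] by (intro mult_left_mono) (auto simp: coordination_number_def)
    finally show "real (card F) \<le> (coordination_number * interface_const) * N ^ (CARD('d) - 2) * (N / P + P + T * j)"
      by (simp add: mult.assoc)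
  qed
  finally show ?thesis by (simp add: algebra_simps)
qed

text \<open>Closing all edges that cross the hyperplane through the centre bounds the cost by the area. This is
  \<open>cut_cost_subadditive\<close> without blocks.\<close>
theorem cut_cost_bounded:
  assumes rc: "rc_params q \<beta>" and L1: "L \<ge> 1"
  defines "\<Lambda> \<equiv> box_sites Q' k0 0 L h"
  assumes J: "J \<in> edges \<Lambda> \<rightarrow> {0..1}"
  shows "cut_cost q \<beta> J 0 n \<Lambda> \<le> \<beta> * (coordination_number * (D + 2) * (4 * D\<^sup>2) ^ (CARD('d) - 1)) * L ^ (CARD('d) - 1)"
proof -
  interpret rc_params q \<beta> by (rule rc)
  obtain k where k: "k \<noteq> k0"
  proof -
    have "\<not> (UNIV :: 'd set) \<subseteq> {k0}" using dim card_mono[of "{k0}" "UNIV :: 'd set"] by auto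
    then show ?thesis using that by blast
  qed
  define F where "F = {{u, v} | u v. {u, v} \<in> edges \<Lambda> \<and> emb u \<bullet> n \<ge> 0 \<and> \<not> emb v \<bullet> n \<ge> 0
    \<and> (\<forall>i\<in>({} :: nat set). \<not> {u, v} \<subseteq> {})}"
  define A where "A = sheet (L / 2) Q' k {- (L / 2)..L / 2} 0 1"
  have F: "\<exists>u v. e = {u, v} \<and> u \<in> A \<and> u \<sim> v" if "e \<in> F" for e
  proof -
    obtain u v where uv: "e = {u, v}" "{u, v} \<in> edges \<Lambda>" "emb u \<bullet> n \<ge> 0" "\<not> emb v \<bullet> n \<ge> 0"
      using \<open>e \<in> F\<close> unfolding F_def by blast
    have "u \<in> \<Lambda>" "u \<sim> v" using edgesD[OF uv(2)] by auto
    have lat: "\<bar>Q' (emb u) $ l\<bar> \<le> L / 2" if "l \<noteq> k0" for l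
      using \<open>u \<in> \<Lambda>\<close> that by (simp add: \<Lambda>_def box_sites_def less_imp_le)
    moreover have "Q' (emb u) $ k \<in> {- (L / 2)..L / 2}"
      unfolding atLeastAtMost_iff using lat[OF k] by linarith
    moreover have "emb u \<bullet> n \<le> 1"
      using adj_frame_le[OF Q' \<open>u \<sim> v\<close>, of k0] uv unfolding frame_normal[OF Q'] by linarith
    ultimately have "u \<in> A" using uv by (simp add: A_def sheet_def)
    then show ?thesis using uv \<open>u \<sim> v\<close> by blast
  qed
  have LD: "L / 2 \<le> D * L" "0 \<le> L / 2" using L1 D mult_right_mono[of "1 / 2" D L] by simp_all
  have mesh_cells: "real (card (mesh_cells CARD('d) {- (L / 2)..L / 2})) \<le> 4 * D\<^sup>2 * L"
  proof -
    have "real (card (mesh_cells CARD('d) {- (L / 2)..L / 2})) \<le> D * L + 2"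
      using mesh_cells_interval(2)[of "- (L / 2)" "L / 2" "CARD('d)"] L1 by (simp add: D_def)
    moreover have "2 * 1 * 1 \<le> D * L * D" "D * L * 1 \<le> D * L * D"
      using D L1 by (intro mult_mono mult_nonneg_nonneg; simp)+
    moreover have "4 * D\<^sup>2 * L = 4 * (D * L * D)" by (simp add: power2_eq_square)
    ultimately show ?thesis by linarith
  qed
  have A: "finite A" "real (card A) \<le> (D + 2) * (4 * D\<^sup>2) ^ (CARD('d) - 1) * L ^ (CARD('d) - 1)"
  proof -
    note cs = card_sheet[OF Q' k zero_le_one LD(2,1) L1 mesh_cells_interval(1) mesh_cells]
    show "finite A" using cs(1) by (simp add: A_def)
    have "real (card A) \<le> (D + 2) * ((4 * D\<^sup>2 * L) * (4 * D\<^sup>2 * L) ^ (CARD('d) - 2))"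
      using cs(2) by (simp add: A_def mult.assoc)
    also have "(4 * D\<^sup>2 * L) * (4 * D\<^sup>2 * L) ^ (CARD('d) - 2) = (4 * D\<^sup>2 * L) ^ (CARD('d) - 1)"
    proof -
      have "CARD('d) - 1 = Suc (CARD('d) - 2)" using dim by simp
      then show ?thesis by (simp only: power_Suc)
    qed
    finally show "real (card A) \<le> (D + 2) * (4 * D\<^sup>2) ^ (CARD('d) - 1) * L ^ (CARD('d) - 1)"
      by (simp add: power_mult_distrib mult.assoc)
  qed
  have "cut_cost q \<beta> J 0 n \<Lambda> \<le> (\<Sum>i\<in>({} :: nat set). cut_cost q \<beta> J 0 n {}) + \<beta> * card F"
    unfolding F_def
  proof (rule cut_cost_subadditive[where B = "\<lambda>_. {}" and z = "\<lambda>_. 0"])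
    show "finite \<Lambda>" unfolding \<Lambda>_def by (rule finite_box_sites[OF Q'])
  qed (use J in auto)
  also have "\<dots> = \<beta> * card F" by simp
  also have "\<dots> \<le> \<beta> * ((coordination_number * (D + 2) * (4 * D\<^sup>2) ^ (CARD('d) - 1)) * L ^ (CARD('d) - 1))"
  proof (intro mult_left_mono \<beta>)
    have "card F \<le> card A * card (unit_steps :: (int ^ 'd) set)"
      using A(1) F by (rule card_edges_le(2))
    from of_nat_mono[OF this, where 'a = real]
    have "real (card F) \<le> coordination_number * real (card A)"
      by (simp add: coordination_number_def mult.commute)
    also have "\<dots> \<le> coordination_number * ((D + 2) * (4 * D\<^sup>2) ^ (CARD('d) - 1) * L ^ (CARD('d) - 1))"
      using A(2) by (intro mult_left_mono) (auto simp: coordination_number_def)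
    finally show "real (card F) \<le> (coordination_number * (D + 2) * (4 * D\<^sup>2) ^ (CARD('d) - 1)) * L ^ (CARD('d) - 1)"
      by (simp add: mult.assoc)
  qed
  finally show ?thesis by (simp add: mult.assoc)
qed

text \<open>A lower bound on the number of blocks in the first \<open>m\<close> layers, since the cube has \<open>m\<^sup>d\<close> points.\<close>
lemma cube_in_columns:
  assumes m: "D * P * real m \<le> N / 2 - D * P" and i: "\<And>k. i $ k \<in> {0..<int m}"
  shows "i \<in> columns N (i $ k0)"
proof -
  have "\<bar>Q (node i) $ k\<bar> \<le> N / 2 - D * P" if k: "k \<noteq> k0" for k
  proof -
    have "\<bar>Q' (node i) $ l\<bar> \<le> P * m" if "l \<noteq> k0" for l
    proof -
      have "\<bar>real_of_int (i $ l)\<bar> \<le> real m" using i[of l] by auto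
      then have "P * \<bar>real_of_int (i $ l)\<bar> \<le> P * m" using P by (intro mult_left_mono) auto
      then show ?thesis using that P by (simp add: node abs_mult)
    qed
    then have "\<bar>Q (node i) $ k\<bar> \<le> (D - 1) * (P * m)" using k by (intro lateral_change[OF Q' Q])
    also have "\<dots> \<le> D * (P * m)" using P by (intro mult_right_mono) auto
    finally show ?thesis using m by (simp add: mult.assoc)
  qed
  then show ?thesis by (simp add: columns_def)
qed

end

lemma card_cube: "card {i :: int ^ 'd::finite. \<forall>k. i $ k \<in> {0..<int m}} = m ^ CARD('d)"
proof -
  have "bij_betw vec_nth {i :: int ^ 'd. \<forall>k. i $ k \<in> {0..<int m}} (\<Pi>\<^sub>E k\<in>UNIV. {0..<int m})"
    by (rule bij_betwI[where g = vec_lambda]) auto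
  then have "card {i :: int ^ 'd. \<forall>k. i $ k \<in> {0..<int m}} = card (\<Pi>\<^sub>E k\<in>(UNIV :: 'd set). {0..<int m})"
    by (rule bij_betw_same_card)
  then show ?thesis by (simp add: card_PiE)
qed

section \<open>Translation invariance\<close>

lemma rtrancl_links_image:
  assumes "(x, y) \<in> (links G)\<^sup>*"
  shows "(f x, f y) \<in> (links ((`) f ` G))\<^sup>*"
  using assms
proof (induction rule: rtrancl_induct)
  case (step y z)
  have "{y, z} \<in> G" using step(2) by (simp add: links_def)
  then have "f ` {y, z} \<in> (`) f ` G" by (rule imageI)
  then have "(f y, f z) \<in> links ((`) f ` G)" by (simp add: links_def)
  then show ?case using step(3) by simp
qed simp

lemma rtrancl_links_image_iff:
  assumes "inj f"
  shows "(f x, f y) \<in> (links ((`) f ` G))\<^sup>* \<longleftrightarrow> (x, y) \<in> (links G)\<^sup>*"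
proof
  assume "(f x, f y) \<in> (links ((`) f ` G))\<^sup>*"
  from rtrancl_links_image[OF this, of "inv f"] show "(x, y) \<in> (links G)\<^sup>*"
    using assms by (simp add: image_image)
qed (rule rtrancl_links_image)

lemma inj_on_image_set: "inj f \<Longrightarrow> inj_on ((`) f) A"
  by (rule inj_onI) (simp add: inj_image_eq_iff)

lemma cluster_count_image:
  assumes "inj f"
  shows "cluster_count (f ` V) ((`) f ` G) = cluster_count V G"
proof -
  have "(\<lambda>a. {b \<in> f ` V. (a, b) \<in> (links ((`) f ` G))\<^sup>*}) ` f ` V
    = (`) f ` ((\<lambda>a. {b \<in> V. (a, b) \<in> (links G)\<^sup>*}) ` V)"
    unfolding image_image
  proof (rule image_cong[OF refl])
    fix a
    show "{b \<in> f ` V. (f a, b) \<in> (links ((`) f ` G))\<^sup>*} = f ` {b \<in> V. (a, b) \<in> (links G)\<^sup>*}"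
      using rtrancl_links_image_iff[OF assms] by auto
  qed
  then show ?thesis
    unfolding cluster_count_alt using card_image[OF inj_on_image_set[OF assms]] by metis
qed

text \<open>Blocks have the same law because the lattice is invariant under integer translations.\<close>
definition translate :: "int ^ 'd \<Rightarrow> int ^ 'd \<Rightarrow> int ^ 'd" where
  "translate c y = y + c"

lemma inj_translate: "inj (translate c)"
  by (simp add: translate_def inj_def)

lemma adj_translate: "translate c x \<sim> translate c y \<longleftrightarrow> x \<sim> y"
  by (simp add: translate_def adj_def emb_add)

lemma edges_translate: "edges (translate c ` \<Lambda>) = (`) (translate c) ` edges \<Lambda>"
proof (intro equalityI subsetI)
  fix e assume "e \<in> edges (translate c ` \<Lambda>)"
  then obtain x y where "e = {translate c x, translate c y}" "x \<in> \<Lambda>" "y \<in> \<Lambda>" "x \<sim> y"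
    by (auto simp: edges_def adj_translate)
  then have "e = translate c ` {x, y}" "{x, y} \<in> edges \<Lambda>" by (auto intro: edgesI)
  then show "e \<in> (`) (translate c) ` edges \<Lambda>" by blast
next
  fix e assume "e \<in> (`) (translate c) ` edges \<Lambda>"
  then obtain x y where "e = {translate c x, translate c y}" "x \<in> \<Lambda>" "y \<in> \<Lambda>" "x \<sim> y"
    by (auto simp: edges_def)
  then show "e \<in> edges (translate c ` \<Lambda>)" by (auto intro!: edgesI simp: adj_translate)
qed

lemma translate_UNIV: "translate c ` UNIV = UNIV"
  by (rule surjI[where f = "translate (- c)"]) (simp add: translate_def)

lemma edges_translate_UNIV: "(`) (translate c) ` edges UNIV = edges UNIV"
  using edges_translate[of c UNIV] by (simp add: translate_UNIV)

lemma wired_prob_translate: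
  assumes "E \<subseteq> edges UNIV"
  shows "wired_prob q \<beta> J ((`) (translate c) ` E) P
    = wired_prob q \<beta> (\<lambda>e. J (translate c ` e)) E (\<lambda>X. P ((`) (translate c) ` X))"
proof -
  let ?f = "(`) (translate c)"
  have injf: "inj_on ?f A" for A by (rule inj_on_image_set[OF inj_translate])
  have injff: "inj_on ((`) ?f) A" for A by (rule inj_on_image_set[OF injf])
  have weight: "wired_weight q \<beta> J (?f ` E) (?f ` X) = wired_weight q \<beta> (\<lambda>e. J (translate c ` e)) E X" for X
  proof -
    have "(\<Prod>e\<in>?f ` E. if e \<in> ?f ` X then edge_prob \<beta> J e else 1 - edge_prob \<beta> J e)
      = (\<Prod>e\<in>E. if e \<in> X then edge_prob \<beta> (\<lambda>e. J (translate c ` e)) e else 1 - edge_prob \<beta> (\<lambda>e. J (translate c ` e)) e)"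
      unfolding prod.reindex[OF injf] comp_def inj_image_mem_iff[OF injf] by (intro prod.cong refl) (simp add: edge_prob_def)
    moreover have "?f ` X \<union> (edges UNIV - ?f ` E) = ?f ` (X \<union> (edges UNIV - E))"
      using image_set_diff[OF injf, of "edges UNIV" E] by (simp add: image_Un edges_translate_UNIV)
    moreover have "\<Union>(?f ` E) = translate c ` \<Union>E" by blast
    ultimately show ?thesis by (simp add: wired_weight_def cluster_count_image[OF inj_translate])
  qed
  have Pow: "Pow (?f ` E) = (`) ?f ` Pow E" by (rule image_Pow_surj[OF refl, symmetric])
  show ?thesis
    unfolding wired_prob_def Pow sum.reindex[OF injff] comp_def weight ..
qed

lemma bdry_translate: "bdry (translate c ` \<Lambda>) = translate c ` bdry \<Lambda>"
proof (intro equalityI subsetI)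
  fix y assume "y \<in> bdry (translate c ` \<Lambda>)"
  then obtain x z where x: "x \<in> \<Lambda>" "y = translate c x" "z \<notin> translate c ` \<Lambda>" "z \<sim> y" by (auto simp: bdry_def)
  have z: "z = translate c (z - c)" by (simp add: translate_def)
  have "z - c \<notin> \<Lambda>" using x(3) z by blast
  moreover have "z - c \<sim> x" using x(2,4) z adj_translate by metis
  ultimately show "y \<in> translate c ` bdry \<Lambda>" using x by (auto simp: bdry_def)
next
  fix y assume "y \<in> translate c ` bdry \<Lambda>"
  then obtain x z where x: "x \<in> \<Lambda>" "y = translate c x" "z \<notin> \<Lambda>" "z \<sim> x" by (auto simp: bdry_def)
  then have "translate c z \<notin> translate c ` \<Lambda>" by (simp add: inj_image_mem_iff[OF inj_translate])
  then show "y \<in> bdry (translate c ` \<Lambda>)"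
    using x(1,2,4) adj_translate[of c z x] unfolding bdry_def by blast
qed

lemma cut_translate: "cut (emb c) n (translate c ` \<Lambda>) ((`) (translate c) ` X) \<longleftrightarrow> cut 0 n \<Lambda> X"
proof -
  have "bdry_plus (emb c) n (translate c ` \<Lambda>) = translate c ` bdry_plus 0 n \<Lambda>"
    "bdry_minus (emb c) n (translate c ` \<Lambda>) = translate c ` bdry_minus 0 n \<Lambda>"
    unfolding bdry_plus_def bdry_minus_def bdry_translate by (auto simp: translate_def emb_add)
  then show ?thesis by (simp add: cut_def rtrancl_links_image_iff[OF inj_translate])
qed

lemma cut_cost_translate:
  "cut_cost q \<beta> J (emb c) n (translate c ` \<Lambda>) = cut_cost q \<beta> (\<lambda>e. J (translate c ` e)) 0 n \<Lambda>"
  unfolding cut_cost_def edges_translate wired_prob_translate[OF edges_subset_UNIV] cut_translate ..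

lemma box_sites_translate: "box_sites Q k0 (emb c) L H = translate c ` box_sites Q k0 0 L H"
proof (intro equalityI subsetI)
  fix y assume "y \<in> box_sites Q k0 (emb c) L H"
  then have "y - c \<in> box_sites Q k0 0 L H" by (simp add: box_sites_def emb_diff)
  moreover have "y = translate c (y - c)" by (simp add: translate_def)
  ultimately show "y \<in> translate c ` box_sites Q k0 0 L H" by blast
qed (auto simp: box_sites_def translate_def emb_add)

lemma wired_prob_cong: "(\<And>e. e \<in> E \<Longrightarrow> J e = J' e) \<Longrightarrow> wired_prob q \<beta> J E P = wired_prob q \<beta> J' E P"
proof -
  assume J: "\<And>e. e \<in> E \<Longrightarrow> J e = J' e"
  have eq: "wired_weight q \<beta> J E = wired_weight q \<beta> J' E"
    unfolding wired_weight_def using J by (intro ext arg_cong2[where f = "(*)"] prod.cong) (auto simp: edge_prob_def)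
  show ?thesis unfolding wired_prob_def eq ..
qed

lemma cut_cost_cong: "(\<And>e. e \<in> edges \<Lambda> \<Longrightarrow> J e = J' e) \<Longrightarrow> cut_cost q \<beta> J x n \<Lambda> = cut_cost q \<beta> J' x n \<Lambda>"
  unfolding cut_cost_def by (subst wired_prob_cong) auto

section \<open>Random couplings\<close>

text \<open>No assumption mentions the lattice, so the parameter \<open>dimension\<close> ties its type to the locale.\<close>
locale rc_random = rc_params q \<beta> for q \<beta> :: real +
  fixes \<rho> :: "real measure" and dimension :: "'d::finite itself"
  assumes prob_\<rho>: "prob_space \<rho>" and sets_\<rho>: "sets \<rho> = sets (restrict_space borel {0..1})"
begin

abbreviation couplings :: "('d edge \<Rightarrow> real) measure" where
  "couplings \<equiv> coupling_measure \<rho>"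

sublocale prob_space couplings
  unfolding coupling_measure_def using prob_\<rho> by (intro prob_space_PiM)

lemma space_\<rho>: "space \<rho> = {0..1}"
  using sets_eq_imp_space_eq[OF sets_\<rho>] by (simp add: space_restrict_space)

lemma coupling_range: "J \<in> space couplings \<Longrightarrow> J \<in> edges \<Lambda> \<rightarrow> {0..1}"
  using edges_subset_UNIV[of \<Lambda>] by (auto simp: coupling_measure_def space_PiM space_\<rho> PiE_iff)

lemma measurable_coupling:
  assumes "e \<in> I" shows "(\<lambda>J. J e) \<in> borel_measurable (PiM I (\<lambda>_. \<rho>))"
proof -
  have "(\<lambda>x. x) \<in> borel_measurable \<rho>"
    unfolding measurable_cong_sets[OF sets_\<rho> refl] by (rule measurable_restrict_space1) simp
  from measurable_compose[OF measurable_component_singleton[OF assms] this] show ?thesis .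
qed

lemma measurable_cut_cost_PiM:
  assumes "finite \<Lambda>" and sub: "edges \<Lambda> \<subseteq> I"
  shows "(\<lambda>J. cut_cost q \<beta> J x n \<Lambda>) \<in> borel_measurable (PiM I (\<lambda>_. \<rho>))"
proof -
  have e: "(\<lambda>J. edge_prob \<beta> J e) \<in> borel_measurable (PiM I (\<lambda>_. \<rho>))" if "e \<in> edges \<Lambda>" for e
    unfolding edge_prob_def using that sub
    by (intro borel_measurable_diff borel_measurable_const borel_measurable_exp[THEN measurable_compose_rev]
        borel_measurable_times measurable_coupling) auto
  have w: "(\<lambda>J. wired_weight q \<beta> J (edges \<Lambda>) X) \<in> borel_measurable (PiM I (\<lambda>_. \<rho>))" for X
    unfolding wired_weight_def
  proof (intro borel_measurable_times borel_measurable_prod borel_measurable_const)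
    fix e' assume "e' \<in> edges \<Lambda>"
    then show "(\<lambda>J. if e' \<in> X then edge_prob \<beta> J e' else 1 - edge_prob \<beta> J e')
        \<in> borel_measurable (PiM I (\<lambda>_. \<rho>))"
      using e[of e'] by (cases "e' \<in> X") simp_all
  qed
  have wP: "(\<lambda>J. if cut x n \<Lambda> X then wired_weight q \<beta> J (edges \<Lambda>) X else 0) \<in> borel_measurable (PiM I (\<lambda>_. \<rho>))" for X
    using w[of X] by (cases "cut x n \<Lambda> X") simp_all
  show ?thesis
    unfolding cut_cost_def wired_prob_def
    by (intro borel_measurable_uminus borel_measurable_ln borel_measurable_divide borel_measurable_sum)
      (auto intro: w wP)
qed

lemma measurable_cut_cost:
  "finite \<Lambda> \<Longrightarrow> (\<lambda>J. cut_cost q \<beta> J x n \<Lambda>) \<in> borel_measurable couplings"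
  unfolding coupling_measure_def by (rule measurable_cut_cost_PiM[OF _ edges_subset_UNIV])

lemma distr_cut_cost_translate:
  assumes fin: "finite \<Lambda>"
  shows "distr couplings borel (\<lambda>J. cut_cost q \<beta> J (emb c) n (translate c ` \<Lambda>))
    = distr couplings borel (\<lambda>J. cut_cost q \<beta> J 0 n \<Lambda>)"
proof -
  define tr where "tr J = (\<lambda>e\<in>edges UNIV. J (translate c ` e))" for J :: "'d edge \<Rightarrow> real"
  have inj: "inj_on ((`) (translate c)) (edges UNIV)"
    by (rule inj_on_image_set[OF inj_translate])
  have maps: "(`) (translate c) \<in> edges UNIV \<rightarrow> edges UNIV"
    using edges_translate_UNIV by blast
  have "distr couplings couplings tr = couplings"
    unfolding coupling_measure_def tr_def
    using distr_PiM_reindex[where K = "edges UNIV" and M = "\<lambda>_. \<rho>", OF prob_\<rho> inj maps] by simp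
  moreover have tr: "tr \<in> measurable couplings couplings"
    unfolding coupling_measure_def tr_def using maps
    by (intro measurable_restrict measurable_component_singleton) auto
  ultimately have "distr couplings borel (\<lambda>J. cut_cost q \<beta> J 0 n \<Lambda>)
      = distr couplings borel (\<lambda>J. cut_cost q \<beta> (tr J) 0 n \<Lambda>)"
    using distr_distr[OF measurable_cut_cost[OF fin] tr, of 0 n] by (simp add: comp_def)
  moreover have "cut_cost q \<beta> (tr J) 0 n \<Lambda> = cut_cost q \<beta> J (emb c) n (translate c ` \<Lambda>)" for J
    unfolding cut_cost_translate by (rule cut_cost_cong) (use edges_subset_UNIV in \<open>auto simp: tr_def\<close>)
  ultimately show ?thesis by simp
qed

text \<open>The cost of a box is a function of the couplings of its edges only.\<close>
lemma indep_cut_costs: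
  assumes fin: "\<And>i. i \<in> K \<Longrightarrow> finite (B i)"
    and disj: "\<And>i j. i \<in> K \<Longrightarrow> j \<in> K \<Longrightarrow> i \<noteq> j \<Longrightarrow> B i \<inter> B j = {}"
  shows "indep_vars (\<lambda>_. borel) (\<lambda>i J. cut_cost q \<beta> J (x i) n (B i)) K"
proof -
  have "indep_vars (\<lambda>_. \<rho>) (\<lambda>e J. J e) (edges UNIV)"
  proof (cases "edges UNIV = ({} :: 'd edge set)")
    case True
    then show ?thesis by (simp add: indep_vars_def indep_sets_def)
  next
    case False
    have rv: "random_variable \<rho> (\<lambda>J. J e)" if "e \<in> edges UNIV" for e
      unfolding coupling_measure_def using that by (rule measurable_component_singleton)
    have "distr couplings (PiM (edges UNIV) (\<lambda>_. \<rho>)) (\<lambda>J. \<lambda>e\<in>edges UNIV. J e)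
      = distr couplings couplings (\<lambda>J. J)"
      by (rule distr_cong) (auto simp: coupling_measure_def space_PiM)
    also have "\<dots> = PiM (edges UNIV) (\<lambda>_. \<rho>)" by (simp add: distr_id coupling_measure_def)
    also have "\<dots> = PiM (edges UNIV) (\<lambda>e. distr couplings \<rho> (\<lambda>J. J e))"
      using distr_PiM_component[where I = "edges (UNIV :: 'd site set)" and M = "\<lambda>_. \<rho>", OF prob_\<rho>]
      by (intro PiM_cong) (simp_all add: coupling_measure_def)
    finally show ?thesis using indep_vars_iff_distr_eq_PiM'[OF False rv] by simp
  qed
  moreover have "disjoint_family_on (\<lambda>i. edges (B i)) K"
    unfolding disjoint_family_on_def
  proof (intro ballI impI, rule ccontr)
    fix i j assume ij: "i \<in> K" "j \<in> K" "i \<noteq> j" and "edges (B i) \<inter> edges (B j) \<noteq> {}"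
    then obtain a b where "{a, b} \<in> edges (B i)" "{a, b} \<in> edges (B j)"
      using edges_UNIV_D edges_subset_UNIV by blast
    then have "a \<in> B i \<inter> B j" using edgesD by blast
    then show False using disj[OF ij] by blast
  qed
  ultimately have "indep_vars (\<lambda>i. PiM (edges (B i)) (\<lambda>_. \<rho>)) (\<lambda>i J. restrict (\<lambda>e. J e) (edges (B i))) K"
    using edges_subset_UNIV by (intro indep_vars_restrict)
  then have "indep_vars (\<lambda>_. borel) (\<lambda>i J. cut_cost q \<beta> (restrict (\<lambda>e. J e) (edges (B i))) (x i) n (B i)) K"
    by (rule indep_vars_compose2) (use fin in \<open>auto intro: measurable_cut_cost_PiM\<close>)
  moreover have "cut_cost q \<beta> (restrict (\<lambda>e. J e) (edges (B i))) (x i) n (B i) = cut_cost q \<beta> J (x i) n (B i)" for J i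
    by (rule cut_cost_cong) simp
  ultimately show ?thesis by simp
qed

text \<open>One constant that serves both as the factor of the error in \<open>slab_subadditive\<close> and as an upper
  bound for the surface tension by \<open>cut_cost_bounded\<close>, which account for the two summands; adding 1 makes
  it positive if \<open>\<beta> = 0\<close>.\<close>
definition tau_bound :: real where
  "tau_bound = \<beta> * (real (card (unit_steps :: (int ^ 'd) set))
      * (16 * real CARD('d) * (real CARD('d) * (2 * real CARD('d) + 3) + 2) ^ 3 * (4 * (real CARD('d))\<^sup>2) ^ (CARD('d) - 2)))
    + \<beta> * (real (card (unit_steps :: (int ^ 'd) set))
      * (real CARD('d) + 2) * (4 * (real CARD('d))\<^sup>2) ^ (CARD('d) - 1)) + 1"

lemma tau_bound_pos: "tau_bound > 0"
  unfolding tau_bound_def using \<beta> by (intro add_nonneg_pos add_nonneg_nonneg mult_nonneg_nonneg) auto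

text \<open>The surface tension \<open>\<tau>\<^sup>J\<close> of a box centred at the origin, with the cube \<open>\<S>\<close> given by a frame.\<close>
definition tau :: "real ^ 'd \<Rightarrow> 'd \<Rightarrow> (real ^ 'd \<Rightarrow> real ^ 'd) \<Rightarrow> real \<Rightarrow> real \<Rightarrow> ('d edge \<Rightarrow> real) \<Rightarrow> real" where
  "tau n k0 Q N H J = cut_cost q \<beta> J 0 n (box_sites Q k0 0 N H) / N ^ (CARD('d) - 1)"

lemma measurable_tau:
  "frame n k0 Q \<Longrightarrow> tau n k0 Q N H \<in> borel_measurable couplings"
  unfolding tau_def using measurable_cut_cost[OF finite_box_sites] by simp

lemma tau_bounds:
  assumes dim: "CARD('d) \<ge> 2" and Q: "frame n k0 Q" and N: "N \<ge> 1" and H: "H > 0"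
    and J: "J \<in> space couplings"
  shows "0 \<le> tau n k0 Q N H J" "tau n k0 Q N H J \<le> tau_bound"
proof -
  interpret block_grid n k0 Q Q N H using assms by unfold_locales auto
  have rc: "rc_params q \<beta>" by unfold_locales
  have "0 \<le> cut_cost q \<beta> J 0 n (box_sites Q k0 0 N H)"
    by (rule cut_cost_nonneg[OF finite_box_sites[OF Q] coupling_range[OF J]])
  then show "0 \<le> tau n k0 Q N H J" using N by (simp add: tau_def)
  have "cut_cost q \<beta> J 0 n (box_sites Q k0 0 N H)
      \<le> \<beta> * (coordination_number * (D + 2) * (4 * D\<^sup>2) ^ (CARD('d) - 1)) * N ^ (CARD('d) - 1)"
    by (rule cut_cost_bounded[OF rc N coupling_range[OF J]])
  also have "\<dots> \<le> tau_bound * N ^ (CARD('d) - 1)"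
  proof (rule mult_right_mono)
    show "\<beta> * (coordination_number * (D + 2) * (4 * D\<^sup>2) ^ (CARD('d) - 1)) \<le> tau_bound"
      unfolding tau_bound_def coordination_number_def D_def using \<beta> by simp
  qed (use N in simp)
  finally show "tau n k0 Q N H J \<le> tau_bound"
    using N by (simp add: tau_def divide_le_eq)
qed

lemma integrable_tau:
  assumes dim: "CARD('d) \<ge> 2" and Q: "frame n k0 Q" and N: "N \<ge> 1" and H: "H > 0"
  shows "integrable couplings (tau n k0 Q N H)"
  using tau_bounds[OF assms] measurable_tau[OF Q]
  by (intro integrable_const_bound[where B = tau_bound] AE_I2) auto

end

section \<open>Comparison of two scales\<close>

text \<open>The lower bound on \<open>h\<close> leaves room for the rounding of the centres: near the height of the layer,
  blocks are only left through their lateral sides.\<close>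
locale rc_grid = rc_random q \<beta> \<rho> dimension + block_grid n k0 Q Q' L h
  for q \<beta> \<rho> and dimension :: "'d::finite itself" and n :: "real ^ 'd" and k0 Q Q' L h +
  assumes L1: "L \<ge> 1" and h_large: "h > 2 * D + 2"
begin

definition block_tau :: "int ^ 'd \<Rightarrow> ('d edge \<Rightarrow> real) \<Rightarrow> real" where
  "block_tau i J = cut_cost q \<beta> J (emb (centre i)) n (block i) / L ^ (CARD('d) - 1)"

lemma block_eq: "block i = translate (centre i) ` box_sites Q' k0 0 L h"
  unfolding block_def by (rule box_sites_translate)

lemma finite_block: "finite (block i)"
  unfolding block_def by (rule finite_box_sites[OF Q'])

lemma measurable_block_tau: "block_tau i \<in> borel_measurable couplings"
  unfolding block_tau_def using measurable_cut_cost[OF finite_block] by simp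

lemma distr_block_tau: "distr couplings borel (block_tau i) = distr couplings borel (tau n k0 Q' L h)"
proof -
  let ?c = "L ^ (CARD('d) - 1)"
  note m = measurable_cut_cost[OF finite_block[of i], of "emb (centre i)" n]
    measurable_cut_cost[OF finite_box_sites[OF Q', of 0 L h], of 0 n]
  have "distr couplings borel (block_tau i)
    = distr (distr couplings borel (\<lambda>J. cut_cost q \<beta> J (emb (centre i)) n (block i))) borel (\<lambda>x. x / ?c)"
    using m by (subst distr_distr) (auto simp: comp_def block_tau_def[abs_def])
  also have "\<dots> = distr (distr couplings borel (\<lambda>J. cut_cost q \<beta> J 0 n (box_sites Q' k0 0 L h))) borel (\<lambda>x. x / ?c)"
    unfolding block_eq distr_cut_cost_translate[OF finite_box_sites[OF Q']] ..
  also have "\<dots> = distr couplings borel (tau n k0 Q' L h)"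
    using m by (subst distr_distr) (auto simp: comp_def tau_def[abs_def])
  finally show ?thesis .
qed

lemma block_tau_iid:
  assumes "finite K" shows "iid_interval_bounded_random_variables couplings K block_tau (tau n k0 Q' L h) 0 tau_bound"
proof
  show "finite K" by fact
  have "indep_vars (\<lambda>_. borel) (\<lambda>i J. cut_cost q \<beta> J (emb (centre i)) n (block i)) K"
    using finite_block blocks_disjoint by (intro indep_cut_costs) auto
  then show "indep_vars (\<lambda>_. borel) block_tau K"
    unfolding block_tau_def[abs_def] by (rule indep_vars_compose2) simp
  show "distr couplings borel (block_tau i) = distr couplings borel (tau n k0 Q' L h)" for i by (rule distr_block_tau)
  show "random_variable borel (tau n k0 Q' L h)" by (rule measurable_tau[OF Q'])
  show "AE J in couplings. tau n k0 Q' L h J \<in> {0..tau_bound}"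
    using tau_bounds[OF dim Q' L1 h] by (intro AE_I2) simp
qed

lemma integrable_block_tau: "integrable couplings (block_tau i)" and expectation_block_tau: "expectation (block_tau i) = expectation (tau n k0 Q' L h)"
proof -
  interpret iid: iid_interval_bounded_random_variables couplings "{i}" block_tau "tau n k0 Q' L h" 0 tau_bound
    by (rule block_tau_iid) simp
  interpret b: interval_bounded_random_variable couplings "block_tau i" 0 tau_bound
    by (rule iid.X.bounded_random_variable) simp
  show "integrable couplings (block_tau i)" by (rule b.integrable)
  show "expectation (block_tau i) = expectation (tau n k0 Q' L h)" by (rule iid.expectation_X) simp
qed

lemma tau_slab:
  assumes J: "J \<in> space couplings" and j: "j \<ge> 0" and N: "N \<ge> 1" and H: "T * j + h + D + 3 \<le> H"
  shows "tau n k0 Q N H J \<le> (L / N) ^ (CARD('d) - 1) * (\<Sum>i\<in>columns N j. block_tau i J) + tau_bound * (1 / P + (P + T * j) / N)"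
proof -
  have rc: "rc_params q \<beta>" by unfold_locales
  have pow: "N ^ (CARD('d) - 1) = N * N ^ (CARD('d) - 2)"
  proof -
    have "CARD('d) - 1 = Suc (CARD('d) - 2)" using dim by simp
    then show ?thesis by (simp only: power_Suc)
  qed
  have Tj: "0 \<le> T * j" using T j by simp
  have "cut_cost q \<beta> J 0 n (box_sites Q k0 0 N H)
      \<le> (\<Sum>i\<in>columns N j. cut_cost q \<beta> J (emb (centre i)) n (block i))
        + \<beta> * (coordination_number * interface_const) * N ^ (CARD('d) - 2) * (N / P + P + T * j)"
    by (rule slab_subadditive[OF rc j N h_large H coupling_range[OF J]])
  also have "\<beta> * (coordination_number * interface_const) * N ^ (CARD('d) - 2) * (N / P + P + T * j)
      \<le> tau_bound * N ^ (CARD('d) - 2) * (N / P + P + T * j)"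
  proof (intro mult_right_mono)
    show "\<beta> * (coordination_number * interface_const) \<le> tau_bound"
      unfolding tau_bound_def coordination_number_def interface_const_def D_def using \<beta> by simp
  qed (use N P Tj in auto)
  finally have *: "cut_cost q \<beta> J 0 n (box_sites Q k0 0 N H)
      \<le> (\<Sum>i\<in>columns N j. cut_cost q \<beta> J (emb (centre i)) n (block i)) + tau_bound * N ^ (CARD('d) - 2) * (N / P + P + T * j)"
    by simp
  have sum: "(\<Sum>i\<in>columns N j. cut_cost q \<beta> J (emb (centre i)) n (block i)) = L ^ (CARD('d) - 1) * (\<Sum>i\<in>columns N j. block_tau i J)"
    using L by (simp add: block_tau_def flip: sum_divide_distrib)
  have "tau n k0 Q N H J \<le> (L ^ (CARD('d) - 1) * (\<Sum>i\<in>columns N j. block_tau i J)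
      + tau_bound * N ^ (CARD('d) - 2) * (N / P + P + T * j)) / N ^ (CARD('d) - 1)"
    unfolding tau_def using * N unfolding sum by (intro divide_right_mono) auto
  also have "\<dots> = (L / N) ^ (CARD('d) - 1) * (\<Sum>i\<in>columns N j. block_tau i J) + tau_bound * ((N / P + P + T * j) / N)"
  proof -
    have "tau_bound * N ^ (CARD('d) - 2) * (N / P + P + T * j) / N ^ (CARD('d) - 1) = tau_bound * ((N / P + P + T * j) / N)"
      unfolding pow using N by simp
    then show ?thesis unfolding add_divide_distrib[of "L ^ _ * _"] by (simp add: power_divide)
  qed
  also have "(N / P + P + T * j) / N = 1 / P + (P + T * j) / N"
    using N P by (simp add: field_simps)
  finally show ?thesis .
qed

lemma columns_share:
  assumes "N > 0" shows "real (card (columns N j)) * (L / N) ^ (CARD('d) - 1) \<le> 1"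
proof -
  have "real (card (columns N j)) * L ^ (CARD('d) - 1) \<le> real (card (columns N j)) * P ^ (CARD('d) - 1)"
    using P L by (intro mult_left_mono power_mono) auto
  also have "\<dots> \<le> N ^ (CARD('d) - 1)" by (rule columns_volume[OF assms])
  finally show ?thesis using assms by (simp add: power_divide divide_le_eq)
qed

text \<open>The expectation of the estimate for the layer at height 0, where the number of blocks is at most
  \<open>(N/L)\<^sup>d\<^sup>-\<^sup>1\<close> by \<open>columns_share\<close>.\<close>
theorem mean_tau_le:
  assumes N: "N \<ge> 1" and H: "h + D + 3 \<le> H"
  shows "expectation (tau n k0 Q N H) \<le> expectation (tau n k0 Q' L h) + tau_bound * (1 / P + P / N)"
proof -
  let ?r = "(L / N) ^ (CARD('d) - 1)" and ?a = "expectation (tau n k0 Q' L h)"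
  have H0: "H > 0" using H h D by simp
  have a0: "0 \<le> ?a" using tau_bounds(1)[OF dim Q' L1 h] by (intro integral_nonneg_AE AE_I2)
  have "expectation (tau n k0 Q N H) \<le> expectation (\<lambda>J. ?r * (\<Sum>i\<in>columns N 0. block_tau i J) + tau_bound * (1 / P + P / N))"
  proof (rule integral_mono)
    show "integrable couplings (tau n k0 Q N H)" by (rule integrable_tau[OF dim Q N H0])
    show "integrable couplings (\<lambda>J. ?r * (\<Sum>i\<in>columns N 0. block_tau i J) + tau_bound * (1 / P + P / N))"
      using integrable_block_tau by auto
    show "tau n k0 Q N H J \<le> ?r * (\<Sum>i\<in>columns N 0. block_tau i J) + tau_bound * (1 / P + P / N)"
      if "J \<in> space couplings" for J
      using tau_slab[OF that _ N, of 0 H] H by simp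
  qed
  also have "\<dots> = (real (card (columns N 0)) * ?r) * ?a + tau_bound * (1 / P + P / N)"
    using integrable_block_tau by (simp add: expectation_block_tau prob_space)
  also have "\<dots> \<le> 1 * ?a + tau_bound * (1 / P + P / N)"
    using columns_share[of N 0] N a0 by (intro add_right_mono mult_right_mono) auto
  finally show ?thesis by simp
qed

text \<open>If the interface of the big box is expensive, then so is the interface in each of the \<open>m \<ge> c\<^sub>1 N\<close>
  lowest layers. The average over all blocks \<open>K\<close> of these layers then exceeds the mean by \<open>\<eta> / 2\<close>, and
  Hoeffding's inequality applies to the \<open>card K \<ge> (c\<^sub>1 N)\<^sup>d\<close> independent blocks.\<close>
theorem upper_deviation:
  assumes b: "expectation (tau n k0 Q' L h) + tau_bound / P < b" and \<delta>: "\<delta> > 0"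
  shows "\<exists>c>0. \<forall>\<^sub>F N in sequentially.
    prob {J \<in> space couplings. b \<le> tau n k0 Q (real N) (\<delta> * real N) J} \<le> exp (- c * real N ^ CARD('d))"
proof -
  define a where "a = expectation (tau n k0 Q' L h)"
  define \<eta> where "\<eta> = b - a - tau_bound / P"
  \<comment> \<open>Layers up to height \<open>\<kappa> N\<close> fit into the box, and their
    height contributes at most \<open>\<eta> / 4\<close> to the error.\<close>
  define \<kappa> where "\<kappa> = min (\<delta> / 2) (\<eta> / (4 * tau_bound))"
  \<comment> \<open>For large \<open>N\<close> there are at least \<open>c1 * N\<close> layers
    below height \<open>\<kappa> N\<close>, and in each direction at least as many cells inside
    the box.\<close>
  define c1 where "c1 = min (\<kappa> / T) (1 / (2 * D * P)) / 2"
  define c where "c = 2 * c1 ^ CARD('d) * (\<eta> / 2)\<^sup>2 / tau_bound\<^sup>2"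
  have a0: "0 \<le> a" unfolding a_def using tau_bounds(1)[OF dim Q' L1 h] by (intro integral_nonneg_AE AE_I2)
  have DP: "D * P > 0" using D P by simp
  have \<eta>: "\<eta> > 0" using b by (simp add: \<eta>_def a_def)
  have \<kappa>: "\<kappa> > 0" "\<kappa> \<le> \<delta> / 2" "tau_bound * \<kappa> \<le> \<eta> / 4"
    using \<delta> \<eta> tau_bound_pos by (auto simp: \<kappa>_def min_def field_simps)
  have c1: "c1 > 0" "2 * c1 * T \<le> \<kappa>" "4 * c1 * (D * P) \<le> 1"
    using \<kappa> T DP D P by (auto simp: c1_def min_def field_simps)
  have c: "c > 0" using c1 \<eta> tau_bound_pos by (simp add: c_def)
  have "\<forall>\<^sub>F N in sequentially. real N \<ge> 1 \<and> c1 * N \<ge> 1 \<and> real N \<ge> 8 * (D * P)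
      \<and> tau_bound * P / N \<le> \<eta> / 4 \<and> \<delta> / 2 * N \<ge> h + D + 3"
  proof (intro eventually_conj)
    show "\<forall>\<^sub>F N in sequentially. tau_bound * P / real N \<le> \<eta> / 4"
      using eventually_ge_at_top[of "nat \<lceil>4 * tau_bound * P / \<eta>\<rceil> + 1"]
    proof eventually_elim
      case (elim N)
      then have "4 * tau_bound * P / \<eta> \<le> real N" "real N > 0" by linarith+
      then show ?case using \<eta> by (simp add: field_simps)
    qed
    show "\<forall>\<^sub>F N in sequentially. c1 * real N \<ge> 1"
      using eventually_ge_at_top[of "nat \<lceil>1 / c1\<rceil>"]
    proof eventually_elim
      case (elim N)
      then have "1 / c1 \<le> real N" by linarith
      then show ?case using c1 by (simp add: field_simps)
    qed
    show "\<forall>\<^sub>F N in sequentially. \<delta> / 2 * real N \<ge> h + D + 3"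
      using eventually_ge_at_top[of "nat \<lceil>(h + D + 3) / (\<delta> / 2)\<rceil>"]
    proof eventually_elim
      case (elim N)
      then have "(h + D + 3) / (\<delta> / 2) \<le> real N" by linarith
      then show ?case using \<delta> by (simp add: field_simps)
    qed
  qed (use eventually_ge_at_top[of 1] eventually_ge_at_top[of "nat \<lceil>8 * (D * P)\<rceil>"] in
      \<open>auto elim: eventually_mono\<close>)
  then have "\<forall>\<^sub>F N in sequentially.
    prob {J \<in> space couplings. b \<le> tau n k0 Q (real N) (\<delta> * real N) J} \<le> exp (- c * real N ^ CARD('d))"
  proof eventually_elim
    case (elim N)
    then have N: "real N \<ge> 1" "c1 * N \<ge> 1" "real N \<ge> 8 * (D * P)" "tau_bound * P / N \<le> \<eta> / 4"
      "\<delta> / 2 * N \<ge> h + D + 3" by auto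
    define m where "m = nat \<lceil>c1 * N\<rceil>"
    have m: "c1 * N \<le> real m" "real m \<le> c1 * N + 1" using N(2) by (auto simp: m_def)
    have Tm: "T * m \<le> \<kappa> * N"
    proof -
      have "T * real m \<le> T * (2 * c1 * N)" using m(2) N(2) T by (intro mult_left_mono) auto
      also have "\<dots> = 2 * c1 * T * N" by simp
      also have "\<dots> \<le> \<kappa> * N" using c1(2) by (intro mult_right_mono) auto
      finally show ?thesis .
    qed
    have DPm: "D * P * real m \<le> real N / 2 - D * P"
    proof -
      have "(D * P) * real m \<le> (D * P) * (c1 * N + 1)" using m(2) DP by (intro mult_left_mono) auto
      also have "\<dots> = (4 * c1 * (D * P)) * (N / 4) + D * P" by (simp add: algebra_simps)
      also have "\<dots> \<le> 1 * (N / 4) + D * P" using c1(3) by (intro add_right_mono mult_right_mono) auto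
      finally show ?thesis using N(3) by linarith
    qed
    define K where "K = (\<Union>j\<in>{0..<int m}. columns (real N) j)"
    have finK: "finite K" unfolding K_def using finite_columns by blast
    have cube: "{i. \<forall>k. i $ k \<in> {0..<int m}} \<subseteq> K"
    proof
      fix i :: "int ^ 'd" assume "i \<in> {i. \<forall>k. i $ k \<in> {0..<int m}}"
      then have i: "\<And>k. i $ k \<in> {0..<int m}" by simp
      show "i \<in> K" unfolding K_def using cube_in_columns[OF DPm i] i[of k0] by blast
    qed
    have "m ^ CARD('d) \<le> card K" using card_mono[OF finK cube] unfolding card_cube .
    then have "real m ^ CARD('d) \<le> real (card K)" by (metis of_nat_le_iff of_nat_power)
    moreover have "(c1 * N) ^ CARD('d) \<le> real m ^ CARD('d)" using c1 by (intro power_mono m(1)) simp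
    ultimately have cardK: "(c1 * N) ^ CARD('d) \<le> real (card K)" by (rule order_trans[rotated])
    have K0: "real (card K) > 0" using cardK N(2) by (smt (verit) zero_less_power)
    then have Kne: "K \<noteq> {}" by auto
    have sumK: "(\<Sum>i\<in>K. f i) = (\<Sum>j\<in>{0..<int m}. \<Sum>i\<in>columns (real N) j. f i)" for f :: "int ^ 'd \<Rightarrow> real"
      unfolding K_def using finite_columns by (intro sum.UNION_disjoint) (auto simp: columns_def)
    have "{J \<in> space couplings. b \<le> tau n k0 Q N (\<delta> * N) J}
      \<subseteq> {J \<in> space couplings. a + \<eta> / 2 \<le> (\<Sum>i\<in>K. block_tau i J) / card K}"
    proof safe
      fix J assume J: "J \<in> space couplings" and bJ: "b \<le> tau n k0 Q N (\<delta> * N) J"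
      let ?r = "(L / N) ^ (CARD('d) - 1)"
      have r: "?r > 0" using L N by simp
      \<comment> \<open>The average over one layer is too large. The error terms \<open>P /
        N\<close> and \<open>T j / N\<close> use up half of \<open>\<eta>\<close>.\<close>
      have slab: "real (card (columns (real N) j)) * (a + \<eta> / 2) \<le> (\<Sum>i\<in>columns (real N) j. block_tau i J)"
        if j: "j \<in> {0..<int m}" for j
      proof -
        have "T * j \<le> T * m" using j T by (intro mult_left_mono) auto
        then have Tj: "T * j \<le> \<kappa> * N" using Tm by linarith
        also have "\<dots> \<le> \<delta> / 2 * N" using \<kappa>(2) by (intro mult_right_mono) auto
        finally have H: "T * j + h + D + 3 \<le> \<delta> * N" using N(5) by simp
        have "tau_bound * (T * j / N) \<le> tau_bound * \<kappa>" using Tj N tau_bound_pos by (intro mult_left_mono) (auto simp: divide_le_eq)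
        moreover have "tau_bound * (1 / P + (P + T * j) / N) = tau_bound / P + tau_bound * P / N + tau_bound * (T * j / N)"
          by (simp add: algebra_simps add_divide_distrib)
        ultimately have "tau_bound * (1 / P + (P + T * j) / N) \<le> tau_bound / P + \<eta> / 4 + \<eta> / 4"
          using N(4) \<kappa>(3) by linarith
        moreover have "b \<le> ?r * (\<Sum>i\<in>columns (real N) j. block_tau i J) + tau_bound * (1 / P + (P + T * j) / N)"
          using bJ tau_slab[OF J _ N(1) H] j by simp
        ultimately have "a + \<eta> / 2 \<le> ?r * (\<Sum>i\<in>columns (real N) j. block_tau i J)"
          using \<eta>_def by linarith
        moreover have "(real (card (columns (real N) j)) * ?r) * (a + \<eta> / 2) \<le> 1 * (a + \<eta> / 2)"
          using columns_share[of N j] N(1) a0 \<eta> by (intro mult_right_mono) auto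
        ultimately have "?r * (real (card (columns (real N) j)) * (a + \<eta> / 2)) \<le> ?r * (\<Sum>i\<in>columns (real N) j. block_tau i J)"
          by (simp add: algebra_simps)
        then show ?thesis using r by (simp only: mult_le_cancel_left_pos)
      qed
      have "real (card K) * (a + \<eta> / 2) = (\<Sum>i\<in>K. a + \<eta> / 2)" by simp
      also have "\<dots> = (\<Sum>j\<in>{0..<int m}. real (card (columns (real N) j)) * (a + \<eta> / 2))"
        unfolding sumK by simp
      also have "\<dots> \<le> (\<Sum>i\<in>K. block_tau i J)" unfolding sumK by (intro sum_mono slab)
      finally show "a + \<eta> / 2 \<le> (\<Sum>i\<in>K. block_tau i J) / card K" using K0 by (simp add: field_simps)
    qed
    moreover have "{J \<in> space couplings. a + \<eta> / 2 \<le> (\<Sum>i\<in>K. block_tau i J) / card K} \<in> events"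
      using measurable_block_tau by measurable
    ultimately have "prob {J \<in> space couplings. b \<le> tau n k0 Q N (\<delta> * N) J}
      \<le> prob {J \<in> space couplings. a + \<eta> / 2 \<le> (\<Sum>i\<in>K. block_tau i J) / card K}"
      by (intro finite_measure_mono)
    also have "\<dots> \<le> exp (- 2 * real (card K) * (\<eta> / 2)\<^sup>2 / (tau_bound - 0)\<^sup>2)"
    proof -
      interpret iid: iid_interval_bounded_random_variables couplings K block_tau "tau n k0 Q' L h" 0 tau_bound
        by (rule block_tau_iid[OF finK])
      interpret hoeff: Hoeffding_ineq_iid couplings K block_tau "tau n k0 Q' L h" 0 tau_bound a
        by unfold_locales (simp add: a_def)
      show ?thesis using hoeff.Hoeffding_ineq_ge'[of "\<eta> / 2"] \<eta> tau_bound_pos Kne by simp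
    qed
    also have "\<dots> \<le> exp (- c * real N ^ CARD('d))"
    proof -
      have "2 * (c1 * N) ^ CARD('d) * (\<eta> / 2)\<^sup>2 / tau_bound\<^sup>2 \<le> 2 * real (card K) * (\<eta> / 2)\<^sup>2 / tau_bound\<^sup>2"
        using cardK by (intro divide_right_mono mult_right_mono) auto
      then show ?thesis by (simp add: c_def power_mult_distrib algebra_simps)
    qed
    finally show ?case .
  qed
  then show ?thesis using c by blast
qed

end

section \<open>Limits\<close>

text \<open>A subsequence converges to some \<open>l\<close> by compactness. The sequence cannot exceed \<open>l\<close> by much
  eventually, as it is almost below each late term of the subsequence; and no late term can be much below
  \<open>l\<close>, as the subsequence is almost below each late term.\<close>
lemma almost_decreasing_convergent:
  fixes f :: "nat \<Rightarrow> real"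
  assumes range: "\<And>n. f n \<in> {0..B}"
    and dec: "\<And>e. e > 0 \<Longrightarrow> \<forall>\<^sub>F L in sequentially. \<forall>\<^sub>F N in sequentially. f N \<le> f L + e"
  shows "\<exists>l. f \<longlonglongrightarrow> l"
proof -
  have "compact {0..B}" by simp
  then obtain l r where r: "strict_mono r" and lim: "(f \<circ> r) \<longlonglongrightarrow> l"
    using range unfolding compact_def by metis
  have "f \<longlonglongrightarrow> l"
  proof (rule tendstoI)
    fix e :: real assume e: "e > 0"
    have near: "\<forall>\<^sub>F k in sequentially. \<bar>f (r k) - l\<bar> < e / 3"
      using tendstoD[OF lim, of "e / 3"] e by (simp add: dist_real_def comp_def)
    have dec3: "\<forall>\<^sub>F L in sequentially. \<forall>\<^sub>F N in sequentially. f N \<le> f L + e / 3"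
      using dec[of "e / 3"] e by simp
    have "\<forall>\<^sub>F k in sequentially. \<bar>f (r k) - l\<bar> < e / 3 \<and> (\<forall>\<^sub>F N in sequentially. f N \<le> f (r k) + e / 3)"
      by (intro eventually_conj near eventually_subseq[OF r dec3])
    then obtain k where k: "\<bar>f (r k) - l\<bar> < e / 3" "\<forall>\<^sub>F N in sequentially. f N \<le> f (r k) + e / 3"
      using eventually_happens'[OF sequentially_bot] by blast
    have upper: "\<forall>\<^sub>F N in sequentially. f N < l + e"
      using k(2) by (rule eventually_mono) (use k(1) e in linarith)
    have lower: "\<forall>\<^sub>F L in sequentially. l - e < f L"
      using dec3
    proof (rule eventually_mono)
      fix L assume "\<forall>\<^sub>F N in sequentially. f N \<le> f L + e / 3"
      from eventually_conj[OF near eventually_subseq[OF r this]]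
      obtain i where "\<bar>f (r i) - l\<bar> < e / 3" "f (r i) \<le> f L + e / 3"
        using eventually_happens'[OF sequentially_bot] by blast
      then show "l - e < f L" using e by linarith
    qed
    show "\<forall>\<^sub>F N in sequentially. dist (f N) l < e"
      using upper lower by eventually_elim (simp add: dist_real_def abs_less_iff)
  qed
  then show ?thesis ..
qed

lemma almost_decreasing_limits:
  fixes f g :: "nat \<Rightarrow> real"
  assumes f: "f \<longlonglongrightarrow> s" and g: "g \<longlonglongrightarrow> t"
    and le: "\<And>e. e > 0 \<Longrightarrow> \<forall>\<^sub>F L in sequentially. \<forall>\<^sub>F N in sequentially. g N \<le> f L + e"
  shows "t \<le> s"
proof (rule field_le_epsilon)
  fix e :: real assume e: "e > 0"
  have "\<forall>\<^sub>F L in sequentially. t \<le> f L + e"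
    using le[OF e] by (rule eventually_mono) (use g in \<open>auto intro: tendsto_upperbound\<close>)
  then show "t \<le> s + e"
    using f by (intro tendsto_lowerbound[of "\<lambda>L. f L + e"]) (auto intro: tendsto_intros)
qed

lemma (in prob_space) limit_in_probability_unique:
  assumes X: "\<And>N. X N \<in> borel_measurable M"
    and s: "tendsto_in_probability M X s" and t: "tendsto_in_probability M X t"
  shows "s = t"
proof (rule ccontr)
  assume "s \<noteq> t"
  define \<eta> where "\<eta> = \<bar>s - t\<bar> / 3"
  have \<eta>: "\<eta> > 0" using \<open>s \<noteq> t\<close> by (simp add: \<eta>_def)
  let ?A = "\<lambda>u N. {\<omega> \<in> space M. \<bar>X N \<omega> - u\<bar> > \<eta>}"
  have "(\<lambda>N. prob (?A s N) + prob (?A t N)) \<longlonglongrightarrow> 0 + 0"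
    using s t \<eta> unfolding tendsto_in_probability_def by (intro tendsto_add) auto
  moreover have "1 \<le> prob (?A s N) + prob (?A t N)" for N
  proof -
    have ev: "?A u N \<in> events" for u using X[of N] by measurable
    have "\<eta> < \<bar>x - s\<bar> \<or> \<eta> < \<bar>x - t\<bar>" for x
    proof (rule ccontr)
      assume "\<not> (\<eta> < \<bar>x - s\<bar> \<or> \<eta> < \<bar>x - t\<bar>)"
      then have "\<bar>x - s\<bar> \<le> \<eta>" "\<bar>x - t\<bar> \<le> \<eta>" by auto
      then have "\<bar>s - t\<bar> \<le> 2 * \<eta>" by linarith
      then show False using \<eta> by (simp add: \<eta>_def)
    qed
    then have "space M \<subseteq> ?A s N \<union> ?A t N" by blast
    then have "prob (space M) \<le> prob (?A s N \<union> ?A t N)" using ev by (intro finite_measure_mono) auto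
    also have "\<dots> \<le> prob (?A s N) + prob (?A t N)" using ev by (intro measure_Un_le) auto
    finally show ?thesis by (simp add: prob_space)
  qed
  ultimately have "(1 :: real) \<le> 0 + 0"
    by (intro tendsto_lowerbound[of "\<lambda>N. prob (?A s N) + prob (?A t N)"]) auto
  then show False by simp
qed

lemma tendsto_in_probability_cong:
  assumes "\<forall>\<^sub>F N in sequentially. \<forall>\<omega>\<in>space M. X N \<omega> = Y N \<omega>"
  shows "tendsto_in_probability M X t \<longleftrightarrow> tendsto_in_probability M Y t"
proof -
  have "((\<lambda>N. measure M {\<omega> \<in> space M. \<bar>X N \<omega> - t\<bar> > \<eta>}) \<longlonglongrightarrow> 0)
    \<longleftrightarrow> ((\<lambda>N. measure M {\<omega> \<in> space M. \<bar>Y N \<omega> - t\<bar> > \<eta>}) \<longlonglongrightarrow> 0)" for \<eta>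
  proof (rule tendsto_cong)
    show "\<forall>\<^sub>F N in sequentially. measure M {\<omega> \<in> space M. \<bar>X N \<omega> - t\<bar> > \<eta>} = measure M {\<omega> \<in> space M. \<bar>Y N \<omega> - t\<bar> > \<eta>}"
      using assms by (rule eventually_mono) (auto intro!: arg_cong[where f = "measure M"])
  qed
  then show ?thesis by (simp add: tendsto_in_probability_def)
qed

context prob_space
begin

text \<open>Bounded random variables that rarely exceed \<open>t + \<eta>\<close> and whose expectations converge to \<open>t\<close>
  cannot be below \<open>t - \<eta>\<close> with a probability bounded from below, since this would lower the
  expectations.\<close>
lemma tendsto_in_probability_of_mean:
  assumes X: "\<And>N. X N \<in> borel_measurable M" and B: "\<forall>\<^sub>F N in sequentially. \<forall>\<omega>\<in>space M. 0 \<le> X N \<omega> \<and> X N \<omega> \<le> B"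
    and mean: "(\<lambda>N. expectation (X N)) \<longlonglongrightarrow> t"
    and upper: "\<And>\<eta>. \<eta> > 0 \<Longrightarrow> (\<lambda>N. prob {\<omega> \<in> space M. t + \<eta> \<le> X N \<omega>}) \<longlonglongrightarrow> 0"
  shows "tendsto_in_probability M X t"
  unfolding tendsto_in_probability_def
proof (intro allI impI)
  fix \<eta> :: real assume \<eta>: "\<eta> > 0"
  have ev [measurable]: "{\<omega> \<in> space M. t + s \<le> X N \<omega>} \<in> events" "{\<omega> \<in> space M. X N \<omega> < t - s} \<in> events" for s N
    using X[of N] by measurable
  let ?U = "\<lambda>s N. {\<omega> \<in> space M. t + s \<le> X N \<omega>}" and ?L = "\<lambda>N. {\<omega> \<in> space M. X N \<omega> < t - \<eta>}"
  have "0 \<le> t"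
  proof (rule tendsto_lowerbound[OF mean])
    show "\<forall>\<^sub>F N in sequentially. 0 \<le> expectation (X N)"
      using B by (rule eventually_mono) (intro integral_nonneg_AE AE_I2, simp)
  qed simp
  \<comment> \<open>This is the expectation of a pointwise bound: \<open>X N\<close> is at most
    \<open>B\<close> on the upper event, at most \<open>t - \<eta>\<close> on the lower one, and
    less than \<open>t + s\<close> otherwise.\<close>
  have low: "\<forall>\<^sub>F N in sequentially. \<eta> * prob (?L N) \<le> t + s + B * prob (?U s N) - expectation (X N)" if s: "s > 0" for s
    using B
  proof (rule eventually_mono)
    fix N assume B: "\<forall>\<omega>\<in>space M. 0 \<le> X N \<omega> \<and> X N \<omega> \<le> B"
    have "expectation (X N) \<le> expectation (\<lambda>\<omega>. t + s + B * indicator (?U s N) \<omega> - \<eta> * indicator (?L N) \<omega>)"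
    proof (rule integral_mono)
      show "integrable M (X N)"
        using X[of N] B by (intro integrable_const_bound[where B = B] AE_I2) auto
      show "integrable M (\<lambda>\<omega>. t + s + B * indicator (?U s N) \<omega> - \<eta> * indicator (?L N) \<omega>)"
        by (intro Bochner_Integration.integrable_diff Bochner_Integration.integrable_add
            integrable_mult_right integrable_const integrable_real_indicator) (auto simp: emeasure_eq_measure)
      fix \<omega> assume w: "\<omega> \<in> space M"
      then show "X N \<omega> \<le> t + s + B * indicator (?U s N) \<omega> - \<eta> * indicator (?L N) \<omega>"
        using B \<open>0 \<le> t\<close> s \<eta> by (fastforce simp: indicator_def)
    qed
    also have "\<dots> = t + s + B * prob (?U s N) - \<eta> * prob (?L N)"
      by (subst Bochner_Integration.integral_diff; (subst Bochner_Integration.integral_add)?)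
        (auto simp: prob_space emeasure_eq_measure intro!: Bochner_Integration.integrable_add integrable_mult_right integrable_real_indicator)
    finally show "\<eta> * prob (?L N) \<le> t + s + B * prob (?U s N) - expectation (X N)" by simp
  qed
  have "(\<lambda>N. prob (?L N)) \<longlonglongrightarrow> 0"
  proof (rule tendstoI)
    fix e :: real assume e: "e > 0"
    define s where "s = \<eta> * e / 2"
    have s: "s > 0" using \<eta> e by (simp add: s_def)
    have "(\<lambda>N. t + s + B * prob (?U s N) - expectation (X N)) \<longlonglongrightarrow> t + s + B * 0 - t"
      by (intro tendsto_intros upper[OF s] mean)
    then have "\<forall>\<^sub>F N in sequentially. t + s + B * prob (?U s N) - expectation (X N) < \<eta> * e"
    proof (rule order_tendstoD(2))
      show "t + s + B * 0 - t < \<eta> * e" using s by (simp add: s_def)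
    qed
    then show "\<forall>\<^sub>F N in sequentially. dist (prob (?L N)) 0 < e"
      using low[OF s]
    proof eventually_elim
      case (elim N)
      then have "\<eta> * prob (?L N) < \<eta> * e" by linarith
      then show ?case using \<eta> by simp
    qed
  qed
  from tendsto_add[OF upper[OF \<eta>] this]
  have lim: "(\<lambda>N. prob (?U \<eta> N) + prob (?L N)) \<longlonglongrightarrow> 0" by simp
  show "(\<lambda>N. prob {\<omega> \<in> space M. \<eta> < \<bar>X N \<omega> - t\<bar>}) \<longlonglongrightarrow> 0"
  proof (rule tendsto_sandwich[OF _ _ tendsto_const lim])
    show "\<forall>\<^sub>F N in sequentially. prob {\<omega> \<in> space M. \<eta> < \<bar>X N \<omega> - t\<bar>} \<le> prob (?U \<eta> N) + prob (?L N)"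
    proof (rule always_eventually, rule allI)
      fix N
      have "prob {\<omega> \<in> space M. \<eta> < \<bar>X N \<omega> - t\<bar>} \<le> prob (?U \<eta> N \<union> ?L N)"
        by (intro finite_measure_mono) auto
      also have "\<dots> \<le> prob (?U \<eta> N) + prob (?L N)" by (intro measure_Un_le) auto
      finally show "prob {\<omega> \<in> space M. \<eta> < \<bar>X N \<omega> - t\<bar>} \<le> prob (?U \<eta> N) + prob (?L N)" .
    qed
  qed simp
qed

end

section \<open>The quenched surface tension\<close>

context rc_random
begin

definition mean_tau :: "real ^ 'd \<Rightarrow> 'd \<Rightarrow> (real ^ 'd \<Rightarrow> real ^ 'd) \<Rightarrow> real \<Rightarrow> nat \<Rightarrow> real" where
  "mean_tau n k0 Q \<delta> N = expectation (tau n k0 Q (real N) (\<delta> * real N))"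

lemma mean_tau_range:
  assumes dim: "CARD('d) \<ge> 2" and Q: "frame n k0 Q" and \<delta>: "\<delta> > 0"
  shows "mean_tau n k0 Q \<delta> N \<in> {0..tau_bound}"
proof (cases "N = 0")
  case True
  \<comment> \<open>For \<open>N = 0\<close> the area is 0 and the quotient in
    \<open>tau\<close> has the default value 0.\<close>
  have "(0 :: real) ^ (CARD('d) - 1) = 0" using dim by (intro zero_power) simp
  then have "tau n k0 Q 0 0 J = 0" for J unfolding tau_def by (simp only: div_by_0)
  then have "tau n k0 Q 0 0 = (\<lambda>_. 0)" by (rule ext)
  then show ?thesis using True tau_bound_pos by (simp add: mean_tau_def)
next
  case False
  then have N: "real N \<ge> 1" "\<delta> * real N > 0" using \<delta> by auto
  note b = tau_bounds[OF dim Q N]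
  have "expectation (tau n k0 Q (real N) (\<delta> * real N)) \<le> expectation (\<lambda>_. tau_bound)"
    using b by (intro integral_mono integrable_tau[OF dim Q N]) auto
  moreover have "0 \<le> expectation (tau n k0 Q (real N) (\<delta> * real N))"
    using b by (intro integral_nonneg_AE AE_I2) auto
  ultimately show ?thesis by (simp add: mean_tau_def prob_space)
qed

lemma eventually_real_ge: "\<forall>\<^sub>F N in sequentially. x \<le> real N"
  using eventually_ge_at_top[of "nat \<lceil>x\<rceil>"] by (rule eventually_mono) linarith

lemma eventually_rc_grid:
  fixes n :: "real ^ 'd"
  assumes dim: "CARD('d) \<ge> 2" and Q: "frame n k0 Q" and Q': "frame n k0 Q'"
    and \<delta>': "\<delta>' > 0" and e: "e > 0"
  shows "\<forall>\<^sub>F L in sequentially. rc_grid q \<beta> \<rho> n k0 Q Q' (real L) (\<delta>' * real L)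
    \<and> tau_bound / (real L + 2 * real CARD('d)) \<le> e"
  using eventually_real_ge[of 1] eventually_real_ge[of "(2 * real CARD('d) + 3) / \<delta>'"]
    eventually_real_ge[of "tau_bound / e"]
proof eventually_elim
  case (elim L)
  then have "\<delta>' * real L \<ge> 2 * real CARD('d) + 3" using \<delta>' by (simp add: field_simps)
  then interpret block_grid n k0 Q Q' "real L" "\<delta>' * real L"
    using elim dim Q Q' by unfold_locales auto
  have "rc_grid q \<beta> \<rho> n k0 Q Q' (real L) (\<delta>' * real L)"
    using elim \<open>\<delta>' * real L \<ge> 2 * real CARD('d) + 3\<close> by unfold_locales (auto simp: D_def)
  moreover have "tau_bound / (real L + 2 * real CARD('d)) \<le> tau_bound / real L"
    using elim tau_bound_pos by (intro divide_left_mono) auto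
  moreover have "tau_bound / real L \<le> e" using elim e by (simp add: field_simps)
  ultimately show ?case by simp
qed

text \<open>This comparison holds between any two cubes and ratios, so it yields both the existence of
  the limit and its independence of \<open>\<S>\<close> and \<open>\<delta>\<close>.\<close>
lemma mean_tau_almost_decreasing:
  assumes dim: "CARD('d) \<ge> 2" and Q: "frame n k0 Q" and Q': "frame n k0 Q'"
    and \<delta>: "\<delta> > 0" "\<delta>' > 0" and e: "e > 0"
  shows "\<forall>\<^sub>F L in sequentially. \<forall>\<^sub>F N in sequentially. mean_tau n k0 Q \<delta> N \<le> mean_tau n k0 Q' \<delta>' L + e"
proof (rule eventually_mono[OF eventually_rc_grid[OF dim Q Q' \<delta>(2), of "e / 2"]])
  show "0 < e / 2" using e by simp
  fix L assume grid: "rc_grid q \<beta> \<rho> n k0 Q Q' (real L) (\<delta>' * real L) \<and> tau_bound / (real L + 2 * real CARD('d)) \<le> e / 2"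
  then interpret rc_grid q \<beta> \<rho> dimension n k0 Q Q' "real L" "\<delta>' * real L" by simp
  show "\<forall>\<^sub>F N in sequentially. mean_tau n k0 Q \<delta> N \<le> mean_tau n k0 Q' \<delta>' L + e"
    using eventually_real_ge[of 1] eventually_real_ge[of "tau_bound * P / (e / 2)"]
      eventually_real_ge[of "(\<delta>' * real L + D + 3) / \<delta>"]
  proof eventually_elim
    case (elim N)
    have "mean_tau n k0 Q \<delta> N \<le> mean_tau n k0 Q' \<delta>' L + tau_bound * (1 / P + P / real N)"
      unfolding mean_tau_def using elim \<delta> by (intro mean_tau_le) (auto simp: field_simps)
    moreover have "tau_bound * P / real N \<le> e / 2" using elim e by (simp add: field_simps)
    moreover have "tau_bound / P \<le> e / 2" using grid by (simp add: P_def D_def)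
    moreover have "tau_bound * (1 / P + P / real N) = tau_bound / P + tau_bound * P / real N" by (simp add: algebra_simps)
    ultimately show ?case by linarith
  qed
qed

lemma mean_tau_limit:
  assumes dim: "CARD('d) \<ge> 2"
  shows "\<exists>t. \<forall>Q \<delta>. frame n k0 Q \<longrightarrow> \<delta> > 0 \<longrightarrow> mean_tau n k0 Q \<delta> \<longlonglongrightarrow> t"
proof -
  have ex: "\<exists>t. mean_tau n k0 Q \<delta> \<longlonglongrightarrow> t" if "frame n k0 Q" "\<delta> > 0" for Q \<delta>
    by (rule almost_decreasing_convergent[OF mean_tau_range[OF dim that]
          mean_tau_almost_decreasing[OF dim that(1,1,2,2)]])
  have eq: "s = t" if "frame n k0 Q" "\<delta> > 0" "mean_tau n k0 Q \<delta> \<longlonglongrightarrow> s"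
    "frame n k0 Q'" "\<delta>' > 0" "mean_tau n k0 Q' \<delta>' \<longlonglongrightarrow> t" for Q \<delta> s Q' \<delta>' t
  proof (rule antisym)
    show "s \<le> t" by (rule almost_decreasing_limits[OF that(6,3)]) (rule mean_tau_almost_decreasing[OF dim that(1,4,2,5)])
    show "t \<le> s" by (rule almost_decreasing_limits[OF that(3,6)]) (rule mean_tau_almost_decreasing[OF dim that(4,1,5,2)])
  qed
  show ?thesis
  proof (cases "\<exists>Q. frame n k0 Q")
    case True
    then obtain Q0 where Q0: "frame n k0 Q0" ..
    obtain t where t: "mean_tau n k0 Q0 1 \<longlonglongrightarrow> t" using ex[OF Q0, of 1] by auto
    have "mean_tau n k0 Q \<delta> \<longlonglongrightarrow> t" if Q: "frame n k0 Q" "\<delta> > 0" for Q \<delta>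
    proof -
      obtain s where s: "mean_tau n k0 Q \<delta> \<longlonglongrightarrow> s" using ex[OF Q] by auto
      then show ?thesis using eq[OF Q s Q0 _ t] by simp
    qed
    then show ?thesis by blast
  qed blast
qed

text \<open>Since the expectations converge, \<open>L\<close> can be fixed so large that \<open>upper_deviation\<close> applies to any
  level \<open>b > t\<close>.\<close>
lemma upper_deviation_limit:
  assumes dim: "CARD('d) \<ge> 2" and Q: "frame n k0 Q" and \<delta>: "\<delta> > 0"
    and t: "mean_tau n k0 Q \<delta> \<longlonglongrightarrow> t" and b: "t < b"
  shows "\<exists>c>0. \<forall>\<^sub>F N in sequentially.
    prob {J \<in> space couplings. b \<le> tau n k0 Q (real N) (\<delta> * real N) J} \<le> exp (- c * real N ^ CARD('d))"
proof -
  define e where "e = (b - t) / 3"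
  have e: "e > 0" using b by (simp add: e_def)
  have "\<forall>\<^sub>F L in sequentially. mean_tau n k0 Q \<delta> L < t + e" using order_tendstoD(2)[OF t, of "t + e"] e by simp
  from eventually_conj[OF this eventually_rc_grid[OF dim Q Q \<delta> e]]
  obtain L where coarse: "mean_tau n k0 Q \<delta> L < t + e" "rc_grid q \<beta> \<rho> n k0 Q Q (real L) (\<delta> * real L)"
    "tau_bound / (real L + 2 * real CARD('d)) \<le> e"
    using eventually_happens'[OF sequentially_bot] by blast
  interpret rc_grid q \<beta> \<rho> dimension n k0 Q Q "real L" "\<delta> * real L" by (rule coarse(2))
  have "tau_bound / P \<le> e" using coarse(3) by (simp add: P_def D_def)
  from add_less_le_mono[OF coarse(1) this]
  have "expectation (tau n k0 Q (real L) (\<delta> * real L)) + tau_bound / P < t + e + e"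
    by (simp only: mean_tau_def)
  also have "\<dots> < b" using b by (simp add: e_def field_simps)
  finally have "expectation (tau n k0 Q (real L) (\<delta> * real L)) + tau_bound / P < b" .
  then show ?thesis using \<delta> by (rule upper_deviation)
qed

lemma exp_volume_tendsto_0:
  assumes "CARD('d) \<ge> 2" "c > 0" shows "(\<lambda>N. exp (- c * real N ^ CARD('d))) \<longlonglongrightarrow> 0"
proof (rule tendsto_sandwich[OF _ _ tendsto_const])
  show "\<forall>\<^sub>F N in sequentially. exp (- c * real N ^ CARD('d)) \<le> exp (- c * real N)"
    using eventually_real_ge[of 1]
  proof eventually_elim
    case (elim N)
    have "real N ^ 1 \<le> real N ^ CARD('d)" using elim assms(1) by (intro power_increasing) auto
    then show ?case using assms(2) by simp
  qed
  show "(\<lambda>N. exp (- c * real N)) \<longlonglongrightarrow> 0"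
  proof (rule filterlim_compose[OF exp_at_bot])
    show "filterlim (\<lambda>N. - c * real N) at_bot sequentially"
      using assms(2) by (intro filterlim_tendsto_neg_mult_at_bot[OF tendsto_const] filterlim_real_sequentially) simp
  qed
qed simp

lemma tau_tendsto_in_probability:
  assumes dim: "CARD('d) \<ge> 2" and Q: "frame n k0 Q" and \<delta>: "\<delta> > 0"
    and t: "mean_tau n k0 Q \<delta> \<longlonglongrightarrow> t"
  shows "tendsto_in_probability couplings (\<lambda>N. tau n k0 Q (real N) (\<delta> * real N)) t"
proof (rule tendsto_in_probability_of_mean)
  show "tau n k0 Q (real N) (\<delta> * real N) \<in> borel_measurable couplings" for N
    by (rule measurable_tau[OF Q])
  show "\<forall>\<^sub>F N in sequentially. \<forall>J\<in>space couplings. 0 \<le> tau n k0 Q (real N) (\<delta> * real N) J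
      \<and> tau n k0 Q (real N) (\<delta> * real N) J \<le> tau_bound"
    using eventually_real_ge[of 1] by (rule eventually_mono) (use tau_bounds[OF dim Q] \<delta> in auto)
  show "(\<lambda>N. expectation (tau n k0 Q (real N) (\<delta> * real N))) \<longlonglongrightarrow> t"
    using t by (simp add: mean_tau_def[abs_def])
  fix \<eta> :: real assume "\<eta> > 0"
  then obtain c where c: "c > 0" "\<forall>\<^sub>F N in sequentially.
      prob {J \<in> space couplings. t + \<eta> \<le> tau n k0 Q (real N) (\<delta> * real N) J} \<le> exp (- c * real N ^ CARD('d))"
    using upper_deviation_limit[OF dim Q \<delta> t, of "t + \<eta>"] by auto
  show "(\<lambda>N. prob {J \<in> space couplings. t + \<eta> \<le> tau n k0 Q (real N) (\<delta> * real N) J}) \<longlonglongrightarrow> 0"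
    by (rule tendsto_sandwich[OF _ c(2) tendsto_const exp_volume_tendsto_0[OF dim c(1)]]) simp
qed

lemma tau_J_eq_tau:
  assumes Q: "frame n k0 Q" and S: "\<And>x L H. L > 0 \<Longrightarrow> sites (rect x L H S n) = box_sites Q k0 x L H"
    and N: "N > 0" and J: "J \<in> space couplings"
  shows "tau_J q \<beta> J 0 N H S n = tau n k0 Q N H J"
  unfolding tau_def
  using tau_J_eq_cut_cost[of 0 N H S n J] finite_box_sites[OF Q] coupling_range[OF J]
  by (simp add: S[OF N])

text \<open>The definite description in \<open>tau_q\<close> is proper: the limit \<open>t\<close> of the expectations is a limit in
  probability for all \<open>\<S>\<close> and \<open>\<delta>\<close>, and a single cube suffices for uniqueness.\<close>
lemma tau_q_eq:
  assumes dim: "CARD('d) \<ge> 2" and S0: "S0 \<in> unit_cubes n"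
    and t: "\<And>Q \<delta>. frame n k0 Q \<Longrightarrow> \<delta> > 0 \<Longrightarrow> mean_tau n k0 Q \<delta> \<longlonglongrightarrow> t"
  shows "tau_q \<rho> q \<beta> n = t"
proof -
  let ?lim = "\<lambda>t. \<forall>\<delta>>0. \<forall>S\<in>unit_cubes n. tendsto_in_probability couplings
       (\<lambda>N J. tau_J q \<beta> J 0 (real N) (\<delta> * real N) S n) t"
  have iff: "\<exists>Q. frame n k0 Q \<and> (\<forall>s. tendsto_in_probability couplings (\<lambda>N J. tau_J q \<beta> J 0 (real N) (\<delta> * real N) S n) s
      \<longleftrightarrow> tendsto_in_probability couplings (\<lambda>N. tau n k0 Q (real N) (\<delta> * real N)) s)"
    if S: "S \<in> unit_cubes n" for S \<delta>
  proof -
    obtain Q where Q: "frame n k0 Q" "\<And>x L H. L > 0 \<Longrightarrow> sites (rect x L H S n) = box_sites Q k0 x L H"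
      using unit_cube_frame[OF S, of k0] by blast
    have "\<forall>\<^sub>F N in sequentially. \<forall>J\<in>space couplings.
        tau_J q \<beta> J 0 (real N) (\<delta> * real N) S n = tau n k0 Q (real N) (\<delta> * real N) J"
      using eventually_gt_at_top[of 0] by (rule eventually_mono) (auto intro: tau_J_eq_tau[OF Q])
    from tendsto_in_probability_cong[OF this] show ?thesis using Q(1) by blast
  qed
  have "?lim t"
  proof (intro allI impI ballI)
    fix \<delta> :: real and S assume \<delta>: "\<delta> > 0" and "S \<in> unit_cubes n"
    then obtain Q where Q: "frame n k0 Q"
      "\<And>s. tendsto_in_probability couplings (\<lambda>N J. tau_J q \<beta> J 0 (real N) (\<delta> * real N) S n) s
        \<longleftrightarrow> tendsto_in_probability couplings (\<lambda>N. tau n k0 Q (real N) (\<delta> * real N)) s"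
      using iff[of S \<delta>] by blast
    show "tendsto_in_probability couplings (\<lambda>N J. tau_J q \<beta> J 0 (real N) (\<delta> * real N) S n) t"
      unfolding Q(2) by (rule tau_tendsto_in_probability[OF dim Q(1) \<delta> t[OF Q(1) \<delta>]])
  qed
  moreover have "s = t" if "?lim s" for s
  proof -
    obtain Q where Q: "frame n k0 Q" "\<And>s. tendsto_in_probability couplings (\<lambda>N J. tau_J q \<beta> J 0 (real N) (1 * real N) S0 n) s
      \<longleftrightarrow> tendsto_in_probability couplings (\<lambda>N. tau n k0 Q (real N) (1 * real N)) s"
      using iff[OF S0, of 1] by blast
    have "tendsto_in_probability couplings (\<lambda>N. tau n k0 Q (real N) (1 * real N)) s"
      using that[rule_format, OF zero_less_one S0] unfolding Q(2) .
    moreover have "tendsto_in_probability couplings (\<lambda>N. tau n k0 Q (real N) (1 * real N)) t"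
      using tau_tendsto_in_probability[OF dim Q(1) zero_less_one t[OF Q(1) zero_less_one]] .
    ultimately show ?thesis using measurable_tau[OF Q(1)] by (intro limit_in_probability_unique)
  qed
  ultimately show ?thesis unfolding tau_q_def by (rule the_equality)
qed

end

theorem theorem1p4:
  fixes \<rho> :: "real measure" and q \<beta> \<epsilon> \<delta> :: real
    and n :: "real ^ 'd::finite" and S :: "(real ^ 'd) set"
  assumes "CARD('d) \<ge> 2" and "q \<ge> 1" and "\<beta> \<ge> 0"
    and "prob_space \<rho>" and "sets \<rho> = sets (restrict_space borel {0..1})"
    and "norm n = 1" and "S \<in> unit_cubes n"
    and "\<epsilon> > 0" and "\<delta> > 0"
  shows "limsup (\<lambda>N. ereal (1 / real N ^ CARD('d)) *
           log_prob (measure (coupling_measure \<rho>)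
             {J \<in> space (coupling_measure \<rho>).
                tau_J q \<beta> J 0 (real N) (\<delta> * real N) S n \<ge> tau_q \<rho> q \<beta> n + \<epsilon>})) < 0"
proof -
  interpret rc_random q \<beta> \<rho> "TYPE('d)" by (intro rc_random.intro rc_params.intro rc_random_axioms.intro assms)
  obtain k0 :: 'd where True by simp
  obtain Q where Q: "frame n k0 Q" "\<And>x L H. L > 0 \<Longrightarrow> sites (rect x L H S n) = box_sites Q k0 x L H"
    using unit_cube_frame[OF assms(7), of k0] by blast
  obtain t where t: "\<And>Q \<delta>. frame n k0 Q \<Longrightarrow> \<delta> > 0 \<Longrightarrow> mean_tau n k0 Q \<delta> \<longlonglongrightarrow> t"
    using mean_tau_limit[OF assms(1)] by blast
  have tau_q: "tau_q \<rho> q \<beta> n = t" by (rule tau_q_eq[OF assms(1,7) t])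
  obtain c where c: "c > 0" and dev: "\<forall>\<^sub>F N in sequentially.
      prob {J \<in> space couplings. t + \<epsilon> \<le> tau n k0 Q (real N) (\<delta> * real N) J} \<le> exp (- c * real N ^ CARD('d))"
    using upper_deviation_limit[OF assms(1) Q(1) assms(9) t[OF Q(1) assms(9)], of "t + \<epsilon>"] assms(8) by auto
  let ?p = "\<lambda>N. prob {J \<in> space couplings. tau_q \<rho> q \<beta> n + \<epsilon> \<le> tau_J q \<beta> J 0 (real N) (\<delta> * real N) S n}"
  have "\<forall>\<^sub>F N in sequentially. ereal (1 / real N ^ CARD('d)) * log_prob (?p N) \<le> ereal (- c)"
    using dev eventually_gt_at_top[of 0]
  proof eventually_elim
    case (elim N)
    have "{J \<in> space couplings. tau_q \<rho> q \<beta> n + \<epsilon> \<le> tau_J q \<beta> J 0 (real N) (\<delta> * real N) S n}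
        = {J \<in> space couplings. t + \<epsilon> \<le> tau n k0 Q (real N) (\<delta> * real N) J}"
      unfolding tau_q using tau_J_eq_tau[OF Q] elim(2) by auto
    then have p: "?p N \<le> exp (- c * real N ^ CARD('d))" using elim(1) by simp
    show ?case
    proof (cases "?p N = 0")
      case True
      then show ?thesis using elim(2) by (simp add: log_prob_def)
    next
      case False
      then have "0 < ?p N" using measure_nonneg by (simp add: less_le)
      then have "ln (?p N) \<le> - c * real N ^ CARD('d)"
        using p ln_le_cancel_iff[of "?p N" "exp (- c * real N ^ CARD('d))"] by simp
      then have "1 / real N ^ CARD('d) * ln (?p N) \<le> 1 / real N ^ CARD('d) * (- c * real N ^ CARD('d))"
        by (intro mult_left_mono) auto
      also have "\<dots> = - c" using elim(2) by simp
      finally show ?thesis using False by (simp add: log_prob_def)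
    qed
  qed
  then have "limsup (\<lambda>N. ereal (1 / real N ^ CARD('d)) * log_prob (?p N)) \<le> ereal (- c)"
    by (rule Limsup_bounded)
  also have "\<dots> < 0" using c by simp
  finally show ?thesis .
qed

end
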